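(* Let $\mu_2(x)=\frac{1}{\pi(1+|x|^2)^2}$ for $x\in\mathbb{R}^2$, and write $\mathrm{d}\mu_2=\mu_2(x)\,\mathrm{d}x$. Then $$\log\left(\int_{\mathbb{R}^2}e^u\,\mathrm{d}\mu_2\right)-\int_{\mathbb{R}^2}u\,\mathrm{d}\mu_2\le\frac{1}{16\pi}\int_{\mathbb{R}^2}|\nabla u|^2\,\mathrm{d}x\qquad\text{for all } u\in H^1(\mathbb{R}^2).$$ Moreover, $u=0$ is an optimal function, i.e. equality holds for $u=0$.
   Context: $H^1(\mathbb{R}^2)$ is the usual Sobolev space of real-valued functions. The measure $\mathrm{d}\mu_2$ is a probability measure on $\mathbb{R}^2$. *)

theory Defs
  imports "HOL-Analysis.Analysis"
begin

text \<open>Everything is stated for genuine functions rather than classes modulo equality almost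
  everywhere, and measurability is with respect to the Lebesgue sigma-algebra, so every
  representative of a class is covered.\<close>

definition L2 :: "('a::euclidean_space \<Rightarrow> 'b::euclidean_space) \<Rightarrow> bool" where
  "L2 f \<longleftrightarrow> f \<in> borel_measurable lebesgue \<and> integrable lebesgue (\<lambda>x. (norm (f x))\<^sup>2)"

definition locally_integrable :: "('a::euclidean_space \<Rightarrow> 'b::euclidean_space) \<Rightarrow> bool" where
  "locally_integrable f \<longleftrightarrow> (\<forall>K. compact K \<longrightarrow> set_integrable lebesgue K f)"

text \<open>A function is of class \<open>C\<^sup>k\<^sup>+\<^sup>1\<close> on the whole space if it is differentiable and all its
  partial derivatives are of class \<open>C\<^sup>k\<close>.\<close>

primrec Ck :: "nat \<Rightarrow> ('a::euclidean_space \<Rightarrow> real) \<Rightarrow> bool" where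
  "Ck 0 f \<longleftrightarrow> continuous_on UNIV f"
| "Ck (Suc k) f \<longleftrightarrow> f differentiable_on UNIV \<and>
     (\<forall>i\<in>Basis. Ck k (\<lambda>x. frechet_derivative f (at x) i))"

definition test_function :: "('a::euclidean_space \<Rightarrow> real) \<Rightarrow> bool" where
  "test_function \<phi> \<longleftrightarrow> (\<forall>k. Ck k \<phi>) \<and> compact (closure {x. \<phi> x \<noteq> 0})"

definition has_weak_gradient ::
    "('a::euclidean_space \<Rightarrow> real) \<Rightarrow> ('a \<Rightarrow> 'a) \<Rightarrow> bool" where
  "has_weak_gradient u g \<longleftrightarrow> locally_integrable u \<and> locally_integrable g \<and>
     (\<forall>\<phi>. test_function \<phi> \<longrightarrow> (\<forall>i\<in>Basis.
        (LINT x|lebesgue. u x * frechet_derivative \<phi> (at x) i)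
          = - (LINT x|lebesgue. (g x \<bullet> i) * \<phi> x)))"

text \<open>A weak gradient is unique only up to equality almost everywhere; the choice operator
  picks a representative, and is meaningful only when some weak gradient exists.\<close>

definition weak_gradient :: "('a::euclidean_space \<Rightarrow> real) \<Rightarrow> 'a \<Rightarrow> 'a" where
  "weak_gradient u = (SOME g. has_weak_gradient u g)"

definition sobolev_H1 :: "('a::euclidean_space \<Rightarrow> real) set" where
  "sobolev_H1 = {u. L2 u \<and> (\<exists>g. has_weak_gradient u g \<and> L2 g)}"

definition mu2 :: "real ^ 2 \<Rightarrow> real" where
  "mu2 x = 1 / (pi * (1 + (norm x)\<^sup>2)\<^sup>2)"

definition dmu2 :: "(real ^ 2) measure" where
  "dmu2 = density lebesgue (\<lambda>x. ennreal (mu2 x))"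

end

theory Submission
  imports Defs
begin

text \<open>
  Write \<open>n(x) = 1 + |x|\<^sup>2\<close>. For a \<open>C\<^sup>1\<close> function \<open>w\<close> of compact support, the Knothe map \<open>T\<close> transports the
  measure with density \<open>e\<^sup>w n\<^sup>-\<^sup>2\<close> on a large square of half-side \<open>R\<close> onto a multiple of \<open>n\<^sup>-\<^sup>2\<close> on the
  square of half-side \<open>\<rho>R\<close>. As \<open>DT\<close> is triangular with positive diagonal, the arithmetic-geometric mean
  inequality bounds \<open>(det DT)\<^bsup>1/2\<^esup>\<close> by half the divergence of \<open>T\<close>; integration by parts and Young's
  inequality then yield the Onofri inequality up to terms which diverge logarithmically in \<open>R\<close> but
  cancel. Letting \<open>R\<close> tend to infinity, the sharp inequality is obtained for the dilation factor \<open>\<rho>\<close> with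
  \<open>\<rho>\<^sup>2 = \<integral>e\<^sup>w d\<mu>\<^sub>2\<close>. Mollification and a cutoff reduce \<open>H\<^sup>1\<close> functions to this case by Fatou's lemma.
\<close>

section \<open>The Knothe map between two squares\<close>

text \<open>For w = 0 and \<open>\<rho>\<close> = 1 the map T is the identity and every estimate is
  an equality, except for one bound on the boundary flux whose loss vanishes as R grows. Only the
  diagonal of DT enters its determinant and its divergence, so the argument runs fibre by fibre: the
  second component of T is never treated as a function of both variables, and no regularity across
  fibres is required. Squares are used because T carries each side to the corresponding side; the
  flux through the boundary is then explicit, and it does not disappear in the limit but balances
  the two masses. The constant 1/16 arises because the method works with a square root
  \<open>\<psi>\<close> of the density: half of its logarithmic gradient contains a quarter of the
  gradient of w, and this gets squared. The dilation is what creates a logarithm: with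
  \<open>\<rho>\<close> = 1 the divergent terms cancel completely, and only the weaker bound with 2
  pi (1 - sqrt (pi / Z)) in place of pi ln (Z / pi) would result, Z being the integral of e^w n^-2.
  For u in \<open>sobolev_H1\<close> the integrability of e^u is not known beforehand; it comes out
  of the same limit as the inequality.\<close>

lemma DERIV_integral_continuous:
  fixes q :: "real \<Rightarrow> real"
  assumes "continuous_on UNIV q" "a < x"
  shows "((\<lambda>x. integral {a..x} q) has_real_derivative q x) (at x)"
proof -
  have "((\<lambda>x. integral {a..x} q) has_real_derivative q x) (at x within {a..x+1})"
    by (rule integral_has_real_derivative)
       (use assms in \<open>auto intro: continuous_on_subset\<close>)
  moreover have "at x within {a..x+1} = at x"
    by (rule at_within_interior) (use assms in auto)
  ultimately show ?thesis by simp
qed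

text \<open>T solves G (T x) = F x for primitives F of \<open>p\<close> and G of \<open>q\<close>,
  so T is the inverse of G composed with F. Both densities live on the whole line; hence F and G
  extend past the endpoints, and the derivative of T is two-sided even at \<open>a\<close> and
  \<open>b\<close>.\<close>

lemma monotone_transport:
  fixes p q :: "real \<Rightarrow> real"
  assumes ab: "a < b" and cd: "c < d"
    and contp: "continuous_on UNIV p" and contq: "continuous_on UNIV q"
    and posp: "\<And>x. p x > 0" and posq: "\<And>x. q x > 0"
    and mass: "integral {a..b} p = integral {c..d} q"
  obtains T where "T a = c" "T b = d" "\<And>x. x \<in> {a..b} \<Longrightarrow> T x \<in> {c..d}"
    "\<And>x. x \<in> {a..b} \<Longrightarrow> (T has_real_derivative p x / q (T x)) (at x)"
proof -
  \<comment> \<open>The margins differ on purpose: G starts at \<open>c-2\<close> but is inverted on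
    \<open>{c-1..d+1}\<close>, so it is differentiable on all of that interval, and
    \<open>{G c..G d}\<close> lies in the interior of the domain of the inverse. The additive
    constant in F makes F a = G c, and equality of the masses then gives F b = G d.\<close>
  define G where "G = (\<lambda>x. integral {c-2..x} q)"
  define F where "F = (\<lambda>x. integral {a-1..x} p - integral {a-1..a} p + G c)"
  have dG: "(G has_real_derivative q x) (at x)" if "x > c-2" for x
    unfolding G_def using that by (rule DERIV_integral_continuous[OF contq])
  have dF: "(F has_real_derivative p x) (at x)" if "x > a-1" for x
    unfolding F_def by (rule derivative_eq_intros DERIV_integral_continuous[OF contp] that | simp)+
  have Gless: "G x < G y" if "c-2 < x" "x < y" for x y
    by (rule DERIV_pos_imp_increasing[OF that(2)]) (rule exI, rule conjI[OF dG posq], use that in simp)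
  have Fless: "F x < F y" if "a-1 < x" "x < y" for x y
    by (rule DERIV_pos_imp_increasing[OF that(2)]) (rule exI, rule conjI[OF dF posp], use that in simp)
  have Fa: "F a = G c" by (simp add: F_def)
  have ip: "p integrable_on {u..v}" and iq: "q integrable_on {u..v}" for u v
    by (auto intro!: integrable_continuous_interval intro: continuous_on_subset contp contq)
  have Fb: "F b = G d"
    using Henstock_Kurzweil_Integration.integral_combine[of "a-1" a b p]
      Henstock_Kurzweil_Integration.integral_combine[of "c-2" c d q] ab cd mass ip iq
    by (simp add: F_def G_def)
  define g where "g = the_inv_into {c-1..d+1} G"
  have injG: "inj_on G {c-1..d+1}"
  proof (rule linorder_inj_onI)
    show "G x \<noteq> G y" if "x < y" "x \<in> {c-1..d+1}" for x y using Gless[of x y] that by auto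
  qed auto
  have contG: "continuous_on {c-1..d+1} G"
    by (rule DERIV_continuous_on, rule has_field_derivative_at_within, rule dG) simp
  have imG: "G ` {c-1..d+1} = {G (c-1)..G (d+1)}"
  proof
    show "G ` {c-1..d+1} \<subseteq> {G (c-1)..G (d+1)}"
    proof clarify
      fix x assume "x \<in> {c-1..d+1}"
      then show "G x \<in> {G (c-1)..G (d+1)}"
        using Gless[of "c-1" x] Gless[of x "d+1"] by (cases "x = c-1"; cases "x = d+1") (auto simp: add.commute)
    qed
    show "{G (c-1)..G (d+1)} \<subseteq> G ` {c-1..d+1}"
    proof
      fix y assume "y \<in> {G (c-1)..G (d+1)}"
      then show "y \<in> G ` {c-1..d+1}" using IVT'[of G "c-1" y "d+1"] contG cd by auto
    qed
  qed
  have contg: "continuous_on {G (c-1)..G (d+1)} g"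
    using continuous_on_inv_into[OF contG _ injG] imG unfolding g_def by auto
  have Gg: "G (g y) = y" if "y \<in> {G (c-1)..G (d+1)}" for y
    unfolding g_def by (rule f_the_inv_into_f[OF injG]) (use imG that in auto)
  have gG: "g (G x) = x" if "x \<in> {c-1..d+1}" for x
    unfolding g_def by (rule the_inv_into_f_f[OF injG that])
  have Gc: "G (c-1) < G c" "G d < G (d+1)" "G c < G d" using Gless[of "c-1" c] Gless[of d "d+1"] Gless[of c d] cd by auto
  have gran: "g y \<in> {c..d}" if y: "y \<in> {G c..G d}" for y
  proof -
    obtain x where x: "c \<le> x" "x \<le> d" "G x = y"
      using IVT'[of G c y d] y cd continuous_on_subset[OF contG, of "{c..d}"] by auto
    then show ?thesis using gG[of x] by auto
  qed
  have dg: "(g has_real_derivative inverse (q (g y))) (at y)" if y: "y \<in> {G c..G d}" for y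
  proof (rule DERIV_inverse_function[where a="G (c-1)" and b="G (d+1)"])
    show "(G has_real_derivative q (g y)) (at (g y))" using gran[OF y] by (intro dG) simp
    show "q (g y) \<noteq> 0" using posq[of "g y"] by simp
    show "G (c-1) < y" "y < G (d+1)" using y Gc by auto
    then show "isCont g y" by (intro continuous_on_interior[OF contg]) auto
  qed (use Gg in auto)
  have Fran: "F x \<in> {G c..G d}" if "x \<in> {a..b}" for x
    using Fless[of a x] Fless[of x b] Fa Fb that by (cases "x = a"; cases "x = b") auto
  show ?thesis
  proof (rule that[of "\<lambda>x. g (F x)"])
    show "g (F a) = c" "g (F b) = d" using Fa Fb gG cd by auto
    show "g (F x) \<in> {c..d}" if "x \<in> {a..b}" for x using gran Fran that by blast
    show "((\<lambda>x. g (F x)) has_real_derivative p x / q (g (F x))) (at x)" if x: "x \<in> {a..b}" for x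
      using DERIV_chain2[OF dg[OF Fran[OF x]] dF[of x]] x by (simp add: field_simps)
  qed
qed

lemma has_integral_comp_deriv:
  fixes T f :: "real \<Rightarrow> real"
  assumes "a \<le> b" "c \<le> d" "T a = c" "T b = d" "\<And>x. x \<in> {a..b} \<Longrightarrow> T x \<in> {c..d}"
    "\<And>x. x \<in> {a..b} \<Longrightarrow> (T has_real_derivative T' x) (at x)" "continuous_on UNIV f"
  shows "((\<lambda>x. T' x * f (T x)) has_integral integral {c..d} f) {a..b}"
proof -
  have "((\<lambda>x. T' x *\<^sub>R f (T x)) has_integral integral {T a..T b} f) {a..b}"
    by (rule has_integral_substitution[where c=c and d=d])
       (use assms in \<open>auto intro: continuous_on_subset has_field_derivative_at_within\<close>)
  then show ?thesis using assms by simp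
qed

lemma has_integral_deriv:
  fixes F :: "real \<Rightarrow> real"
  assumes "a \<le> b" "\<And>x. x \<in> {a..b} \<Longrightarrow> (F has_real_derivative f x) (at x)"
  shows "(f has_integral F b - F a) {a..b}"
  by (rule fundamental_theorem_of_calculus)
     (use assms in \<open>auto intro: has_vector_derivative_at_within simp: has_real_derivative_iff_has_vector_derivative\<close>)

text \<open>
  The part of the Knothe argument on a vertical fibre: \<open>\<psi>\<^sup>2\<close> is the density along the fibre, \<open>\<alpha>\<close> the
  derivative of the first component of the map, and \<open>e\<close> is minus half the logarithmic derivative of \<open>\<psi>\<close>.
\<close>

lemma knothe_fibre:
  fixes \<psi> e :: "real \<Rightarrow> real"
  assumes R: "R > 0" and S: "S > 0" and k: "k > 0" and \<alpha>: "\<alpha> > 0"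
    and pos: "\<And>y. \<psi> y > 0"
    and deriv: "\<And>y. (\<psi> has_real_derivative - 2 * \<psi> y * e y) (at y)"
    and cont: "continuous_on UNIV e"
    and mass: "integral {-R..R} (\<lambda>y. (\<psi> y)\<^sup>2) = integral {-S..S} (\<lambda>t. \<alpha> / (k + t\<^sup>2)\<^sup>2)"
  shows "\<alpha> * integral {-S..S} (\<lambda>t. 1 / (k + t\<^sup>2))
    \<le> \<alpha> / 2 * integral {-R..R} \<psi> + S / 2 * (\<psi> R + \<psi> (-R))
      + \<alpha> / 2 * integral {-S..S} (\<lambda>t. t\<^sup>2 / (k + t\<^sup>2)\<^sup>2) + 1 / 2 * integral {-R..R} (\<lambda>y. (e y)\<^sup>2)"
proof -
  have kt: "k + t\<^sup>2 > 0" for t :: real using k by (simp add: add_pos_nonneg)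
  have kt0: "k + t\<^sup>2 \<noteq> 0" for t :: real using kt[of t] by simp
  have cpsi: "continuous_on UNIV \<psi>"
    by (rule DERIV_continuous_on, rule has_field_derivative_at_within, rule deriv)
  obtain T where T: "T (-R) = -S" "T R = S" "\<And>x. x \<in> {-R..R} \<Longrightarrow> T x \<in> {-S..S}"
    and dT: "\<And>x. x \<in> {-R..R} \<Longrightarrow> (T has_real_derivative (\<psi> x)\<^sup>2 / (\<alpha> / (k + (T x)\<^sup>2)\<^sup>2)) (at x)"
  proof (rule monotone_transport[of "-R" R "-S" S "\<lambda>y. (\<psi> y)\<^sup>2" "\<lambda>t. \<alpha> / (k + t\<^sup>2)\<^sup>2"])
    show "continuous_on UNIV (\<lambda>t. \<alpha> / (k + t\<^sup>2)\<^sup>2)" by (intro continuous_intros) (simp add: kt0)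
    show "continuous_on UNIV (\<lambda>y. (\<psi> y)\<^sup>2)" by (intro continuous_intros cpsi)
    show "0 < (\<psi> x)\<^sup>2" for x using pos[of x] by simp
    show "0 < \<alpha> / (k + x\<^sup>2)\<^sup>2" for x using kt[of x] \<alpha> by simp
  qed (use R S mass in auto)
  \<comment> \<open>\<open>\<alpha> * T'\<close> is the Jacobian determinant of the planar map. It
    equals the square of \<open>\<psi>\<close> times \<open>k + T\<^sup>2\<close>, so this product
    is the geometric mean of the two diagonal entries.\<close>
  define T' where "T' = (\<lambda>x. (\<psi> x)\<^sup>2 / (\<alpha> / (k + (T x)\<^sup>2)\<^sup>2))"
  have dT': "(T has_real_derivative T' x) (at x)" if "x \<in> {-R..R}" for x
    using dT[OF that] unfolding T'_def .
  have subst: "((\<lambda>x. T' x * f (T x)) has_integral integral {-S..S} f) {-R..R}"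
    if "continuous_on UNIV f" for f
    by (rule has_integral_comp_deriv) (use R S T dT' that in auto)
  have i1: "((\<lambda>x. T' x * (1 / (k + (T x)\<^sup>2))) has_integral integral {-S..S} (\<lambda>t. 1 / (k + t\<^sup>2))) {-R..R}"
    by (rule subst) (intro continuous_intros, simp add: kt0)
  have i2: "((\<lambda>x. T' x * ((T x)\<^sup>2 / (k + (T x)\<^sup>2)\<^sup>2)) has_integral integral {-S..S} (\<lambda>t. t\<^sup>2 / (k + t\<^sup>2)\<^sup>2)) {-R..R}"
    by (rule subst) (intro continuous_intros, simp add: kt0)
  \<comment> \<open>The integrand is the derivative of \<open>\<psi>\<close> times T. The endpoints
    go to -S and S, so the boundary values become S times the sum of the end values of
    \<open>\<psi>\<close>.\<close>
  have i3: "((\<lambda>x. \<psi> x * T' x + (- 2 * \<psi> x * e x) * T x) has_integral \<psi> R * T R - \<psi> (-R) * T (-R)) {-R..R}"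
    by (rule has_integral_deriv) (use R in \<open>auto simp: T'_def intro!: derivative_eq_intros deriv dT\<close>)
  have i4: "(\<psi> has_integral integral {-R..R} \<psi>) {-R..R}"
    by (intro integrable_integral integrable_continuous_interval continuous_on_subset[OF cpsi]) auto
  have i5: "((\<lambda>y. (e y)\<^sup>2) has_integral integral {-R..R} (\<lambda>y. (e y)\<^sup>2)) {-R..R}"
    by (intro integrable_integral integrable_continuous_interval continuous_intros continuous_on_subset[OF cont]) auto
  \<comment> \<open>arithmetic-geometric mean of \<open>\<alpha>\<close> and \<open>T'\<close>, then Young's inequality for \<open>\<psi> T e\<close>\<close>
  have pw: "\<alpha> * (T' x * (1 / (k + (T x)\<^sup>2))) \<le> \<alpha> / 2 * \<psi> x
      + 1 / 2 * (\<psi> x * T' x + (- 2 * \<psi> x * e x) * T x)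
      + \<alpha> / 2 * (T' x * ((T x)\<^sup>2 / (k + (T x)\<^sup>2)\<^sup>2)) + 1 / 2 * (e x)\<^sup>2" for x
  proof -
    define m where "m = k + (T x)\<^sup>2"
    have m: "m > 0" unfolding m_def by (rule kt)
    have T'm: "T' x = (\<psi> x * m)\<^sup>2 / \<alpha>" unfolding T'_def m_def[symmetric] by (simp add: power_mult_distrib)
    have "2 * \<alpha> * (\<psi> x * m) \<le> \<alpha>\<^sup>2 + (\<psi> x * m)\<^sup>2"
      using sum_squares_bound[of \<alpha> "\<psi> x * m"] by simp
    then have "2 * (\<psi> x * m) \<le> \<alpha> + T' x"
      using \<alpha> unfolding T'm by (simp add: field_simps power2_eq_square)
    then have a: "\<psi> x * (2 * (\<psi> x * m)) \<le> \<psi> x * (\<alpha> + T' x)" using pos[of x] by simp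
    have b: "2 * (\<psi> x * T x) * e x \<le> (\<psi> x * T x)\<^sup>2 + (e x)\<^sup>2"
      using sum_squares_bound[of "\<psi> x * T x" "e x"] by simp
    have c: "\<alpha> * (T' x * (1 / m)) = (\<psi> x)\<^sup>2 * m" using m \<alpha> unfolding T'm by (simp add: field_simps power2_eq_square)
    have d: "\<alpha> * (T' x * ((T x)\<^sup>2 / m\<^sup>2)) = (\<psi> x * T x)\<^sup>2" using m \<alpha> unfolding T'm by (simp add: field_simps power2_eq_square)
    show ?thesis using a b c d unfolding m_def[symmetric] by (simp add: algebra_simps power2_eq_square)
  qed
  note h = has_integral_le[OF has_integral_mult_right[OF i1]
      has_integral_add[OF has_integral_add[OF has_integral_add[OF
        has_integral_mult_right[OF i4] has_integral_mult_right[OF i3]]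
        has_integral_mult_right[OF i2]] has_integral_mult_right[OF i5]], OF pw]
  show ?thesis using h by (simp add: T algebra_simps)
qed

lemma integral_pos_continuous:
  fixes f :: "real \<Rightarrow> real"
  assumes "a < b" "continuous_on UNIV f" "\<And>x. f x > 0"
  shows "integral {a..b} f > 0"
proof -
  have "integral {a..b} (\<lambda>x. 0) < integral {a..b} f"
    by (rule integral_less_real) (use assms in \<open>auto intro: continuous_on_subset\<close>)
  then show ?thesis by simp
qed

lemma continuous_on_parametric_integral:
  fixes f :: "real \<Rightarrow> real \<Rightarrow> real"
  assumes "continuous_on UNIV (\<lambda>(x, y). f x y)"
  shows "continuous_on UNIV (\<lambda>x. integral {a..b} (f x))"
  using integral_continuous_on_param[of UNIV a b f] continuous_on_subset[OF assms] by simp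

lemma continuous_on_slice:
  assumes "continuous_on UNIV (\<lambda>(x, y). f x y)" "continuous_on S g" "continuous_on S h"
  shows "continuous_on S (\<lambda>x. f (g x) (h x))"
  using continuous_on_compose2[OF assms(1) continuous_on_Pair[OF assms(2,3)]] by simp

text \<open>The first component transports the marginal \<open>p\<close> to the marginal
  \<open>C\<close>. On the fibre over x, \<open>knothe_fibre\<close> applies with
  \<open>\<alpha>\<close> the derivative of that component and k = 1 + (T x)^2. It returns only a
  number, so the fibre maps never have to be assembled or shown measurable in x. What remains is an
  integration by parts in x for \<open>\<Psi>\<close>, the integral of \<open>\<psi>\<close> over a
  fibre, and Young's inequality for the term with \<open>e1\<close>.\<close>

theorem knothe_inequality:
  fixes \<psi> e1 e2 :: "real \<Rightarrow> real \<Rightarrow> real"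
  assumes R: "R > 0" and S: "S > 0"
    and pos: "\<And>x y. \<psi> x y > 0"
    and d1: "\<And>x y. ((\<lambda>x. \<psi> x y) has_real_derivative - 2 * \<psi> x y * e1 x y) (at x)"
    and d2: "\<And>x y. ((\<lambda>y. \<psi> x y) has_real_derivative - 2 * \<psi> x y * e2 x y) (at y)"
    and c0: "continuous_on UNIV (\<lambda>(x, y). \<psi> x y)"
    and c1: "continuous_on UNIV (\<lambda>(x, y). e1 x y)"
    and c2: "continuous_on UNIV (\<lambda>(x, y). e2 x y)"
    and mass: "integral {-R..R} (\<lambda>x. integral {-R..R} (\<lambda>y. (\<psi> x y)\<^sup>2))
       = integral {-S..S} (\<lambda>s. integral {-S..S} (\<lambda>t. 1 / (1 + s\<^sup>2 + t\<^sup>2)\<^sup>2))"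
  shows "integral {-S..S} (\<lambda>s. integral {-S..S} (\<lambda>t. 1 / (1 + s\<^sup>2 + t\<^sup>2)))
    \<le> S / 2 * (integral {-R..R} (\<lambda>x. \<psi> x R + \<psi> x (-R)) + integral {-R..R} (\<lambda>y. \<psi> R y + \<psi> (-R) y))
      + 1 / 2 * integral {-S..S} (\<lambda>s. integral {-S..S} (\<lambda>t. (s\<^sup>2 + t\<^sup>2) / (1 + s\<^sup>2 + t\<^sup>2)\<^sup>2))
      + 1 / 2 * integral {-R..R} (\<lambda>x. integral {-R..R} (\<lambda>y. (e1 x y)\<^sup>2 + (e2 x y)\<^sup>2))"
proof -
  have k0: "1 + s\<^sup>2 + t\<^sup>2 > 0" for s t :: real by (simp add: add_pos_nonneg)
  have k1: "1 + s\<^sup>2 > 0" for s :: real by (simp add: add_pos_nonneg)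
  have k0': "1 + s\<^sup>2 + t\<^sup>2 \<noteq> 0" for s t :: real using k0[of s t] by simp
  note [continuous_intros] = continuous_on_slice[OF c0] continuous_on_slice[OF c1] continuous_on_slice[OF c2]
  define p where "p = (\<lambda>x. integral {-R..R} (\<lambda>y. (\<psi> x y)\<^sup>2))"
  define A where "A = (\<lambda>s. integral {-S..S} (\<lambda>t. 1 / (1 + s\<^sup>2 + t\<^sup>2)))"
  define B where "B = (\<lambda>s. integral {-S..S} (\<lambda>t. t\<^sup>2 / (1 + s\<^sup>2 + t\<^sup>2)\<^sup>2))"
  define C where "C = (\<lambda>s. integral {-S..S} (\<lambda>t. 1 / (1 + s\<^sup>2 + t\<^sup>2)\<^sup>2))"
  define \<Psi> where "\<Psi> = (\<lambda>x. integral {-R..R} (\<psi> x))"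
  define \<Psi>' where "\<Psi>' = (\<lambda>x. integral {-R..R} (\<lambda>y. - 2 * \<psi> x y * e1 x y))"
  define E1 where "E1 = (\<lambda>x. integral {-R..R} (\<lambda>y. (e1 x y)\<^sup>2))"
  define E2 where "E2 = (\<lambda>x. integral {-R..R} (\<lambda>y. (e2 x y)\<^sup>2))"
  note parint = continuous_on_parametric_integral
  have cp: "continuous_on UNIV p" unfolding p_def
    by (intro parint) (auto simp: case_prod_beta intro!: continuous_intros)
  have cA: "continuous_on UNIV A" unfolding A_def
    by (intro parint) (auto simp: case_prod_beta k0' intro!: continuous_intros)
  have cB: "continuous_on UNIV B" unfolding B_def
    by (intro parint) (auto simp: case_prod_beta k0' intro!: continuous_intros)
  have cC: "continuous_on UNIV C" unfolding C_def
    by (intro parint) (auto simp: case_prod_beta k0' intro!: continuous_intros)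
  have cE1: "continuous_on UNIV E1" unfolding E1_def
    by (intro parint) (auto simp: case_prod_beta intro!: continuous_intros)
  have cE2: "continuous_on UNIV E2" unfolding E2_def
    by (intro parint) (auto simp: case_prod_beta intro!: continuous_intros)
  have ppos: "p x > 0" for x unfolding p_def
    by (rule integral_pos_continuous) (use R pos in \<open>auto intro!: continuous_intros simp: less_imp_neq[OF pos, symmetric]\<close>)
  have Cpos: "C x > 0" for x unfolding C_def
    by (rule integral_pos_continuous) (use S in \<open>auto intro!: continuous_intros simp: k0'\<close>)
  obtain T where T: "T (-R) = -S" "T R = S" "\<And>x. x \<in> {-R..R} \<Longrightarrow> T x \<in> {-S..S}"
    and dT: "\<And>x. x \<in> {-R..R} \<Longrightarrow> (T has_real_derivative p x / C (T x)) (at x)"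
    by (rule monotone_transport[of "-R" R "-S" S p C])
       (use R S mass cp cC ppos Cpos in \<open>auto simp: p_def C_def\<close>)
  define T' where "T' = (\<lambda>x. p x / C (T x))"
  have T'pos: "T' x > 0" for x unfolding T'_def using ppos Cpos by simp
  have dT': "(T has_real_derivative T' x) (at x)" if "x \<in> {-R..R}" for x
    using dT[OF that] unfolding T'_def .
  have subst: "((\<lambda>x. T' x * f (T x)) has_integral integral {-S..S} f) {-R..R}"
    if "continuous_on UNIV f" for f
    by (rule has_integral_comp_deriv) (use R S T dT' that in auto)
  have d\<Psi>: "(\<Psi> has_real_derivative \<Psi>' x) (at x)" for x
  proof -
    have "((\<lambda>x. integral (cbox (-R) R) (\<psi> x)) has_field_derivative
        integral (cbox (-R) R) (\<lambda>y. - 2 * \<psi> x y * e1 x y)) (at x within UNIV)"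
      by (rule leibniz_rule_field_derivative)
         (use d1 in \<open>auto intro!: integrable_continuous_interval continuous_intros simp: case_prod_beta\<close>)
    then show ?thesis by (simp add: \<Psi>_def \<Psi>'_def)
  qed
  have i1: "((\<lambda>x. T' x * A (T x)) has_integral integral {-S..S} A) {-R..R}"
    by (rule subst[OF cA])
  have i2: "((\<lambda>x. T' x * B (T x)) has_integral integral {-S..S} B) {-R..R}"
    by (rule subst[OF cB])
  have i3: "((\<lambda>x. T' x * ((T x)\<^sup>2 * C (T x))) has_integral integral {-S..S} (\<lambda>s. s\<^sup>2 * C s)) {-R..R}"
    by (rule subst) (intro continuous_intros cC)
  \<comment> \<open>Derivative of T times \<open>\<Psi>\<close>; as T is -S and S at the ends, this
    is the flux through the two sides with constant first coordinate.\<close>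
  have i4: "((\<lambda>x. T' x * \<Psi> x + T x * \<Psi>' x) has_integral T R * \<Psi> R - T (-R) * \<Psi> (-R)) {-R..R}"
    by (rule has_integral_deriv) (use R in \<open>auto simp: T'_def intro!: derivative_eq_intros d\<Psi> dT\<close>)
  have i5: "((\<lambda>x. \<psi> x R + \<psi> x (-R)) has_integral integral {-R..R} (\<lambda>x. \<psi> x R + \<psi> x (-R))) {-R..R}"
    by (intro integrable_integral integrable_continuous_interval continuous_intros)
  have i6: "(E1 has_integral integral {-R..R} E1) {-R..R}"
    by (intro integrable_integral integrable_continuous_interval continuous_on_subset[OF cE1]) auto
  have i7: "(E2 has_integral integral {-R..R} E2) {-R..R}"
    by (intro integrable_integral integrable_continuous_interval continuous_on_subset[OF cE2]) auto
  have pw: "T' x * A (T x) \<le> 1 / 2 * (T' x * \<Psi> x + T x * \<Psi>' x) + S / 2 * (\<psi> x R + \<psi> x (-R))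
      + 1 / 2 * (T' x * B (T x)) + 1 / 2 * (T' x * ((T x)\<^sup>2 * C (T x))) + 1 / 2 * E1 x + 1 / 2 * E2 x" for x
  proof -
    have "T' x * integral {-S..S} (\<lambda>t. 1 / ((1 + (T x)\<^sup>2) + t\<^sup>2))
      \<le> T' x / 2 * integral {-R..R} (\<psi> x) + S / 2 * (\<psi> x R + \<psi> x (-R))
        + T' x / 2 * integral {-S..S} (\<lambda>t. t\<^sup>2 / ((1 + (T x)\<^sup>2) + t\<^sup>2)\<^sup>2) + 1 / 2 * integral {-R..R} (\<lambda>y. (e2 x y)\<^sup>2)"
    proof (rule knothe_fibre[OF R S k1 T'pos pos d2])
      show "continuous_on UNIV (e2 x)" by (intro continuous_intros)
      \<comment> \<open>The transport equation of the marginals is exactly the equality of masses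
        that the fibre lemma requires.\<close>
      have "T' x * C (T x) = p x" using Cpos[of "T x"] by (simp add: T'_def)
      then show "integral {-R..R} (\<lambda>y. (\<psi> x y)\<^sup>2) = integral {-S..S} (\<lambda>t. T' x / (1 + (T x)\<^sup>2 + t\<^sup>2)\<^sup>2)"
        unfolding p_def C_def by (simp add: divide_inverse)
    qed
    then have a: "T' x * A (T x) \<le> T' x / 2 * \<Psi> x + S / 2 * (\<psi> x R + \<psi> x (-R)) + T' x / 2 * B (T x) + 1 / 2 * E2 x"
      by (simp add: A_def \<Psi>_def B_def E2_def)
    \<comment> \<open>Young's inequality for the first coordinate, integrated over the fibre. Since
      T x is constant on it, the square term is (T x)^2 times \<open>p x\<close>, which the
      transport equation turns into an integral over the target.\<close>
    have "((\<lambda>y. - T x * (- 2 * \<psi> x y * e1 x y)) has_integral - T x * \<Psi>' x) {-R..R}"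
      unfolding \<Psi>'_def
      by (intro has_integral_mult_right integrable_integral integrable_continuous_interval continuous_intros)
    moreover have "((\<lambda>y. (T x)\<^sup>2 * (\<psi> x y)\<^sup>2 + (e1 x y)\<^sup>2) has_integral (T x)\<^sup>2 * p x + E1 x) {-R..R}"
      unfolding p_def E1_def
      by (intro has_integral_add has_integral_mult_right integrable_integral integrable_continuous_interval continuous_intros)
    ultimately have "- T x * \<Psi>' x \<le> (T x)\<^sup>2 * p x + E1 x"
    proof (rule has_integral_le)
      show "- T x * (- 2 * \<psi> x y * e1 x y) \<le> (T x)\<^sup>2 * (\<psi> x y)\<^sup>2 + (e1 x y)\<^sup>2" for y
        using sum_squares_bound[of "T x * \<psi> x y" "e1 x y"] by (simp add: power_mult_distrib algebra_simps)
    qed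
    moreover have "(T x)\<^sup>2 * p x = T' x * ((T x)\<^sup>2 * C (T x))"
      using Cpos[of "T x"] by (simp add: T'_def)
    ultimately have "- T x * \<Psi>' x \<le> T' x * ((T x)\<^sup>2 * C (T x)) + E1 x" by linarith
    then show ?thesis using a by (simp add: algebra_simps)
  qed
  note h = has_integral_le[OF i1
      has_integral_add[OF has_integral_add[OF has_integral_add[OF has_integral_add[OF has_integral_add[OF
        has_integral_mult_right[OF i4] has_integral_mult_right[OF i5]]
        has_integral_mult_right[OF i2]] has_integral_mult_right[OF i3]]
        has_integral_mult_right[OF i6]] has_integral_mult_right[OF i7]] pw]
  have "integral {-S..S} (\<lambda>s. integral {-S..S} (\<lambda>t. (s\<^sup>2 + t\<^sup>2) / (1 + s\<^sup>2 + t\<^sup>2)\<^sup>2))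
      = integral {-S..S} (\<lambda>s. B s + s\<^sup>2 * C s)"
  proof (rule integral_cong)
    fix s
    have "((\<lambda>t. t\<^sup>2 / (1 + s\<^sup>2 + t\<^sup>2)\<^sup>2 + s\<^sup>2 * (1 / (1 + s\<^sup>2 + t\<^sup>2)\<^sup>2)) has_integral B s + s\<^sup>2 * C s) {-S..S}"
      unfolding B_def C_def
      by (intro has_integral_add has_integral_mult_right integrable_integral integrable_continuous_interval continuous_intros)
         (simp_all add: k0')
    then show "integral {-S..S} (\<lambda>t. (s\<^sup>2 + t\<^sup>2) / (1 + s\<^sup>2 + t\<^sup>2)\<^sup>2) = B s + s\<^sup>2 * C s"
      by (intro integral_unique) (simp add: add_divide_distrib add.commute)
  qed
  also have "\<dots> = integral {-S..S} B + integral {-S..S} (\<lambda>s. s\<^sup>2 * C s)"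
    by (intro integral_add integrable_continuous_interval continuous_intros continuous_on_subset[OF cB] continuous_on_subset[OF cC]) auto
  finally have j1: "integral {-S..S} (\<lambda>s. integral {-S..S} (\<lambda>t. (s\<^sup>2 + t\<^sup>2) / (1 + s\<^sup>2 + t\<^sup>2)\<^sup>2)) = \<dots>" .
  have "integral {-R..R} (\<lambda>x. integral {-R..R} (\<lambda>y. (e1 x y)\<^sup>2 + (e2 x y)\<^sup>2)) = integral {-R..R} (\<lambda>x. E1 x + E2 x)"
    unfolding E1_def E2_def
    by (intro integral_cong integral_add integrable_continuous_interval continuous_intros)
  also have "\<dots> = integral {-R..R} E1 + integral {-R..R} E2"
    by (intro integral_add integrable_continuous_interval continuous_on_subset[OF cE1] continuous_on_subset[OF cE2]) auto
  finally have j2: "integral {-R..R} (\<lambda>x. integral {-R..R} (\<lambda>y. (e1 x y)\<^sup>2 + (e2 x y)\<^sup>2)) = \<dots>" .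
  have j3: "integral {-R..R} (\<lambda>y. \<psi> R y + \<psi> (-R) y) = \<Psi> R + \<Psi> (-R)"
    unfolding \<Psi>_def by (intro integral_add integrable_continuous_interval continuous_intros)
  show ?thesis unfolding j1 j2 j3 using h by (simp add: T A_def algebra_simps)
qed

section \<open>Compactly supported functions of class C1\<close>

text \<open>The sharp inequality is first obtained on pairs, where squares are products and
  integrals over them are iterated; \<open>onofri_C1_vec\<close> carries it over to
  \<open>real ^ 2\<close>.\<close>

abbreviation square :: "real \<Rightarrow> (real \<times> real) set" where
  "square R \<equiv> cbox (-R, -R) (R, R)"

abbreviation japanese :: "real \<times> real \<Rightarrow> real" where
  "japanese z \<equiv> 1 + (fst z)\<^sup>2 + (snd z)\<^sup>2"

lemma japanese_pos: "japanese z > 0"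
  by (simp add: add_pos_nonneg)

lemma japanese_nz: "japanese z \<noteq> 0"
  using japanese_pos[of z] by simp

section \<open>Integration over squares\<close>

lemma integral_square_iterated:
  fixes f :: "real \<times> real \<Rightarrow> real"
  assumes "continuous_on UNIV f"
  shows "integral (square R) f = integral {-R..R} (\<lambda>x. integral {-R..R} (\<lambda>y. f (x, y)))"
  using integral_prod_continuous[of "-R" "-R" R R f] continuous_on_subset[OF assms] by simp

lemma integral_square_iterated_swap:
  fixes f :: "real \<times> real \<Rightarrow> real"
  assumes "continuous_on UNIV f"
  shows "integral (square R) f = integral {-R..R} (\<lambda>y. integral {-R..R} (\<lambda>x. f (x, y)))"
proof -
  have "integral {-R..R} (\<lambda>x. integral {-R..R} (\<lambda>y. f (x, y))) = integral {-R..R} (\<lambda>y. integral {-R..R} (\<lambda>x. f (x, y)))"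
    using integral_swap_continuous[of "-R" "-R" R R "\<lambda>x y. f (x, y)"] continuous_on_subset[OF assms] by simp
  then show ?thesis using integral_square_iterated[OF assms] by simp
qed

lemma integrable_square:
  fixes f :: "real \<times> real \<Rightarrow> real"
  assumes "continuous_on UNIV f"
  shows "f integrable_on square R"
  by (rule integrable_continuous) (rule continuous_on_subset[OF assms], simp)

lemma has_integral_square:
  fixes f :: "real \<times> real \<Rightarrow> real"
  assumes "continuous_on UNIV f"
  shows "(f has_integral integral (square R) f) (square R)"
  using integrable_square[OF assms] by (rule integrable_integral)

lemma integral_square_scale:
  fixes f :: "real \<times> real \<Rightarrow> real"
  assumes "continuous_on UNIV f" "\<rho> > 0"
  shows "integral (square (\<rho> * R)) f = integral (square R) (\<lambda>z. \<rho>\<^sup>2 * f (\<rho> *\<^sub>R z))"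
proof -
  have *: "((\<lambda>z. f (\<rho> *\<^sub>R z + 0)) has_integral integral (square (\<rho> * R)) f /\<^sub>R \<rho> ^ DIM(real \<times> real))
     (cbox (((-(\<rho> * R), -(\<rho> * R)) - 0) /\<^sub>R \<rho>) (((\<rho> * R, \<rho> * R) - 0) /\<^sub>R \<rho>))"
    by (rule has_integral_affinity'[OF has_integral_square[OF assms(1)] assms(2)])
  have "((\<lambda>z. f (\<rho> *\<^sub>R z)) has_integral integral (square (\<rho> * R)) f / \<rho>\<^sup>2) (square R)"
  proof -
    have "inverse \<rho> * (R * \<rho>) = R" using assms(2) by simp
    with * show ?thesis by (simp add: divide_inverse mult.commute power2_eq_square)
  qed
  then have h: "((\<lambda>z. \<rho>\<^sup>2 * f (\<rho> *\<^sub>R z)) has_integral \<rho>\<^sup>2 * (integral (square (\<rho> * R)) f / \<rho>\<^sup>2)) (square R)"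
    by (rule has_integral_mult_right)
  show ?thesis using integral_unique[OF h] assms(2) by simp
qed

text \<open>Divergence theorem for the field w x / n with n = 1 + |x|^2. The divergence of x / n is
  2 / n^2, and the flux vanishes because w is zero on the sides. This is where the linear term of
  the Onofri inequality originates.\<close>

lemma integral_euler_field:
  fixes w w1 w2 :: "real \<times> real \<Rightarrow> real"
  assumes c0: "continuous_on UNIV w" and c1: "continuous_on UNIV w1" and c2: "continuous_on UNIV w2"
    and d1: "\<And>x y. ((\<lambda>x. w (x, y)) has_real_derivative w1 (x, y)) (at x)"
    and d2: "\<And>x y. ((\<lambda>y. w (x, y)) has_real_derivative w2 (x, y)) (at y)"
    and R: "R \<ge> 0" and zero: "\<And>x y. \<bar>x\<bar> = R \<or> \<bar>y\<bar> = R \<Longrightarrow> w (x, y) = 0"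
  shows "integral (square R) (\<lambda>z. (fst z * w1 z + snd z * w2 z) / japanese z)
    = - 2 * integral (square R) (\<lambda>z. w z / (japanese z)\<^sup>2)"
proof -
  note cc[continuous_intros] = continuous_on_compose2[OF c0] continuous_on_compose2[OF c1] continuous_on_compose2[OF c2]
  \<comment> \<open>\<open>f1\<close> and \<open>f2\<close> are the partial derivatives of the two
    components of w x / n; each integrates to zero along the lines in its own direction.\<close>
  define f1 where "f1 = (\<lambda>z. w z * (1 + (snd z)\<^sup>2 - (fst z)\<^sup>2) / (japanese z)\<^sup>2 + fst z * w1 z / japanese z)"
  define f2 where "f2 = (\<lambda>z. w z * (1 + (fst z)\<^sup>2 - (snd z)\<^sup>2) / (japanese z)\<^sup>2 + snd z * w2 z / japanese z)"
  have cf1: "continuous_on UNIV f1" unfolding f1_def using japanese_nz by (intro continuous_intros) auto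
  have cf2: "continuous_on UNIV f2" unfolding f2_def using japanese_nz by (intro continuous_intros) auto
  have nz: "1 + x\<^sup>2 + y\<^sup>2 \<noteq> 0" for x y :: real using japanese_nz[of "(x,y)"] by simp
  have D1: "((\<lambda>x. x * w (x, y) / (1 + x\<^sup>2 + y\<^sup>2)) has_real_derivative f1 (x, y)) (at x)" for x y
  proof -
    define n where "n = 1 + x\<^sup>2 + y\<^sup>2"
    have n: "n \<noteq> 0" using nz by (simp add: n_def)
    have "((\<lambda>x. x * w (x, y) / (1 + x\<^sup>2 + y\<^sup>2)) has_real_derivative
      ((w (x, y) + x * w1 (x, y)) * n - x * w (x, y) * (2 * x)) / (n * n)) (at x)"
      using n unfolding n_def by (auto intro!: derivative_eq_intros d1)
    moreover have e: "f1 (x, y) = w (x, y) * (n - 2 * x\<^sup>2) / n\<^sup>2 + x * w1 (x, y) / n"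
      by (simp add: f1_def n_def)
    have "f1 (x, y) = ((w (x, y) + x * w1 (x, y)) * n - x * w (x, y) * (2 * x)) / (n * n)"
      unfolding e using n by (simp add: divide_simps) (simp add: algebra_simps power2_eq_square)
    ultimately show ?thesis by simp
  qed
  have D2: "((\<lambda>y. y * w (x, y) / (1 + x\<^sup>2 + y\<^sup>2)) has_real_derivative f2 (x, y)) (at y)" for x y
  proof -
    define n where "n = 1 + x\<^sup>2 + y\<^sup>2"
    have n: "n \<noteq> 0" using nz by (simp add: n_def)
    have "((\<lambda>y. y * w (x, y) / (1 + x\<^sup>2 + y\<^sup>2)) has_real_derivative
      ((w (x, y) + y * w2 (x, y)) * n - y * w (x, y) * (2 * y)) / (n * n)) (at y)"
      using n unfolding n_def by (auto intro!: derivative_eq_intros d2)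
    moreover have e: "f2 (x, y) = w (x, y) * (n - 2 * y\<^sup>2) / n\<^sup>2 + y * w2 (x, y) / n"
      by (simp add: f2_def n_def)
    have "f2 (x, y) = ((w (x, y) + y * w2 (x, y)) * n - y * w (x, y) * (2 * y)) / (n * n)"
      unfolding e using n by (simp add: divide_simps) (simp add: algebra_simps power2_eq_square)
    ultimately show ?thesis by simp
  qed
  have "integral {-R..R} (\<lambda>x. f1 (x, y)) = 0" for y
    using has_integral_deriv[of "-R" R, OF _ D1[of y]] R zero by (simp add: integral_unique)
  then have I1: "integral (square R) f1 = 0" by (simp add: integral_square_iterated_swap[OF cf1])
  have "integral {-R..R} (\<lambda>y. f2 (x, y)) = 0" for x
    using has_integral_deriv[of "-R" R, OF _ D2[of x]] R zero by (simp add: integral_unique)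
  then have I2: "integral (square R) f2 = 0" by (simp add: integral_square_iterated[OF cf2])
  have "(fst z * w1 z + snd z * w2 z) / japanese z = f1 z + f2 z - 2 * (w z / (japanese z)\<^sup>2)" for z
  proof -
    have "w z * (1 + (snd z)\<^sup>2 - (fst z)\<^sup>2) / d + w z * (1 + (fst z)\<^sup>2 - (snd z)\<^sup>2) / d = 2 * (w z / d)" for d
      by (simp add: add_divide_distrib[symmetric] algebra_simps)
    from this[of "(japanese z)\<^sup>2"] show ?thesis unfolding f1_def f2_def by (simp add: add_divide_distrib)
  qed
  moreover have "integral (square R) (\<lambda>z. f1 z + f2 z - 2 * (w z / (japanese z)\<^sup>2))
      = 0 + 0 - 2 * integral (square R) (\<lambda>z. w z / (japanese z)\<^sup>2)"
  proof (rule integral_unique, intro has_integral_diff has_integral_add has_integral_mult_right)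
    show "(f1 has_integral 0) (square R)" "(f2 has_integral 0) (square R)"
      using has_integral_square[OF cf1, of R] has_integral_square[OF cf2, of R] I1 I2 by auto
    show "((\<lambda>z. w z / (japanese z)\<^sup>2) has_integral integral (square R) (\<lambda>z. w z / (japanese z)\<^sup>2)) (square R)"
      by (intro has_integral_square continuous_intros c0) (simp add: japanese_nz)
  qed
  ultimately show ?thesis by simp
qed

section \<open>Radial integrals in two dimensions\<close>

text \<open>A disc of radius sqrt a has area pi a, so the squared norm pushes Lebesgue measure
  forward to pi times Lebesgue measure on the half-line. This replaces polar coordinates. The type
  is any two-dimensional space because both pairs and \<open>real ^ 2\<close> are needed.\<close>

lemma nn_integral_norm_square:
  assumes dim: "DIM('a) = 2" and f: "f \<in> borel_measurable borel"
  shows "(\<integral>\<^sup>+ z. f ((norm z)\<^sup>2) \<partial>(lborel :: 'a::euclidean_space measure))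
    = ennreal pi * (\<integral>\<^sup>+ s. f s * indicator {0..} s \<partial>lborel)"
proof -
  let ?M = "distr (lborel :: 'a measure) borel (\<lambda>z. (norm z)\<^sup>2)"
  let ?N = "density lborel (\<lambda>s::real. ennreal pi * indicator {0..} s)"
  have ball: "emeasure ?M {..a} = (if a \<ge> 0 then ennreal (pi * a) else 0)" for a
  proof -
    have "(\<lambda>z. (norm z)\<^sup>2) -` {..a} \<inter> space lborel = (if a \<ge> 0 then cball (0::'a) (sqrt a) else {})"
    proof -
      have "((norm z)\<^sup>2 \<le> a) = (a \<ge> 0 \<and> norm z \<le> sqrt a)" for z :: 'a
        by (metis norm_ge_zero order_trans real_le_rsqrt real_sqrt_le_iff real_sqrt_unique sqrt_le_D zero_le_power2)
      then show ?thesis by auto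
    qed
    then show ?thesis
      by (simp add: emeasure_distr emeasure_cball dim eval_unit_ball_vol)
  qed
  have "?M = ?N"
  proof (rule measure_eqI_generator_eq[where E="range atMost" and \<Omega>=UNIV and A="\<lambda>i. {..real i}"])
    show "Int_stable (range (atMost :: real \<Rightarrow> real set))"
      by (auto simp: Int_stable_def)
    show "sets ?M = sigma_sets UNIV (range atMost)" "sets ?N = sigma_sets UNIV (range atMost)"
      by (simp_all add: borel_eq_atMost)
    show "emeasure ?M X = emeasure ?N X" if "X \<in> range atMost" for X
    proof -
      obtain a where X: "X = {..a}" using \<open>X \<in> range atMost\<close> by auto
      have "emeasure ?N X = (\<integral>\<^sup>+ s. ennreal pi * indicator {0..a} s \<partial>lborel)"
        unfolding X by (subst emeasure_density) (auto intro!: nn_integral_cong simp: indicator_def)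
      also have "\<dots> = (if a \<ge> 0 then ennreal (pi * a) else 0)"
        by (simp add: nn_integral_cmult_indicator ennreal_mult)
      finally show ?thesis unfolding X ball by simp
    qed
    show "(\<Union>i. {..real i}) = UNIV" by (auto intro: real_arch_simple)
    show "emeasure ?M {..real i} \<noteq> \<infinity>" for i by (simp add: ball)
  qed auto
  then have "(\<integral>\<^sup>+ s. f s \<partial>?M) = (\<integral>\<^sup>+ s. f s \<partial>?N)" by simp
  then show ?thesis using f
    by (simp add: nn_integral_distr nn_integral_density nn_integral_cmult[symmetric] mult_ac)
qed

lemma has_bochner_integral_norm_square:
  fixes f F :: "real \<Rightarrow> real"
  assumes "DIM('a) = 2" "f \<in> borel_measurable borel" "\<And>s. s \<ge> 0 \<Longrightarrow> f s \<ge> 0"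
    "\<And>s. s \<ge> 0 \<Longrightarrow> (F has_real_derivative f s) (at s)" "(F \<longlongrightarrow> L) at_top"
  shows "has_bochner_integral lborel (\<lambda>z::'a::euclidean_space. f ((norm z)\<^sup>2)) (pi * (L - F 0))"
proof (rule has_bochner_integral_nn_integral)
  have mono: "F 0 \<le> F s" if "s \<ge> 0" for s
    by (rule DERIV_nonneg_imp_nondecreasing[OF that]) (use assms in blast)
  have FL: "F 0 \<le> L"
    by (rule tendsto_lowerbound[OF assms(5)]) (auto intro!: eventually_at_top_linorderI[of 0] mono)
  have "(\<integral>\<^sup>+ z. ennreal (f ((norm z)\<^sup>2)) \<partial>(lborel :: 'a measure))
    = ennreal pi * (\<integral>\<^sup>+ s. ennreal (f s) * indicator {0..} s \<partial>lborel)"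
    by (rule nn_integral_norm_square) (use assms in auto)
  also have "(\<integral>\<^sup>+ s. ennreal (f s) * indicator {0..} s \<partial>lborel) = ennreal (L - F 0)"
    by (rule nn_integral_FTC_atLeast) (use assms in auto)
  finally show "(\<integral>\<^sup>+ z. ennreal (f ((norm z)\<^sup>2)) \<partial>(lborel :: 'a measure)) = ennreal (pi * (L - F 0))"
    using FL by (simp add: ennreal_mult)
  show "0 \<le> pi * (L - F 0)" using FL by simp
  show "(\<lambda>z::'a. f ((norm z)\<^sup>2)) \<in> borel_measurable lborel" using assms(2) by measurable
  show "AE z::'a in lborel. 0 \<le> f ((norm z)\<^sup>2)" using assms(3) by simp
qed

lemma tendsto_over_one_plus: "((\<lambda>s::real. a / (1 + s)) \<longlongrightarrow> 0) at_top"
  by (intro tendsto_divide_0[OF tendsto_const] filterlim_at_top_imp_at_infinity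
      filterlim_tendsto_add_at_top[OF tendsto_const] filterlim_ident)

lemma has_bochner_integral_mu:
  assumes "DIM('a) = 2"
  shows "has_bochner_integral lborel (\<lambda>z::'a::euclidean_space. 1 / (1 + (norm z)\<^sup>2)\<^sup>2) pi"
proof -
  have "((\<lambda>s::real. - 1 / (1 + s)) \<longlongrightarrow> 0) at_top"
    by (rule tendsto_over_one_plus)
  then have "has_bochner_integral lborel (\<lambda>z::'a. 1 / (1 + (norm z)\<^sup>2)\<^sup>2) (pi * (0 - - 1 / (1 + 0)))"
    by (intro has_bochner_integral_norm_square[OF assms])
       (auto intro!: derivative_eq_intros simp: power2_eq_square)
  then show ?thesis by simp
qed

text \<open>The integrand is \<open>\<rho>\<^sup>2\<close> / (1 + \<open>\<rho>\<^sup>2\<close> r^2)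
  - 1 / (1 + r^2), the difference of two functions with logarithmically divergent integrals. With s
  = r^2 and c = \<open>\<rho>\<^sup>2\<close>, a primitive is ln ((1 + c s) / (1 + s)), which tends
  to ln c. Dividing by c - 1 makes the integrand nonnegative for every c, at the price of treating
  \<open>\<rho>\<close> = 1 separately.\<close>

lemma has_bochner_integral_log_ratio:
  assumes "DIM('a) = 2" "\<rho> > 0"
  shows "has_bochner_integral lborel
    (\<lambda>z::'a::euclidean_space. (\<rho>\<^sup>2 - 1) / ((1 + \<rho>\<^sup>2 * (norm z)\<^sup>2) * (1 + (norm z)\<^sup>2))) (pi * ln (\<rho>\<^sup>2))"
proof (cases "\<rho> = 1")
  case False
  define c where "c = \<rho>\<^sup>2"
  have c: "c > 0" "c \<noteq> 1" using assms(2) False by (auto simp: c_def power2_eq_1_iff)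
  have lim: "((\<lambda>s::real. ln ((1 + c * s) / (1 + s)) / (c - 1)) \<longlongrightarrow> ln c / (c - 1)) at_top"
  proof -
    have "((\<lambda>s::real. (1 + c * s) / (1 + s)) \<longlongrightarrow> c) at_top"
    proof (rule Lim_transform_eventually)
      show "((\<lambda>s::real. c + (1 - c) / (1 + s)) \<longlongrightarrow> c) at_top"
        using tendsto_add[OF tendsto_const tendsto_over_one_plus] by simp
      show "\<forall>\<^sub>F s in at_top. c + (1 - c) / (1 + s) = (1 + c * s) / (1 + s)"
        by (rule eventually_at_top_linorderI[of 0]) (simp add: field_simps)
    qed
    then show ?thesis using c by (intro tendsto_intros) auto
  qed
  have "has_bochner_integral lborel (\<lambda>z::'a. 1 / ((1 + c * (norm z)\<^sup>2) * (1 + (norm z)\<^sup>2)))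
      (pi * (ln c / (c - 1) - ln ((1 + c * 0) / (1 + 0)) / (c - 1)))"
  proof (rule has_bochner_integral_norm_square[OF assms(1) _ _ _ lim])
    fix s :: real assume s: "s \<ge> 0"
    have p: "1 + c * s > 0" "1 + s > 0" using s c by (auto simp: add_pos_nonneg)
    show "0 \<le> 1 / ((1 + c * s) * (1 + s))" using p by simp
    have "((\<lambda>s. ln ((1 + c * s) / (1 + s)) / (c - 1)) has_real_derivative
       (1 / ((1 + c * s) / (1 + s)) * ((c * (1 + s) - (1 + c * s)) / (1 + s)\<^sup>2)) / (c - 1)) (at s)"
      using p c by (auto intro!: derivative_eq_intros simp: power2_eq_square)
    moreover have "(1 / ((1 + c * s) / (1 + s)) * ((c * (1 + s) - (1 + c * s)) / (1 + s)\<^sup>2)) / (c - 1)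
       = 1 / ((1 + c * s) * (1 + s))"
      using p c by (simp add: divide_simps) (simp add: algebra_simps power2_eq_square)
    ultimately show "((\<lambda>s. ln ((1 + c * s) / (1 + s)) / (c - 1)) has_real_derivative 1 / ((1 + c * s) * (1 + s))) (at s)"
      by simp
  qed auto
  from has_bochner_integral_mult_right[OF this, of "c - 1"] show ?thesis
    using c unfolding c_def[symmetric] by simp
qed (auto intro: has_bochner_integral_zero)

section \<open>The inequality on a square and its limit\<close>

text \<open>Dropping the 1 from the denominator leaves an arctangent integral. It controls the
  boundary flux, where the exact constant matters: the loss disappears as R tends to
  infinity.\<close>

lemma integral_arctan_bound:
  assumes "R > 0"
  shows "integral {-R..R} (\<lambda>x. 1 / (1 + x\<^sup>2 + R\<^sup>2)) \<le> pi / (2 * R)"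
proof -
  have pos: "x\<^sup>2 + R\<^sup>2 > 0" "1 + x\<^sup>2 + R\<^sup>2 > 0" for x :: real using assms by (auto simp: add_nonneg_pos add_pos_nonneg)
  have d: "((\<lambda>x. arctan (x / R) / R) has_real_derivative 1 / (x\<^sup>2 + R\<^sup>2)) (at x)" for x
  proof -
    have "((\<lambda>x. arctan (x / R) / R) has_real_derivative inverse (1 + (x / R)\<^sup>2) * (1 / R) / R) (at x)"
      using assms by (auto intro!: derivative_eq_intros)
    moreover have "1 + (x / R)\<^sup>2 = (x\<^sup>2 + R\<^sup>2) / R\<^sup>2" using assms by (simp add: field_simps)
    then have "inverse (1 + (x / R)\<^sup>2) * (1 / R) / R = 1 / (x\<^sup>2 + R\<^sup>2)" using assms by (simp add: power2_eq_square)
    ultimately show ?thesis by simp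
  qed
  have i1: "((\<lambda>x. 1 / (x\<^sup>2 + R\<^sup>2)) has_integral arctan (R / R) / R - arctan (- R / R) / R) {-R..R}"
    by (rule has_integral_deriv[OF _ d]) (use assms in simp)
  have "(\<lambda>x. 1 / (1 + x\<^sup>2 + R\<^sup>2)) integrable_on {-R..R}"
    by (intro integrable_continuous_interval continuous_intros) (use pos in \<open>auto simp: less_imp_neq[symmetric]\<close>)
  then have i2: "((\<lambda>x. 1 / (1 + x\<^sup>2 + R\<^sup>2)) has_integral integral {-R..R} (\<lambda>x. 1 / (1 + x\<^sup>2 + R\<^sup>2))) {-R..R}"
    by (rule integrable_integral)
  have "integral {-R..R} (\<lambda>x. 1 / (1 + x\<^sup>2 + R\<^sup>2)) \<le> arctan (R / R) / R - arctan (- R / R) / R"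
    by (rule has_integral_le[OF i2 i1]) (use pos in \<open>auto intro!: divide_left_mono\<close>)
  then show ?thesis using assms by (simp add: arctan_minus arctan_one field_simps)
qed

text \<open>The mass factor J / Z makes the source and target masses agree. The Knothe inequality is
  then doubled, the fields \<open>e1\<close>, \<open>e2\<close> are expanded, and the two integrals
  of 1 / n over squares of different size are merged into one convergent expression.\<close>

lemma onofri_on_square:
  fixes w w1 w2 :: "real \<times> real \<Rightarrow> real"
  assumes c0: "continuous_on UNIV w" and c1: "continuous_on UNIV w1" and c2: "continuous_on UNIV w2"
    and d1: "\<And>x y. ((\<lambda>x. w (x, y)) has_real_derivative w1 (x, y)) (at x)"
    and d2: "\<And>x y. ((\<lambda>y. w (x, y)) has_real_derivative w2 (x, y)) (at y)"
    and R: "R > 0" and \<rho>: "\<rho> > 0" and zero: "\<And>x y. \<bar>x\<bar> = R \<or> \<bar>y\<bar> = R \<Longrightarrow> w (x, y) = 0"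
  defines "J \<equiv> integral (square (\<rho> * R)) (\<lambda>z. 1 / (japanese z)\<^sup>2)"
    and "Z \<equiv> integral (square R) (\<lambda>z. exp (w z) / (japanese z)\<^sup>2)"
  shows "integral (square R) (\<lambda>z. (\<rho>\<^sup>2 - 1) / ((1 + \<rho>\<^sup>2 * (norm z)\<^sup>2) * (1 + (norm z)\<^sup>2)))
      + J + integral (square R) (\<lambda>z. 1 / (japanese z)\<^sup>2)
    \<le> 2 * pi * \<rho> * sqrt (J / Z) + 1 / 16 * integral (square R) (\<lambda>z. (w1 z)\<^sup>2 + (w2 z)\<^sup>2)
      + integral (square R) (\<lambda>z. w z / (japanese z)\<^sup>2)"
proof -
  note cc[continuous_intros] = continuous_on_compose2[OF c0] continuous_on_compose2[OF c1] continuous_on_compose2[OF c2]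
  define S where "S = \<rho> * R"
  have S: "S > 0" using R \<rho> by (simp add: S_def)
  have nz: "1 + x\<^sup>2 + y\<^sup>2 \<noteq> 0" and np: "1 + x\<^sup>2 + y\<^sup>2 > 0" for x y :: real
    using japanese_nz[of "(x,y)"] japanese_pos[of "(x,y)"] by auto
  have cj: "continuous_on UNIV (\<lambda>z. 1 / (japanese z)\<^sup>2)" by (intro continuous_intros) (simp add: japanese_nz)
  have ce: "continuous_on UNIV (\<lambda>z. exp (w z) / (japanese z)\<^sup>2)" by (intro continuous_intros) (auto simp: japanese_nz)
  have pos: "integral {-r..r} (\<lambda>x. integral {-r..r} (\<lambda>y. f (x, y))) > 0"
    if "r > 0" "continuous_on UNIV f" "\<And>z. f z > 0" for r and f :: "real \<times> real \<Rightarrow> real"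
    by (intro integral_pos_continuous continuous_on_parametric_integral)
       (use that in \<open>auto intro!: continuous_intros continuous_on_compose2[OF that(2)]\<close>)
  have J: "J > 0" unfolding J_def integral_square_iterated[OF cj]
    by (rule pos[OF _ cj]) (use S nz in \<open>auto simp: S_def\<close>)
  have Z: "Z > 0" unfolding Z_def integral_square_iterated[OF ce]
    by (rule pos[OF _ ce]) (use R nz in auto)
  have wbd: "w (x, R) = 0" "w (x, -R) = 0" "w (R, x) = 0" "w (-R, x) = 0" for x
    using R by (auto intro!: zero)
  define \<kappa> where "\<kappa> = sqrt (J / Z)"
  have \<kappa>: "\<kappa> > 0" and \<kappa>2: "\<kappa>\<^sup>2 = J / Z" using J Z by (auto simp: \<kappa>_def)
  \<comment> \<open>Square root of the normalised source density. Minus half of its logarithmic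
    gradient is x / n minus a quarter of the gradient of w, which gives \<open>e1\<close> and
    \<open>e2\<close>.\<close>
  define \<psi> where "\<psi> = (\<lambda>x y. \<kappa> * exp (w (x, y) / 2) / (1 + x\<^sup>2 + y\<^sup>2))"
  define e1 where "e1 = (\<lambda>x y. x / (1 + x\<^sup>2 + y\<^sup>2) - w1 (x, y) / 4)"
  define e2 where "e2 = (\<lambda>x y. y / (1 + x\<^sup>2 + y\<^sup>2) - w2 (x, y) / 4)"
  have "integral {-S..S} (\<lambda>s. integral {-S..S} (\<lambda>t. 1 / (1 + s\<^sup>2 + t\<^sup>2)))
    \<le> S / 2 * (integral {-R..R} (\<lambda>x. \<psi> x R + \<psi> x (-R)) + integral {-R..R} (\<lambda>y. \<psi> R y + \<psi> (-R) y))
      + 1 / 2 * integral {-S..S} (\<lambda>s. integral {-S..S} (\<lambda>t. (s\<^sup>2 + t\<^sup>2) / (1 + s\<^sup>2 + t\<^sup>2)\<^sup>2))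
      + 1 / 2 * integral {-R..R} (\<lambda>x. integral {-R..R} (\<lambda>y. (e1 x y)\<^sup>2 + (e2 x y)\<^sup>2))"
  proof (rule knothe_inequality[OF R S])
    show "\<psi> x y > 0" for x y using \<kappa> np by (simp add: \<psi>_def)
    show "continuous_on UNIV (\<lambda>(x, y). \<psi> x y)" "continuous_on UNIV (\<lambda>(x, y). e1 x y)" "continuous_on UNIV (\<lambda>(x, y). e2 x y)"
      unfolding \<psi>_def e1_def e2_def case_prod_beta by (auto intro!: continuous_intros simp: nz)
    show "((\<lambda>x. \<psi> x y) has_real_derivative - 2 * \<psi> x y * e1 x y) (at x)" for x y
    proof -
      define n where "n = 1 + x\<^sup>2 + y\<^sup>2"
      have n: "n \<noteq> 0" using nz by (simp add: n_def)
      have "((\<lambda>x. \<psi> x y) has_real_derivative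
          (\<kappa> * (exp (w (x, y) / 2) * (w1 (x, y) / 2)) * n - \<kappa> * exp (w (x, y) / 2) * (2 * x)) / (n * n)) (at x)"
        using n unfolding n_def \<psi>_def by (auto intro!: derivative_eq_intros d1)
      moreover have "- 2 * \<psi> x y * e1 x y = - 2 * (\<kappa> * exp (w (x, y) / 2) / n) * (x / n - w1 (x, y) / 4)"
        by (simp add: \<psi>_def e1_def n_def)
      moreover have "\<dots> = (\<kappa> * (exp (w (x, y) / 2) * (w1 (x, y) / 2)) * n - \<kappa> * exp (w (x, y) / 2) * (2 * x)) / (n * n)"
        using n by (simp add: divide_simps) (simp add: algebra_simps)
      ultimately show ?thesis by simp
    qed
    show "((\<lambda>y. \<psi> x y) has_real_derivative - 2 * \<psi> x y * e2 x y) (at y)" for x y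
    proof -
      define n where "n = 1 + x\<^sup>2 + y\<^sup>2"
      have n: "n \<noteq> 0" using nz by (simp add: n_def)
      have "((\<lambda>y. \<psi> x y) has_real_derivative
          (\<kappa> * (exp (w (x, y) / 2) * (w2 (x, y) / 2)) * n - \<kappa> * exp (w (x, y) / 2) * (2 * y)) / (n * n)) (at y)"
        using n unfolding n_def \<psi>_def by (auto intro!: derivative_eq_intros d2)
      moreover have "- 2 * \<psi> x y * e2 x y = - 2 * (\<kappa> * exp (w (x, y) / 2) / n) * (y / n - w2 (x, y) / 4)"
        by (simp add: \<psi>_def e2_def n_def)
      moreover have "\<dots> = (\<kappa> * (exp (w (x, y) / 2) * (w2 (x, y) / 2)) * n - \<kappa> * exp (w (x, y) / 2) * (2 * y)) / (n * n)"
        using n by (simp add: divide_simps) (simp add: algebra_simps)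
      ultimately show ?thesis by simp
    qed
    have "integral {-R..R} (\<lambda>x. integral {-R..R} (\<lambda>y. (\<psi> x y)\<^sup>2)) = integral {-R..R} (\<lambda>x. integral {-R..R} (\<lambda>y. \<kappa>\<^sup>2 * (exp (w (x, y)) / (1 + x\<^sup>2 + y\<^sup>2)\<^sup>2)))"
      by (simp add: \<psi>_def power_mult_distrib power_divide exp_double[symmetric])
    also have "\<dots> = \<kappa>\<^sup>2 * Z"
      unfolding Z_def integral_square_iterated[OF ce] by (simp only: fst_conv snd_conv integral_mult_right)
    also have "\<dots> = integral {-S..S} (\<lambda>s. integral {-S..S} (\<lambda>t. 1 / (1 + s\<^sup>2 + t\<^sup>2)\<^sup>2))"
      unfolding \<kappa>2 using Z by (simp add: J_def integral_square_iterated[OF cj] S_def)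
    finally show "integral {-R..R} (\<lambda>x. integral {-R..R} (\<lambda>y. (\<psi> x y)\<^sup>2)) = \<dots>" .
  qed
  moreover have "integral {-S..S} (\<lambda>s. integral {-S..S} (\<lambda>t. 1 / (1 + s\<^sup>2 + t\<^sup>2))) = integral (square S) (\<lambda>z. 1 / japanese z)"
    by (subst integral_square_iterated) (auto intro!: continuous_intros simp: japanese_nz nz)
  moreover have "integral {-S..S} (\<lambda>s. integral {-S..S} (\<lambda>t. (s\<^sup>2 + t\<^sup>2) / (1 + s\<^sup>2 + t\<^sup>2)\<^sup>2))
      = integral (square S) (\<lambda>z. 1 / japanese z) - J"
  proof -
    have "integral {-S..S} (\<lambda>s. integral {-S..S} (\<lambda>t. (s\<^sup>2 + t\<^sup>2) / (1 + s\<^sup>2 + t\<^sup>2)\<^sup>2))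
       = integral (square S) (\<lambda>z. ((fst z)\<^sup>2 + (snd z)\<^sup>2) / (japanese z)\<^sup>2)"
      by (subst integral_square_iterated) (auto intro!: continuous_intros simp: japanese_nz nz)
    also have "\<dots> = integral (square S) (\<lambda>z. 1 / japanese z - 1 / (japanese z)\<^sup>2)"
    proof (rule integral_cong)
      fix z :: "real \<times> real"
      define n where "n = japanese z"
      have n: "n \<noteq> 0" using japanese_nz by (simp add: n_def)
      have "(fst z)\<^sup>2 + (snd z)\<^sup>2 = n - 1" by (simp add: n_def)
      then show "((fst z)\<^sup>2 + (snd z)\<^sup>2) / (japanese z)\<^sup>2 = 1 / japanese z - 1 / (japanese z)\<^sup>2"
        unfolding n_def[symmetric] using n by (simp add: field_simps power2_eq_square)
    qed
    also have "\<dots> = integral (square S) (\<lambda>z. 1 / japanese z) - J"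
      unfolding J_def S_def
      by (intro integral_diff integrable_square continuous_intros) (auto simp: japanese_nz)
    finally show ?thesis .
  qed
  moreover have "integral {-R..R} (\<lambda>x. \<psi> x R + \<psi> x (-R)) \<le> \<kappa> * pi / R"
  proof -
    have "integral {-R..R} (\<lambda>x. \<psi> x R + \<psi> x (-R)) = integral {-R..R} (\<lambda>x. 2 * \<kappa> * (1 / (1 + x\<^sup>2 + R\<^sup>2)))"
      by (simp add: \<psi>_def wbd)
    also have "\<dots> = 2 * \<kappa> * integral {-R..R} (\<lambda>x. 1 / (1 + x\<^sup>2 + R\<^sup>2))" by (rule integral_mult_right)
    also have "\<dots> \<le> 2 * \<kappa> * (pi / (2 * R))" by (intro mult_left_mono integral_arctan_bound R) (use \<kappa> in simp)
    finally show ?thesis using R by simp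
  qed
  moreover have "integral {-R..R} (\<lambda>y. \<psi> R y + \<psi> (-R) y) \<le> \<kappa> * pi / R"
  proof -
    have "integral {-R..R} (\<lambda>y. \<psi> R y + \<psi> (-R) y) = integral {-R..R} (\<lambda>x. 2 * \<kappa> * (1 / (1 + x\<^sup>2 + R\<^sup>2)))"
      by (simp add: \<psi>_def wbd add_ac)
    also have "\<dots> = 2 * \<kappa> * integral {-R..R} (\<lambda>x. 1 / (1 + x\<^sup>2 + R\<^sup>2))" by (rule integral_mult_right)
    also have "\<dots> \<le> 2 * \<kappa> * (pi / (2 * R))" by (intro mult_left_mono integral_arctan_bound R) (use \<kappa> in simp)
    finally show ?thesis using R by simp
  qed
  \<comment> \<open>Since |t|^2 / n^2 = 1 / n - 1 / n^2, the quadratic term of the target is half of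
    the left side again, minus half of \<open>J\<close>. On the sides of the square w vanishes, so
    there \<open>\<psi>\<close> is just \<open>\<kappa>\<close> / n and the flux no longer depends
    on the values of w inside.\<close>
  ultimately have main: "integral (square S) (\<lambda>z. 1 / japanese z)
    \<le> S / 2 * (\<kappa> * pi / R + \<kappa> * pi / R) + 1 / 2 * (integral (square S) (\<lambda>z. 1 / japanese z) - J)
      + 1 / 2 * integral {-R..R} (\<lambda>x. integral {-R..R} (\<lambda>y. (e1 x y)\<^sup>2 + (e2 x y)\<^sup>2))"
    using S by (smt (verit) mult_left_mono divide_nonneg_pos)
  have bd: "S / 2 * (\<kappa> * pi / R + \<kappa> * pi / R) = pi * \<rho> * \<kappa>" using R by (simp add: S_def field_simps)
  \<comment> \<open>In the expansion of the squares, the pure terms give 1 / n - 1 / n^2 and a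
    sixteenth of the squared gradient; the cross term is -1/2 times the integrand of
    \<open>integral_euler_field\<close>, so it contributes the integral of w / n^2 with coefficient
    +1.\<close>
  have E: "integral {-R..R} (\<lambda>x. integral {-R..R} (\<lambda>y. (e1 x y)\<^sup>2 + (e2 x y)\<^sup>2))
      = integral (square R) (\<lambda>z. 1 / japanese z) - integral (square R) (\<lambda>z. 1 / (japanese z)\<^sup>2)
        + 1 / 16 * integral (square R) (\<lambda>z. (w1 z)\<^sup>2 + (w2 z)\<^sup>2) + integral (square R) (\<lambda>z. w z / (japanese z)\<^sup>2)"
  proof -
    have "integral {-R..R} (\<lambda>x. integral {-R..R} (\<lambda>y. (e1 x y)\<^sup>2 + (e2 x y)\<^sup>2))
       = integral (square R) (\<lambda>z. (e1 (fst z) (snd z))\<^sup>2 + (e2 (fst z) (snd z))\<^sup>2)"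
      unfolding e1_def e2_def
      by (subst integral_square_iterated) (auto intro!: continuous_intros simp: japanese_nz nz)
    also have "\<dots> = integral (square R) (\<lambda>z. 1 / japanese z - 1 / (japanese z)\<^sup>2
        + 1 / 16 * ((w1 z)\<^sup>2 + (w2 z)\<^sup>2) - 1 / 2 * ((fst z * w1 z + snd z * w2 z) / japanese z))"
    proof (rule integral_cong)
      fix z :: "real \<times> real"
      define n where "n = japanese z"
      have n: "n \<noteq> 0" using japanese_nz by (simp add: n_def)
      have "1 / n - 1 / n\<^sup>2 = ((fst z)\<^sup>2 + (snd z)\<^sup>2) / n\<^sup>2"
        using n by (simp add: field_simps power2_eq_square) (simp add: n_def power2_eq_square)
      moreover have "e1 (fst z) (snd z) = fst z / n - w1 z / 4" "e2 (fst z) (snd z) = snd z / n - w2 z / 4"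
        by (simp_all add: e1_def e2_def n_def)
      moreover have "(fst z / n - w1 z / 4)\<^sup>2 + (snd z / n - w2 z / 4)\<^sup>2 = ((fst z)\<^sup>2 + (snd z)\<^sup>2) / n\<^sup>2
        + 1 / 16 * ((w1 z)\<^sup>2 + (w2 z)\<^sup>2) - 1 / 2 * ((fst z * w1 z + snd z * w2 z) / n)"
        by (simp add: power2_diff power_divide add_divide_distrib)
      ultimately show "(e1 (fst z) (snd z))\<^sup>2 + (e2 (fst z) (snd z))\<^sup>2 = 1 / japanese z - 1 / (japanese z)\<^sup>2
        + 1 / 16 * ((w1 z)\<^sup>2 + (w2 z)\<^sup>2) - 1 / 2 * ((fst z * w1 z + snd z * w2 z) / japanese z)"
        unfolding n_def[symmetric] by simp
    qed
    also have "\<dots> = integral (square R) (\<lambda>z. 1 / japanese z) - integral (square R) (\<lambda>z. 1 / (japanese z)\<^sup>2)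
        + 1 / 16 * integral (square R) (\<lambda>z. (w1 z)\<^sup>2 + (w2 z)\<^sup>2)
        - 1 / 2 * integral (square R) (\<lambda>z. (fst z * w1 z + snd z * w2 z) / japanese z)"
      by (rule integral_unique, intro has_integral_diff has_integral_add has_integral_mult_right has_integral_square continuous_intros)
         (auto simp: japanese_nz)
    also have "integral (square R) (\<lambda>z. (fst z * w1 z + snd z * w2 z) / japanese z)
       = - 2 * integral (square R) (\<lambda>z. w z / (japanese z)\<^sup>2)"
      by (rule integral_euler_field[OF c0 c1 c2 d1 d2]) (use R zero in auto)
    finally show ?thesis by simp
  qed
  \<comment> \<open>Scaling by \<open>\<rho>\<close> pulls the integral over the target square back
    to the source square. There the two integrands are subtracted pointwise, and the divergence
    cancels before any limit is taken.\<close>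
  have L: "integral (square R) (\<lambda>z. (\<rho>\<^sup>2 - 1) / ((1 + \<rho>\<^sup>2 * (norm z)\<^sup>2) * (1 + (norm z)\<^sup>2)))
     = integral (square S) (\<lambda>z. 1 / japanese z) - integral (square R) (\<lambda>z. 1 / japanese z)"
  proof -
    have nn: "(norm z)\<^sup>2 = (fst z)\<^sup>2 + (snd z)\<^sup>2" for z :: "real \<times> real"
      by (cases z) (simp add: norm_Pair)
    have "integral (square S) (\<lambda>z. 1 / japanese z) = integral (square R) (\<lambda>z. \<rho>\<^sup>2 * (1 / japanese (\<rho> *\<^sub>R z)))"
      unfolding S_def by (rule integral_square_scale[OF _ \<rho>]) (auto intro!: continuous_intros simp: japanese_nz nz)
    moreover have "(\<rho>\<^sup>2 - 1) / ((1 + \<rho>\<^sup>2 * (norm z)\<^sup>2) * (1 + (norm z)\<^sup>2)) = \<rho>\<^sup>2 * (1 / japanese (\<rho> *\<^sub>R z)) - 1 / japanese z" for z :: "real \<times> real"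
    proof -
      define r where "r = (norm z)\<^sup>2"
      have j: "japanese z = 1 + r" "japanese (\<rho> *\<^sub>R z) = 1 + \<rho>\<^sup>2 * r"
        by (simp_all add: r_def nn power_mult_distrib distrib_left)
      have "1 + r \<noteq> 0" "1 + \<rho>\<^sup>2 * r \<noteq> 0" using japanese_nz[of z] japanese_nz[of "\<rho> *\<^sub>R z"] unfolding j by auto
      then show ?thesis unfolding j r_def[symmetric] by (simp add: divide_simps) (simp add: algebra_simps)
    qed
    moreover have "integral (square R) (\<lambda>z. \<rho>\<^sup>2 * (1 / japanese (\<rho> *\<^sub>R z)) - 1 / japanese z)
       = integral (square R) (\<lambda>z. \<rho>\<^sup>2 * (1 / japanese (\<rho> *\<^sub>R z))) - integral (square R) (\<lambda>z. 1 / japanese z)"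
      by (intro integral_diff integrable_square continuous_intros) (use japanese_nz in blast)+
    ultimately show ?thesis by simp
  qed
  show ?thesis using main[unfolded bd E] unfolding L \<kappa>_def[symmetric] by (simp add: algebra_simps)
qed

lemma integral_square_tendsto:
  fixes f :: "real \<times> real \<Rightarrow> real"
  assumes f: "integrable lborel f" and a: "a > 0"
  shows "(\<lambda>m. integral (square (a * real m)) f) \<longlonglongrightarrow> (LINT z|lborel. f z)"
proof -
  have meas[measurable]: "f \<in> borel_measurable lborel" using f by auto
  have "integral (square r) f = (LINT z|lborel. indicator (square r) z *\<^sub>R f z)" for r
    using set_borel_integral_eq_integral(2)[of "square r" f] integrable_mult_indicator[OF _ f, of "square r"]
    by (simp add: set_integrable_def set_lebesgue_integral_def)
  moreover have "(\<lambda>m. LINT z|lborel. indicator (square (a * real m)) z *\<^sub>R f z) \<longlonglongrightarrow> (LINT z|lborel. f z)"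
  proof (rule integral_dominated_convergence[where w="\<lambda>z. norm (f z)"])
    show "AE z in lborel. (\<lambda>m. indicator (square (a * real m)) z *\<^sub>R f z) \<longlonglongrightarrow> f z"
    proof (intro AE_I2 tendsto_eventually)
      fix z :: "real \<times> real"
      obtain x y where z: "z = (x, y)" by (cases z)
      obtain k :: nat where k: "(\<bar>x\<bar> + \<bar>y\<bar>) / a \<le> real k" using real_arch_simple by blast
      have "z \<in> square (a * real m)" if "m \<ge> k" for m
      proof -
        have "real k \<le> real m" using that by simp
        then have "(\<bar>x\<bar> + \<bar>y\<bar>) / a \<le> real m" using k by linarith
        then have "\<bar>x\<bar> + \<bar>y\<bar> \<le> a * real m" using a by (simp add: field_simps)
        then show ?thesis unfolding z by auto
      qed
      then show "\<forall>\<^sub>F m in sequentially. indicator (square (a * real m)) z *\<^sub>R f z = f z"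
        unfolding eventually_sequentially by (intro exI[of _ k]) simp
    qed
    show "AE z in lborel. norm (indicator (square (a * real m)) z *\<^sub>R f z) \<le> norm (f z)" for m
      by (intro AE_I2) (simp add: indicator_def)
  qed (use f in auto)
  ultimately show ?thesis by simp
qed

text \<open>With \<open>\<rho>\<close> fixed, every term of \<open>onofri_on_square\<close>
  converges as the half-side m tends to infinity: \<open>J\<close> and the integral of n^-2 over the
  source square tend to pi, and the difference of the divergent integrals tends to pi ln
  \<open>\<rho>\<^sup>2\<close>. The compact support of w makes it vanish on the sides of all large
  squares.\<close>

theorem onofri_C1:
  fixes w w1 w2 :: "real \<times> real \<Rightarrow> real"
  assumes c0: "continuous_on UNIV w" and c1: "continuous_on UNIV w1" and c2: "continuous_on UNIV w2"
    and d1: "\<And>x y. ((\<lambda>x. w (x, y)) has_real_derivative w1 (x, y)) (at x)"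
    and d2: "\<And>x y. ((\<lambda>y. w (x, y)) has_real_derivative w2 (x, y)) (at y)"
    and zero: "\<And>z. z \<notin> square r \<Longrightarrow> w z = 0 \<and> w1 z = 0 \<and> w2 z = 0"
  shows "integrable lborel (\<lambda>z. exp (w z) / (japanese z)\<^sup>2)"
    and "pi * ln ((LINT z|lborel. exp (w z) / (japanese z)\<^sup>2) / pi)
      \<le> 1 / 16 * (LINT z|lborel. (w1 z)\<^sup>2 + (w2 z)\<^sup>2) + (LINT z|lborel. w z / (japanese z)\<^sup>2)"
proof -
  note cc[continuous_intros] = continuous_on_compose2[OF c0] continuous_on_compose2[OF c1] continuous_on_compose2[OF c2]
  have nn: "1 + (norm z)\<^sup>2 = japanese z" for z :: "real \<times> real"
    by (cases z) (simp add: norm_Pair)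
  have cw: "continuous_on UNIV (\<lambda>z. w z / (japanese z)\<^sup>2)"
    and ce: "continuous_on UNIV (\<lambda>z. exp (w z) / (japanese z)\<^sup>2)"
    by (intro continuous_intros; simp add: japanese_nz)+
  have mu: "has_bochner_integral lborel (\<lambda>z::real \<times> real. 1 / (japanese z)\<^sup>2) pi"
    using has_bochner_integral_mu[where 'a="real \<times> real"] by (simp add: nn add.assoc)
  then have imu: "integrable lborel (\<lambda>z::real \<times> real. 1 / (japanese z)\<^sup>2)"
    and mu_eq: "(LINT z|lborel. 1 / (japanese z)\<^sup>2) = pi"
    using has_bochner_integral_iff by blast+
  have "bounded (w ` square r)"
    by (intro compact_imp_bounded compact_continuous_image continuous_on_subset[OF c0]) auto
  then obtain b where b: "\<And>z. z \<in> square r \<Longrightarrow> \<bar>w z\<bar> \<le> b" and b0: "b > 0"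
    unfolding bounded_pos by (auto simp: image_iff)
  have bw: "\<bar>w z\<bar> \<le> b" for z using b[of z] zero[of z] b0 by (cases "z \<in> square r") auto
  have iw: "integrable lborel (\<lambda>z. w z / (japanese z)\<^sup>2)"
  proof (rule Bochner_Integration.integrable_bound[OF integrable_mult_right[OF imu, of b]])
    show "AE z in lborel. norm (w z / (japanese z)\<^sup>2) \<le> norm (b * (1 / (japanese z)\<^sup>2))"
      using bw b0 by (intro AE_I2) (simp add: divide_right_mono)
  qed (use borel_measurable_continuous_onI[OF cw] in simp)
  show ie: "integrable lborel (\<lambda>z. exp (w z) / (japanese z)\<^sup>2)"
  proof (rule Bochner_Integration.integrable_bound[OF integrable_mult_right[OF imu, of "exp b"]])
    have "exp (w z) \<le> exp b" for z using bw[of z] by simp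
    then show "AE z in lborel. norm (exp (w z) / (japanese z)\<^sup>2) \<le> norm (exp b * (1 / (japanese z)\<^sup>2))"
      by (intro AE_I2) (simp add: divide_right_mono)
  qed (use borel_measurable_continuous_onI[OF ce] in simp)
  have iD: "integrable lborel (\<lambda>z. (w1 z)\<^sup>2 + (w2 z)\<^sup>2)"
  proof -
    have "integrable lborel (\<lambda>z. indicator (square r) z *\<^sub>R ((w1 z)\<^sup>2 + (w2 z)\<^sup>2))"
      by (rule borel_integrable_compact) (auto intro!: continuous_intros)
    moreover have "indicator (square r) z *\<^sub>R ((w1 z)\<^sup>2 + (w2 z)\<^sup>2) = (w1 z)\<^sup>2 + (w2 z)\<^sup>2" for z
      using zero[of z] by (cases "z \<in> square r") simp_all
    ultimately show ?thesis by (simp only:)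
  qed
  define Z where "Z = (LINT z|lborel. exp (w z) / (japanese z)\<^sup>2)"
  have Z: "Z > 0"
  proof -
    have "exp (-b) * pi = (LINT z|lborel. exp (-b) * (1 / (japanese z)\<^sup>2))"
      by (simp only: integral_mult_right_zero mu_eq)
    also have "\<dots> \<le> Z" unfolding Z_def
    proof (rule integral_mono[OF integrable_mult_right[OF imu] ie])
      fix z
      have "exp (-b) \<le> exp (w z)" using bw[of z] by simp
      then show "exp (-b) * (1 / (japanese z)\<^sup>2) \<le> exp (w z) / (japanese z)\<^sup>2" by (simp add: divide_right_mono)
    qed
    finally show ?thesis by (smt (verit) exp_gt_zero mult_pos_pos pi_gt_zero)
  qed
  \<comment> \<open>In the limit \<open>\<rho>\<close> enters only through pi ln
    \<open>\<rho>\<^sup>2\<close> - 2 pi \<open>\<rho>\<close> sqrt (pi / Z), and this value of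
    \<open>\<rho>\<close> is its maximiser. There the flux term equals 2 pi and cancels the two
    masses.\<close>
  define \<rho> where "\<rho> = sqrt (Z / pi)"
  have \<rho>: "\<rho> > 0" and \<rho>2: "\<rho>\<^sup>2 = Z / pi" using Z by (auto simp: \<rho>_def)
  define h where "h = (\<lambda>z::real \<times> real. (\<rho>\<^sup>2 - 1) / ((1 + \<rho>\<^sup>2 * (norm z)\<^sup>2) * (1 + (norm z)\<^sup>2)))"
  have hb: "has_bochner_integral lborel h (pi * ln (\<rho>\<^sup>2))"
    unfolding h_def by (rule has_bochner_integral_log_ratio) (use \<rho> in auto)
  have ih: "integrable lborel h" and h_eq: "(LINT z|lborel. h z) = pi * ln (\<rho>\<^sup>2)"
    using hb has_bochner_integral_iff by blast+
  define J where "J = (\<lambda>m. integral (square (\<rho> * real m)) (\<lambda>z. 1 / (japanese z)\<^sup>2))"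
  define Zm where "Zm = (\<lambda>m. integral (square (real m)) (\<lambda>z. exp (w z) / (japanese z)\<^sup>2))"
  note lim1 = integral_square_tendsto[where a=1, simplified]
  have lJ: "J \<longlonglongrightarrow> pi" using integral_square_tendsto[OF imu \<rho>] mu_eq by (simp add: J_def)
  have lZ: "Zm \<longlonglongrightarrow> Z" using lim1[OF ie] by (simp add: Zm_def Z_def)
  have lK: "(\<lambda>m. sqrt (J m / Zm m)) \<longlonglongrightarrow> sqrt (pi / Z)"
    using Z by (intro tendsto_intros lJ lZ) auto
  have "pi * ln (\<rho>\<^sup>2) + pi + pi \<le> 2 * pi * \<rho> * sqrt (pi / Z) + 1 / 16 * (LINT z|lborel. (w1 z)\<^sup>2 + (w2 z)\<^sup>2)
      + (LINT z|lborel. w z / (japanese z)\<^sup>2)"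
  proof (rule LIMSEQ_le)
    show "(\<lambda>m. integral (square (real m)) h + J m + integral (square (real m)) (\<lambda>z. 1 / (japanese z)\<^sup>2))
       \<longlonglongrightarrow> pi * ln (\<rho>\<^sup>2) + pi + pi"
      using lim1[OF ih] lim1[OF imu] unfolding h_eq mu_eq by (intro tendsto_add lJ)
    show "(\<lambda>m. 2 * pi * \<rho> * sqrt (J m / Zm m) + 1 / 16 * integral (square (real m)) (\<lambda>z. (w1 z)\<^sup>2 + (w2 z)\<^sup>2)
        + integral (square (real m)) (\<lambda>z. w z / (japanese z)\<^sup>2))
       \<longlonglongrightarrow> 2 * pi * \<rho> * sqrt (pi / Z) + 1 / 16 * (LINT z|lborel. (w1 z)\<^sup>2 + (w2 z)\<^sup>2)
      + (LINT z|lborel. w z / (japanese z)\<^sup>2)"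
      by (intro tendsto_add tendsto_mult tendsto_const lK lim1[OF iD] lim1[OF iw])
    obtain k :: nat where k: "max r 1 < real k" using reals_Archimedean2 by blast
    have "integral (square (real m)) h + J m + integral (square (real m)) (\<lambda>z. 1 / (japanese z)\<^sup>2)
       \<le> 2 * pi * \<rho> * sqrt (J m / Zm m) + 1 / 16 * integral (square (real m)) (\<lambda>z. (w1 z)\<^sup>2 + (w2 z)\<^sup>2)
        + integral (square (real m)) (\<lambda>z. w z / (japanese z)\<^sup>2)" if "m \<ge> k" for m
    proof -
      have "real k \<le> real m" using that by simp
      then have m: "real m > 0" "real m > r" using k by auto
      show ?thesis unfolding h_def J_def Zm_def
      proof (rule onofri_on_square[OF c0 c1 c2 d1 d2 m(1) \<rho>])
        show "w (x, y) = 0" if "\<bar>x\<bar> = real m \<or> \<bar>y\<bar> = real m" for x y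
        proof -
          have "(x, y) \<notin> square r" using that m by (auto simp: abs_if split: if_splits)
          then show ?thesis using zero by blast
        qed
      qed
    qed
    then show "\<exists>N. \<forall>m\<ge>N. integral (square (real m)) h + J m + integral (square (real m)) (\<lambda>z. 1 / (japanese z)\<^sup>2)
       \<le> 2 * pi * \<rho> * sqrt (J m / Zm m) + 1 / 16 * integral (square (real m)) (\<lambda>z. (w1 z)\<^sup>2 + (w2 z)\<^sup>2)
        + integral (square (real m)) (\<lambda>z. w z / (japanese z)\<^sup>2)" by blast
  qed
  moreover have "\<rho> * sqrt (pi / Z) = 1"
    unfolding \<rho>_def using Z by (simp add: real_sqrt_mult[symmetric])
  ultimately show "pi * ln ((LINT z|lborel. exp (w z) / (japanese z)\<^sup>2) / pi)
      \<le> 1 / 16 * (LINT z|lborel. (w1 z)\<^sup>2 + (w2 z)\<^sup>2) + (LINT z|lborel. w z / (japanese z)\<^sup>2)"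
    unfolding Z_def[symmetric] \<rho>2 by (simp add: mult.assoc)
qed

section \<open>Smooth mollifiers\<close>

lemma Ck_imp_continuous: "Ck k f \<Longrightarrow> continuous_on UNIV f"
  by (cases k) (auto intro: differentiable_imp_continuous_on)

text \<open>The product rule puts an undifferentiated factor next to a derivative of class k; the
  induction in \<open>Ck_mult\<close> needs this inclusion to lower the class of that
  factor.\<close>

lemma Ck_SucD: "Ck (Suc k) f \<Longrightarrow> Ck k f"
proof (induction k arbitrary: f)
  case 0
  then show ?case using Ck_imp_continuous[OF 0] by (simp only: Ck.simps(1))
next
  case (Suc k)
  have a: "f differentiable_on UNIV \<and> (\<forall>i\<in>Basis. Ck (Suc k) (\<lambda>x. frechet_derivative f (at x) i))"
    using Suc.prems by (rule Ck.simps(2)[THEN iffD1])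
  show ?case unfolding Ck.simps(2)[of k]
  proof (intro conjI ballI)
    show "f differentiable_on UNIV" using a by (rule conjunct1)
    show "Ck k (\<lambda>x. frechet_derivative f (at x) i)" if "i \<in> Basis" for i
      by (rule Suc.IH) (rule bspec[OF conjunct2[OF a] that])
  qed
qed

lemma Ck_SucI:
  assumes "\<And>x. (f has_derivative f' x) (at x)" "\<And>i. i \<in> Basis \<Longrightarrow> Ck k (\<lambda>x. f' x i)"
  shows "Ck (Suc k) f"
proof -
  have "frechet_derivative f (at x) = f' x" for x
    using frechet_derivative_at[OF assms(1)] by simp
  moreover have "f differentiable_on UNIV"
    unfolding differentiable_on_def using assms(1) by (blast intro: differentiableI)
  ultimately show ?thesis using assms(2) by simp
qed

lemma Ck_SucE:
  assumes "Ck (Suc k) f"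
  obtains f' where "\<And>x. (f has_derivative f' x) (at x)" "\<And>i. i \<in> Basis \<Longrightarrow> Ck k (\<lambda>x. f' x i)"
  using assms that[of "\<lambda>x. frechet_derivative f (at x)"]
  by (auto simp: differentiable_on_def frechet_derivative_works)

lemma Ck_const: "Ck k (\<lambda>x. c)"
  by (induction k arbitrary: c) (auto intro: continuous_intros)

lemma Ck_add: "Ck k f \<Longrightarrow> Ck k g \<Longrightarrow> Ck k (\<lambda>x. f x + g x)"
proof (induction k arbitrary: f g)
  case (Suc k)
  obtain f' where f: "\<And>x. (f has_derivative f' x) (at x)" "\<And>i. i \<in> Basis \<Longrightarrow> Ck k (\<lambda>x. f' x i)"
    using Ck_SucE[OF Suc.prems(1)] by blast
  obtain g' where g: "\<And>x. (g has_derivative g' x) (at x)" "\<And>i. i \<in> Basis \<Longrightarrow> Ck k (\<lambda>x. g' x i)"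
    using Ck_SucE[OF Suc.prems(2)] by blast
  show ?case
    by (rule Ck_SucI[where f'="\<lambda>x h. f' x h + g' x h"]) (use f g Suc.IH in \<open>auto intro!: derivative_intros\<close>)
qed (auto intro: continuous_intros)

lemma Ck_mult: "Ck k f \<Longrightarrow> Ck k g \<Longrightarrow> Ck k (\<lambda>x. f x * g x)"
proof (induction k arbitrary: f g)
  case (Suc k)
  obtain f' where f: "\<And>x. (f has_derivative f' x) (at x)" "\<And>i. i \<in> Basis \<Longrightarrow> Ck k (\<lambda>x. f' x i)"
    using Ck_SucE[OF Suc.prems(1)] by blast
  obtain g' where g: "\<And>x. (g has_derivative g' x) (at x)" "\<And>i. i \<in> Basis \<Longrightarrow> Ck k (\<lambda>x. g' x i)"
    using Ck_SucE[OF Suc.prems(2)] by blast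
  show ?case
    by (rule Ck_SucI[where f'="\<lambda>x h. f x * g' x h + f' x h * g x"])
       (use f g Suc.IH Ck_SucD[OF Suc.prems(1)] Ck_SucD[OF Suc.prems(2)] in
         \<open>auto intro!: derivative_intros Ck_add\<close>)
qed (auto intro: continuous_intros)

lemma Ck_prod: "finite A \<Longrightarrow> (\<And>i. i \<in> A \<Longrightarrow> Ck k (f i)) \<Longrightarrow> Ck k (\<lambda>x. \<Prod>i\<in>A. f i x)"
  by (induction A rule: finite_induct) (auto intro: Ck_const Ck_mult)

lemma Ck_compose_affine:
  fixes g :: "real \<Rightarrow> real" and v :: "'a::euclidean_space"
  shows "Ck k g \<Longrightarrow> Ck k (\<lambda>x. g (c + x \<bullet> v))"
proof (induction k arbitrary: g)
  case 0
  then show ?case by (auto intro!: continuous_intros continuous_on_compose2[of UNIV g])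
next
  case (Suc k)
  obtain g' where g: "\<And>x. (g has_derivative g' x) (at x)" "\<And>i. i \<in> Basis \<Longrightarrow> Ck k (\<lambda>x. g' x i)"
    using Ck_SucE[OF Suc.prems] by blast
  have lin: "g' x h = h * g' x 1" for x h
    using linear_cmul[OF has_derivative_linear[OF g(1)], of x h 1] by simp
  show ?case
  proof (rule Ck_SucI)
    show "((\<lambda>x. g (c + x \<bullet> v)) has_derivative (\<lambda>h. g' (c + x \<bullet> v) (h \<bullet> v))) (at x)" for x
      by (rule has_derivative_compose[of "\<lambda>x. c + x \<bullet> v" "\<lambda>h. h \<bullet> v", OF _ g(1)]) (auto intro!: derivative_eq_intros)
    have "Ck k (\<lambda>x::'a. (i \<bullet> v) * g' (c + x \<bullet> v) 1)" for i
      using Suc.IH[of "\<lambda>t. g' t 1"] g(2)[of 1] by (intro Ck_mult Ck_const) auto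
    then show "Ck k (\<lambda>x. g' (c + x \<bullet> v) (i \<bullet> v))" for i
      by (subst lin)
  qed
qed

lemma Ck_reflect: "Ck k f \<Longrightarrow> Ck k (\<lambda>x. f (y - x))"
proof (induction k arbitrary: f)
  case 0
  then show ?case by (auto intro!: continuous_intros continuous_on_compose2[of UNIV f])
next
  case (Suc k)
  obtain f' where f: "\<And>x. (f has_derivative f' x) (at x)" "\<And>i. i \<in> Basis \<Longrightarrow> Ck k (\<lambda>x. f' x i)"
    using Ck_SucE[OF Suc.prems] by blast
  show ?case
  proof (rule Ck_SucI)
    show "((\<lambda>x. f (y - x)) has_derivative (\<lambda>h. f' (y - x) (- h))) (at x)" for x
      by (rule has_derivative_compose[of "\<lambda>x. y - x" "\<lambda>h. - h", OF _ f(1)]) (auto intro!: derivative_eq_intros)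
    have "Ck k (\<lambda>x. - 1 * f' (y - x) i)" if "i \<in> Basis" for i
      using Suc.IH[OF f(2)[OF that]] by (intro Ck_mult Ck_const)
    then show "Ck k (\<lambda>x. f' (y - x) (- i))" if "i \<in> Basis" for i
      using that linear_neg[OF has_derivative_linear[OF f(1)]] by simp
  qed
qed

section \<open>A smooth bump function\<close>

text \<open>The polynomial factor makes the family closed under differentiation: the derivative
  belongs to the polynomial X^2 (p - p'). Smoothness of the flat function exp (-1/t) thus follows by
  induction with p arbitrary.\<close>

definition exp_flat :: "real poly \<Rightarrow> real \<Rightarrow> real" where
  "exp_flat p t = (if t > 0 then poly p (1 / t) * exp (- (1 / t)) else 0)"

lemma exp_flat_tendsto_0: "(exp_flat p \<longlongrightarrow> 0) (at 0)"
proof -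
  have "((\<lambda>s. \<Sum>i\<le>degree p. coeff p i * (s ^ i / exp s)) \<longlongrightarrow> (\<Sum>i\<le>degree p. coeff p i * 0)) at_top"
    by (intro tendsto_intros tendsto_power_div_exp_0)
  then have lim: "((\<lambda>s. poly p s * exp (- s)) \<longlongrightarrow> 0) at_top"
    by (simp add: poly_altdef sum_distrib_right exp_minus divide_inverse mult.assoc)
  have "((\<lambda>t. poly p (inverse t) * exp (- inverse t)) \<longlongrightarrow> 0) (at_right 0)"
    by (rule filterlim_compose[OF lim filterlim_inverse_at_top_right])
  then have "(exp_flat p \<longlongrightarrow> 0) (at_right 0)"
    by (rule Lim_transform_eventually)
       (auto simp: exp_flat_def inverse_eq_divide eventually_at_right_less intro: eventually_at_rightI[of 0 1])
  moreover have "(exp_flat p \<longlongrightarrow> 0) (at_left 0)"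
    by (rule Lim_transform_eventually[OF tendsto_const])
       (auto simp: exp_flat_def intro: eventually_at_leftI[of "-1" 0])
  ultimately show ?thesis by (rule filterlim_split_at[rotated])
qed

lemma DERIV_exp_flat: "(exp_flat p has_real_derivative exp_flat ([:0, 0, 1:] * (p - pderiv p)) t) (at t)"
proof -
  consider "t > 0" | "t < 0" | "t = 0" by linarith
  then show ?thesis
  proof cases
    case 1
    have "((\<lambda>t. poly p (1 / t) * exp (- (1 / t))) has_real_derivative
        exp_flat ([:0, 0, 1:] * (p - pderiv p)) t) (at t)"
      using 1 by (auto simp: exp_flat_def intro!: derivative_eq_intros DERIV_chain'[OF _ poly_DERIV])
        (simp add: field_simps power2_eq_square)
    then show ?thesis
      by (rule has_field_derivative_transform_within_open[of _ _ _ "{0<..}"]) (use 1 in \<open>auto simp: exp_flat_def\<close>)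
  next
    case 2
    have "((\<lambda>t. 0) has_real_derivative exp_flat ([:0, 0, 1:] * (p - pderiv p)) t) (at t)"
      using 2 by (simp add: exp_flat_def)
    then show ?thesis
      by (rule has_field_derivative_transform_within_open[of _ _ _ "{..<0}"]) (use 2 in \<open>auto simp: exp_flat_def\<close>)
  next
    case 3
    have z: "exp_flat q 0 = 0" for q by (simp add: exp_flat_def)
    \<comment> \<open>The difference quotient at 0 is again a member of the family, for X p, so
      differentiability there is the limit \<open>exp_flat_tendsto_0\<close>.\<close>
    have quot: "(exp_flat p (0 + h) - exp_flat p 0) / h = exp_flat ([:0, 1:] * p) h" for h
      by (auto simp: exp_flat_def)
    show ?thesis unfolding DERIV_def 3 quot unfolding z by (rule exp_flat_tendsto_0)
  qed
qed

lemma Ck_exp_flat: "Ck k (exp_flat p)"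
proof (induction k arbitrary: p)
  case 0
  show ?case unfolding Ck.simps
    by (rule DERIV_continuous_on, rule has_field_derivative_at_within, rule DERIV_exp_flat)
next
  case (Suc k)
  show ?case
  proof (rule Ck_SucI)
    show "(exp_flat p has_derivative (*) (exp_flat ([:0, 0, 1:] * (p - pderiv p)) x)) (at x)" for x
      using DERIV_exp_flat[of p x] unfolding has_field_derivative_def .
    show "Ck k (\<lambda>x. exp_flat ([:0, 0, 1:] * (p - pderiv p)) x * i)" if "i \<in> Basis" for i
      using Suc.IH that by simp
  qed
qed

text \<open>A product over coordinates, positive exactly on an open cube: its smoothness requires
  only products and compositions of a one-variable function with affine maps.\<close>

definition box_bump :: "real \<Rightarrow> 'a::euclidean_space \<Rightarrow> real" where
  "box_bump e x = (\<Prod>i\<in>Basis. exp_flat 1 (e + x \<bullet> i) * exp_flat 1 (e + x \<bullet> (- i)))"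

lemma Ck_box_bump: "Ck k (box_bump e)"
  unfolding box_bump_def by (intro Ck_prod Ck_mult Ck_compose_affine Ck_exp_flat) auto

lemma box_bump_nonneg: "box_bump e x \<ge> 0"
  unfolding box_bump_def by (intro prod_nonneg) (auto simp: exp_flat_def)

lemma box_bump_pos_iff: "box_bump e x \<noteq> 0 \<longleftrightarrow> (\<forall>i\<in>Basis. \<bar>x \<bullet> i\<bar> < e)"
  unfolding box_bump_def by (auto simp: exp_flat_def abs_less_iff)

definition mollifier :: "real \<Rightarrow> ('a::euclidean_space \<Rightarrow> real) \<Rightarrow> bool" where
  "mollifier e \<eta> \<longleftrightarrow> test_function \<eta> \<and> (\<forall>x. \<eta> x \<ge> 0) \<and> (LINT x|lborel. \<eta> x) = 1
     \<and> (\<forall>x. \<eta> x \<noteq> 0 \<longrightarrow> norm x \<le> e)"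

lemma compact_support_bounded:
  fixes \<phi> :: "'a::euclidean_space \<Rightarrow> real"
  assumes "continuous_on UNIV \<phi>" "\<And>x. \<phi> x \<noteq> 0 \<Longrightarrow> norm x \<le> e"
  obtains C where "C \<ge> 0" "\<And>x. \<bar>\<phi> x\<bar> \<le> C"
proof -
  have "bounded (\<phi> ` cball 0 e)"
    by (intro compact_imp_bounded compact_continuous_image continuous_on_subset[OF assms(1)]) auto
  then obtain C where C: "C > 0" "\<And>x. norm x \<le> e \<Longrightarrow> \<bar>\<phi> x\<bar> \<le> C"
    by (auto simp: bounded_pos)
  have "\<bar>\<phi> x\<bar> \<le> C" for x using C assms(2)[of x] by (cases "\<phi> x = 0") auto
  then show ?thesis using that[of C] C by auto
qed

lemma ex_mollifier:
  assumes "e > 0"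
  shows "\<exists>\<eta>::'a::euclidean_space \<Rightarrow> real. mollifier e \<eta>"
proof -
  \<comment> \<open>The norm is at most the sum of the absolute coordinates, so the cube of
    half-side \<open>r\<close> lies in the ball of radius \<open>e\<close>.\<close>
  define r where "r = e / real DIM('a)"
  have r: "r > 0" using assms by (simp add: r_def)
  have supp: "norm x \<le> e" if "box_bump r x \<noteq> 0" for x :: 'a
  proof -
    have "norm x \<le> (\<Sum>i\<in>Basis. \<bar>x \<bullet> i\<bar>)" by (rule norm_le_l1)
    also have "\<dots> \<le> (\<Sum>i\<in>(Basis :: 'a set). r)"
      by (rule sum_mono) (use that in \<open>auto simp: box_bump_pos_iff intro: less_imp_le\<close>)
    also have "\<dots> = e" by (simp add: r_def)
    finally show ?thesis .
  qed
  have cont: "continuous_on UNIV (box_bump r :: 'a \<Rightarrow> real)" by (rule Ck_imp_continuous[OF Ck_box_bump[of 0]])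
  have "integrable lborel (\<lambda>x::'a. indicator (cball 0 e) x *\<^sub>R box_bump r x)"
    by (rule borel_integrable_compact) (auto intro: continuous_on_subset[OF cont])
  moreover have "indicator (cball 0 e) x *\<^sub>R box_bump r x = box_bump r x" for x :: 'a
    using supp[of x] by (cases "box_bump r x = 0") (auto simp: indicator_def)
  ultimately have int: "integrable lborel (box_bump r :: 'a \<Rightarrow> real)" by (simp only:)
  define I where "I = (LINT x|lborel. (box_bump r :: 'a \<Rightarrow> real) x)"
  have "I \<noteq> 0"
  proof
    assume "I = 0"
    then have "AE x::'a in lborel. box_bump r x = 0"
      unfolding I_def using integral_nonneg_eq_0_iff_AE[OF int AE_I2[OF box_bump_nonneg]] by simp
    then have "AE x::'a in lborel. x \<notin> box (- r *\<^sub>R One) (r *\<^sub>R One)"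
    proof eventually_elim
      case (elim x)
      then obtain i where "i \<in> Basis" "\<not> \<bar>x \<bullet> i\<bar> < r" using box_bump_pos_iff[of r x] by auto
      then show ?case by (auto simp: mem_box intro!: bexI[of _ i])
    qed
    then have "emeasure lborel (box (- r *\<^sub>R One) (r *\<^sub>R One :: 'a)) = 0"
      by (subst (asm) AE_iff_measurable[OF _ refl]) auto
    moreover have "emeasure lborel (box (- r *\<^sub>R One) (r *\<^sub>R One :: 'a)) = ennreal (\<Prod>i\<in>(Basis :: 'a set). 2 * r)"
    proof -
      have "(r *\<^sub>R One - - r *\<^sub>R One) \<bullet> i = 2 * r" if "i \<in> Basis" for i :: 'a
        using that by (simp add: inner_diff_left inner_add_left)
      then show ?thesis by (subst emeasure_lborel_box) (use r in auto)
    qed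
    ultimately have "ennreal (\<Prod>i\<in>(Basis :: 'a set). 2 * r) = 0" by (simp only:)
    then show False using r by simp
  qed
  moreover have "I \<ge> 0" unfolding I_def by (rule Bochner_Integration.integral_nonneg) (rule box_bump_nonneg)
  ultimately have I: "I > 0" by simp
  have "mollifier e (\<lambda>x::'a. (1 / I) * box_bump r x)"
    unfolding mollifier_def test_function_def
  proof (intro conjI allI impI)
    show "Ck k (\<lambda>x::'a. (1 / I) * box_bump r x)" for k by (intro Ck_mult Ck_const Ck_box_bump)
    have "closure {x::'a. (1 / I) * box_bump r x \<noteq> 0} \<subseteq> cball 0 e"
      by (rule closure_minimal) (use supp in auto)
    then show "compact (closure {x::'a. (1 / I) * box_bump r x \<noteq> 0})"
      by (meson bounded_cball bounded_subset closed_closure compact_eq_bounded_closed)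
    show "(1 / I) * box_bump r x \<ge> 0" for x :: 'a using I box_bump_nonneg[of r x] by simp
  qed (use I supp I_def in auto)
  then show ?thesis by blast
qed

section \<open>Convolution with a mollifier\<close>

lemma distr_lborel_reflect: "distr lborel borel (\<lambda>y. x - y) = (lborel :: 'a::euclidean_space measure)"
  using lborel_affine[of "-1" x] by (simp add: density_1)

lemma nn_integral_translate:
  assumes "f \<in> borel_measurable borel"
  shows "(\<integral>\<^sup>+ x. f (x - y) \<partial>lborel) = (\<integral>\<^sup>+ x. f x \<partial>(lborel :: 'a::euclidean_space measure))"
  using nn_integral_distr[of "(+) (-y)" lborel borel f] assms by (simp add: lborel_distr_plus)

lemma integral_reflect:
  fixes f :: "'a::euclidean_space \<Rightarrow> real"
  assumes "f \<in> borel_measurable borel"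
  shows "(LINT y|lborel. f (x - y)) = (LINT y|lborel. f y)"
  using integral_distr[of "\<lambda>y. x - y" lborel borel f] assms by (simp add: distr_lborel_reflect)

text \<open>Borel counterpart of \<open>locally_integrable\<close>. Convolutions and Fubini's
  theorem are carried out over \<open>lborel\<close>; \<open>ex_borel_representative\<close> leads
  here from Lebesgue measurable functions.\<close>

definition loc_int :: "('a::euclidean_space \<Rightarrow> real) \<Rightarrow> bool" where
  "loc_int f \<longleftrightarrow> f \<in> borel_measurable borel \<and>
     (\<forall>r. integrable lborel (\<lambda>y. indicator (cball 0 r) y * f y))"

definition conv :: "('a::euclidean_space \<Rightarrow> real) \<Rightarrow> ('a \<Rightarrow> real) \<Rightarrow> 'a \<Rightarrow> real" where
  "conv \<phi> f x = (LINT y|lborel. \<phi> (x - y) * f y)"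

lemma loc_int_measurable: "loc_int f \<Longrightarrow> f \<in> borel_measurable borel"
  by (simp add: loc_int_def)

context
  fixes \<phi> :: "'a::euclidean_space \<Rightarrow> real" and f :: "'a \<Rightarrow> real" and e :: real
  assumes cont: "continuous_on UNIV \<phi>" and supp: "\<And>x. \<phi> x \<noteq> 0 \<Longrightarrow> norm x \<le> e"
    and f: "loc_int f"
begin

text \<open>Only points y within \<open>e\<close> of x contribute, so a single integrable function
  dominates the kernels for all x in a ball. This is what dominated convergence needs when x
  varies.\<close>

lemma kernel_bound:
  assumes "\<And>x. \<bar>\<phi> x\<bar> \<le> C" "norm x \<le> B"
  shows "\<bar>\<phi> (x - y) * f y\<bar> \<le> C * \<bar>indicator (cball 0 (B + e)) y * f y\<bar>"
proof (cases "\<phi> (x - y) = 0")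
  case False
  then have "norm (x - y) \<le> e" by (rule supp)
  then have "norm y \<le> B + e" using norm_triangle_ineq4[of x "x - y"] assms(2) by simp
  then show ?thesis using assms(1)[of "x - y"] by (simp add: abs_mult mult_right_mono)
next
  case True
  have "C \<ge> 0" using assms(1)[of 0] by linarith
  with True show ?thesis by simp
qed

lemma kernel_measurable [measurable]: "(\<lambda>y. \<phi> (x - y) * f y) \<in> borel_measurable borel"
proof -
  have [measurable]: "\<phi> \<in> borel_measurable borel" by (rule borel_measurable_continuous_onI[OF cont])
  have [measurable]: "f \<in> borel_measurable borel" using f by (rule loc_int_measurable)
  show ?thesis by measurable
qed

lemma integrable_kernel: "integrable lborel (\<lambda>y. \<phi> (x - y) * f y)"
proof -
  obtain C where C: "C \<ge> 0" "\<And>x. \<bar>\<phi> x\<bar> \<le> C" using compact_support_bounded[OF cont supp] by blast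
  show ?thesis
  proof (rule Bochner_Integration.integrable_bound)
    show "integrable lborel (\<lambda>y. C * \<bar>indicator (cball 0 (norm x + e)) y * f y\<bar>)"
      using f by (intro integrable_mult_right integrable_abs) (simp add: loc_int_def)
    show "AE y in lborel. norm (\<phi> (x - y) * f y) \<le> norm (C * \<bar>indicator (cball 0 (norm x + e)) y * f y\<bar>)"
    proof (rule AE_I2)
      fix y
      show "norm (\<phi> (x - y) * f y) \<le> norm (C * \<bar>indicator (cball 0 (norm x + e)) y * f y\<bar>)"
        using kernel_bound[OF C(2) order_refl, of x y] by simp
    qed
  qed (use kernel_measurable in simp)
qed

lemma continuous_conv: "continuous_on UNIV (conv \<phi> f)"
proof -
  obtain C where C: "C \<ge> 0" "\<And>x. \<bar>\<phi> x\<bar> \<le> C" using compact_support_bounded[OF cont supp] by blast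
  have "continuous (at x) (conv \<phi> f)" for x
  proof (rule continuous_at_sequentiallyI)
    fix X assume X: "X \<longlonglongrightarrow> x"
    then obtain B where B: "\<And>n. norm (X n) \<le> B"
      using convergent_imp_Bseq[of X] unfolding Bseq_def convergent_def by auto
    show "(\<lambda>n. conv \<phi> f (X n)) \<longlonglongrightarrow> conv \<phi> f x" unfolding conv_def
    proof (rule integral_dominated_convergence)
      show "integrable lborel (\<lambda>y. C * \<bar>indicator (cball 0 (B + e)) y * f y\<bar>)"
        using f by (intro integrable_mult_right integrable_abs) (simp add: loc_int_def)
      show "AE y in lborel. (\<lambda>n. \<phi> (X n - y) * f y) \<longlonglongrightarrow> \<phi> (x - y) * f y"
        by (intro AE_I2 tendsto_mult tendsto_const isCont_tendsto_compose[of _ \<phi>] tendsto_diff X)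
           (use cont continuous_on_eq_continuous_at[of UNIV \<phi>] in auto)
      show "AE y in lborel. norm (\<phi> (X n - y) * f y) \<le> C * \<bar>indicator (cball 0 (B + e)) y * f y\<bar>" for n
        using kernel_bound[OF C(2) B[of n]] by (intro AE_I2) (simp only: real_norm_def)
    qed (use kernel_measurable in auto)
  qed
  then show ?thesis by (simp add: continuous_on_eq_continuous_at)
qed

end

text \<open>The mean value theorem bounds the difference quotients of \<open>\<phi>\<close> along
  \<open>i\<close> by the supremum of its directional derivative, and all of them live in one ball,
  so the limit passes under the integral. The derivative falls on the kernel alone; local
  integrability of \<open>f\<close> is enough.\<close>

lemma DERIV_conv:
  fixes \<phi> :: "'a::euclidean_space \<Rightarrow> real"
  assumes deriv: "\<And>x. (\<phi> has_derivative \<phi>' x) (at x)"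
    and cont: "continuous_on UNIV (\<lambda>x. \<phi>' x i)"
    and supp: "\<And>x. \<phi> x \<noteq> 0 \<Longrightarrow> norm x \<le> e" and supp': "\<And>x. \<phi>' x i \<noteq> 0 \<Longrightarrow> norm x \<le> e"
    and f: "loc_int f"
  shows "((\<lambda>t. conv \<phi> f (x + t *\<^sub>R i)) has_real_derivative conv (\<lambda>z. \<phi>' z i) f (x + t *\<^sub>R i)) (at t)"
proof -
  have cphi: "continuous_on UNIV \<phi>"
    by (rule has_derivative_continuous_on[OF has_derivative_at_withinI[OF deriv]])
  have [measurable]: "\<phi> \<in> borel_measurable borel" by (rule borel_measurable_continuous_onI[OF cphi])
  have [measurable]: "f \<in> borel_measurable borel" using f by (rule loc_int_measurable)
  obtain C where C: "C \<ge> 0" "\<And>x. \<bar>\<phi>' x i\<bar> \<le> C" using compact_support_bounded[OF cont supp'] by blast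
  have D: "((\<lambda>s. \<phi> (z + s *\<^sub>R i)) has_real_derivative \<phi>' (z + s *\<^sub>R i) i) (at s)" for z s
  proof -
    have "((\<lambda>s. \<phi> (z + s *\<^sub>R i)) has_derivative (\<lambda>h. \<phi>' (z + s *\<^sub>R i) (h *\<^sub>R i))) (at s)"
      by (rule has_derivative_compose[OF _ deriv]) (auto intro!: derivative_eq_intros)
    moreover have "\<phi>' y (h *\<^sub>R i) = \<phi>' y i * h" for y h
      using linear_cmul[OF has_derivative_linear[OF deriv]] by (simp add: mult.commute)
    ultimately show ?thesis unfolding has_field_derivative_def by simp
  qed
  have lip: "\<bar>\<phi> (z + s *\<^sub>R i) - \<phi> (z + t *\<^sub>R i)\<bar> \<le> C * \<bar>s - t\<bar>" for z s t
    using field_differentiable_bound[of UNIV "\<lambda>s. \<phi> (z + s *\<^sub>R i)" "\<lambda>s. \<phi>' (z + s *\<^sub>R i) i" C s t] D C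
    by simp
  show ?thesis unfolding has_field_derivative_iff tendsto_at_iff_sequentially
  proof (intro allI impI)
    fix X assume "\<forall>n. X n \<in> UNIV - {t}" and X: "X \<longlonglongrightarrow> t"
    then have Xt: "X n \<noteq> t" for n by auto
    obtain B where B: "\<And>n. \<bar>X n\<bar> \<le> B"
      using convergent_imp_Bseq[of X] X unfolding Bseq_def convergent_def by auto
    \<comment> \<open>Large enough to contain the supports of all kernels centred at the points x +
      s i with s among the \<open>X n\<close> or equal to \<open>t\<close>.\<close>
    define r where "r = norm x + (B + \<bar>t\<bar>) * norm i + e"
    define q where "q = (\<lambda>n y. (\<phi> (x + X n *\<^sub>R i - y) - \<phi> (x + t *\<^sub>R i - y)) / (X n - t) * f y)"
    have supp_r: "norm y \<le> r" if "\<phi> (x + s *\<^sub>R i - y) \<noteq> 0" "\<bar>s\<bar> \<le> B + \<bar>t\<bar>" for s y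
    proof -
      have "norm (x + s *\<^sub>R i - y) \<le> e" by (rule supp[OF that(1)])
      moreover have "y = x + s *\<^sub>R i - (x + s *\<^sub>R i - y)" by simp
      then have "norm y \<le> norm (x + s *\<^sub>R i) + norm (x + s *\<^sub>R i - y)" by (metis norm_triangle_ineq4)
      moreover have "norm (x + s *\<^sub>R i) \<le> norm x + \<bar>s\<bar> * norm i" using norm_triangle_ineq[of x "s *\<^sub>R i"] by simp
      moreover have "\<bar>s\<bar> * norm i \<le> (B + \<bar>t\<bar>) * norm i" using that(2) by (simp add: mult_right_mono)
      ultimately show ?thesis unfolding r_def by linarith
    qed
    have qb: "\<bar>q n y\<bar> \<le> C * \<bar>indicator (cball 0 r) y * f y\<bar>" for n y
    proof (cases "norm y \<le> r")
      case True
      have "\<bar>\<phi> (x + X n *\<^sub>R i - y) - \<phi> (x + t *\<^sub>R i - y)\<bar> \<le> C * \<bar>X n - t\<bar>"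
        using lip[of "x - y" "X n" t] by (simp add: algebra_simps)
      then have "\<bar>(\<phi> (x + X n *\<^sub>R i - y) - \<phi> (x + t *\<^sub>R i - y)) / (X n - t)\<bar> \<le> C"
        using Xt[of n] by (simp add: abs_divide divide_le_eq)
      from mult_right_mono[OF this abs_ge_zero[of "f y"]] show ?thesis
        using True unfolding q_def abs_mult by simp
    next
      case False
      have "\<bar>X n\<bar> \<le> B + \<bar>t\<bar>" "\<bar>t\<bar> \<le> B + \<bar>t\<bar>" using B[of n] by auto
      then have "\<phi> (x + X n *\<^sub>R i - y) = 0" "\<phi> (x + t *\<^sub>R i - y) = 0" using supp_r[of _ y] False by blast+
      then show ?thesis using C by (simp add: q_def)
    qed
    have "(\<lambda>n. LINT y|lborel. q n y) \<longlonglongrightarrow> (LINT y|lborel. \<phi>' (x + t *\<^sub>R i - y) i * f y)"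
    proof (rule integral_dominated_convergence)
      show "integrable lborel (\<lambda>y. C * \<bar>indicator (cball 0 r) y * f y\<bar>)"
        using f by (intro integrable_mult_right integrable_abs) (simp add: loc_int_def)
      show "AE y in lborel. norm (q n y) \<le> C * \<bar>indicator (cball 0 r) y * f y\<bar>" for n
        using qb by (intro AE_I2) (simp only: real_norm_def)
      show "AE y in lborel. (\<lambda>n. q n y) \<longlonglongrightarrow> \<phi>' (x + t *\<^sub>R i - y) i * f y"
      proof (intro AE_I2)
        fix y
        have "((\<lambda>s. (\<phi> (x - y + s *\<^sub>R i) - \<phi> (x - y + t *\<^sub>R i)) / (s - t)) \<longlongrightarrow> \<phi>' (x - y + t *\<^sub>R i) i) (at t)"
          using D[of "x - y" t] unfolding has_field_derivative_iff .
        then have "(\<lambda>n. (\<phi> (x - y + X n *\<^sub>R i) - \<phi> (x - y + t *\<^sub>R i)) / (X n - t)) \<longlonglongrightarrow> \<phi>' (x - y + t *\<^sub>R i) i"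
          unfolding tendsto_at_iff_sequentially using X Xt by (auto simp: o_def)
        then show "(\<lambda>n. q n y) \<longlonglongrightarrow> \<phi>' (x + t *\<^sub>R i - y) i * f y"
          unfolding q_def by (intro tendsto_mult tendsto_const) (simp add: algebra_simps)
      qed
      show "(\<lambda>y. \<phi>' (x + t *\<^sub>R i - y) i * f y) \<in> borel_measurable lborel"
        using kernel_measurable[OF cont supp' f] by simp
      show "q n \<in> borel_measurable lborel" for n unfolding q_def by measurable
    qed
    moreover have "(LINT y|lborel. q n y) = (conv \<phi> f (x + X n *\<^sub>R i) - conv \<phi> f (x + t *\<^sub>R i)) / (X n - t)" for n
    proof -
      have "(LINT y|lborel. q n y) = (LINT y|lborel. (\<phi> (x + X n *\<^sub>R i - y) * f y - \<phi> (x + t *\<^sub>R i - y) * f y) / (X n - t))"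
        unfolding q_def by (simp add: left_diff_distrib)
      also have "\<dots> = (LINT y|lborel. \<phi> (x + X n *\<^sub>R i - y) * f y - \<phi> (x + t *\<^sub>R i - y) * f y) / (X n - t)"
        by simp
      also have "\<dots> = (conv \<phi> f (x + X n *\<^sub>R i) - conv \<phi> f (x + t *\<^sub>R i)) / (X n - t)"
        unfolding conv_def by (subst Bochner_Integration.integral_diff) (use integrable_kernel[OF cphi supp f] in auto)
      finally show ?thesis .
    qed
    ultimately show "((\<lambda>s. (conv \<phi> f (x + s *\<^sub>R i) - conv \<phi> f (x + t *\<^sub>R i)) / (s - t)) \<circ> X)
        \<longlonglongrightarrow> conv (\<lambda>z. \<phi>' z i) f (x + t *\<^sub>R i)"
      by (simp add: conv_def o_def)
  qed
qed

text \<open>For an indicator, squeeze the set between a closed and an open set of nearly equal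
  measure and take a Urysohn function between them; sums and dominated limits follow. The bound on
  \<open>\<epsilon>\<close> stands inside the conclusion so that the induction hypotheses can be
  used with half of it.\<close>

lemma continuous_approx_L1:
  fixes f :: "'a::euclidean_space \<Rightarrow> real"
  assumes "integrable lborel f"
  shows "\<And>\<epsilon>. \<epsilon> > 0 \<Longrightarrow> \<exists>g. continuous_on UNIV g \<and> integrable lborel g \<and> (LINT x|lborel. \<bar>f x - g x\<bar>) < \<epsilon>"
  using assms
proof (induction f rule: integrable_induct)
  case (base A c)
  \<comment> \<open>Chosen so that |c| d < \<open>\<epsilon>\<close>; the added 1 keeps the quotient
    defined for c = 0.\<close>
  define d where "d = \<epsilon> / (\<bar>c\<bar> + 1)"
  have d: "d > 0" using base(3) by (simp add: d_def add_nonneg_pos)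
  have A: "A \<in> sets lebesgue" using base(1) by simp
  obtain U where U: "open U" "A \<subseteq> U" "(U - A) \<in> lmeasurable" "emeasure lebesgue (U - A) < ennreal (d / 2)"
    using sets_lebesgue_outer_open[OF A, of "d / 2"] d by auto
  obtain T where T: "closed T" "T \<subseteq> A" "(A - T) \<in> lmeasurable" "emeasure lebesgue (A - T) < ennreal (d / 2)"
    using sets_lebesgue_inner_closed[OF A, of "d / 2"] d by auto
  obtain h :: "'a \<Rightarrow> real" where h: "continuous_on UNIV h" "\<And>x. h x \<in> closed_segment 0 1"
      "\<And>x. x \<in> - U \<Longrightarrow> h x = 0" "\<And>x. x \<in> T \<Longrightarrow> h x = 1"
    using Urysohn[of "- U" T 0 "1::real"] U(1,2) T(1,2) by blast
  have h01: "0 \<le> h x" "h x \<le> 1" for x using h(2)[of x] by (auto simp: closed_segment_eq_real_ivl)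
  have [measurable]: "h \<in> borel_measurable borel" "U \<in> sets borel" "T \<in> sets borel" "A \<in> sets borel"
    using h(1) U(1) T(1) base(1) by (auto intro: borel_measurable_continuous_onI)
  have "emeasure lborel (U - T) \<le> emeasure lborel ((U - A) \<union> (A - T))"
    by (rule emeasure_mono) auto
  also have "\<dots> \<le> emeasure lborel (U - A) + emeasure lborel (A - T)" by (rule emeasure_subadditive) auto
  also have "\<dots> < ennreal (d / 2) + ennreal (d / 2)"
    by (rule add_strict_mono) (use U(4) T(4) in auto)
  also have "\<dots> = ennreal d" using d by (simp flip: ennreal_plus)
  finally have UT: "emeasure lborel (U - T) < ennreal d" .
  then have fin: "emeasure lborel (U - T) < \<infinity>" by (simp add: order.strict_trans ennreal_less_top)
  then have mUT: "measure lborel (U - T) < d"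
    using UT d by (simp add: emeasure_eq_ennreal_measure ennreal_less_iff top.not_eq_extremum)
  have iUT: "integrable lborel (\<lambda>x. \<bar>c\<bar> * indicator (U - T) x :: real)"
    using fin by (intro integrable_mult_right integrable_real_indicator) auto
  have le: "\<bar>indicator A x *\<^sub>R c - c * h x\<bar> \<le> \<bar>c\<bar> * indicator (U - T) x" for x
  proof (cases "x \<in> U - T")
    case True
    have "\<bar>indicator A x - h x\<bar> \<le> 1" using h01[of x] by (auto simp: indicator_def)
    then have "\<bar>c\<bar> * \<bar>indicator A x - h x\<bar> \<le> \<bar>c\<bar> * 1" by (intro mult_left_mono) auto
    moreover have "indicator A x *\<^sub>R c - c * h x = c * (indicator A x - h x)" by (simp add: algebra_simps)
    ultimately show ?thesis using True by (simp add: abs_mult)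
  next
    case False
    then have "indicator A x = h x" using h(3,4)[of x] U(2) T(2) by (auto simp: indicator_def)
    then show ?thesis using False by simp
  qed
  have idiff: "integrable lborel (\<lambda>x. indicator A x *\<^sub>R c - c * h x)"
    by (rule Bochner_Integration.integrable_bound[OF iUT]) (use le in \<open>auto simp: abs_mult\<close>)
  have iA: "integrable lborel (\<lambda>x. indicator A x *\<^sub>R c)" using base by auto
  have "(LINT x|lborel. \<bar>indicator A x *\<^sub>R c - c * h x\<bar>) \<le> (LINT x|lborel. \<bar>c\<bar> * indicator (U - T) x)"
    using idiff iUT le by (intro integral_mono integrable_abs) auto
  also have "\<dots> = \<bar>c\<bar> * measure lborel (U - T)" by simp
  also have "\<dots> \<le> \<bar>c\<bar> * d" using mUT by (intro mult_left_mono) auto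
  also have "\<dots> < \<epsilon>" using base(3) by (simp add: d_def divide_less_eq mult.commute distrib_left)
  finally have "(LINT x|lborel. \<bar>indicator A x *\<^sub>R c - c * h x\<bar>) < \<epsilon>" .
  moreover have "integrable lborel (\<lambda>x. c * h x)"
    using Bochner_Integration.integrable_diff[OF iA idiff] by simp
  ultimately show ?case using h(1) by (intro exI[of _ "\<lambda>x. c * h x"]) (auto intro!: continuous_intros)
next
  case (add f1 f2)
  obtain g1 where g1: "continuous_on UNIV g1" "integrable lborel g1" "(LINT x|lborel. \<bar>f1 x - g1 x\<bar>) < \<epsilon> / 2"
    using add.IH(1)[of "\<epsilon> / 2"] add.prems by auto
  obtain g2 where g2: "continuous_on UNIV g2" "integrable lborel g2" "(LINT x|lborel. \<bar>f2 x - g2 x\<bar>) < \<epsilon> / 2"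
    using add.IH(2)[of "\<epsilon> / 2"] add.prems by auto
  have "(LINT x|lborel. \<bar>f1 x + f2 x - (g1 x + g2 x)\<bar>) \<le> (LINT x|lborel. \<bar>f1 x - g1 x\<bar> + \<bar>f2 x - g2 x\<bar>)"
    using add.hyps g1 g2 by (intro integral_mono) auto
  also have "\<dots> = (LINT x|lborel. \<bar>f1 x - g1 x\<bar>) + (LINT x|lborel. \<bar>f2 x - g2 x\<bar>)"
    using add.hyps g1 g2 by (intro Bochner_Integration.integral_add) auto
  finally show ?case using g1 g2 by (intro exI[of _ "\<lambda>x. g1 x + g2 x"]) (auto intro!: continuous_intros)
next
  case (lim f s)
  have [measurable]: "f \<in> borel_measurable lborel" "\<And>i. s i \<in> borel_measurable lborel" using lim by auto
  have "(\<lambda>i. LINT x|lborel. \<bar>f x - s i x\<bar>) \<longlonglongrightarrow> (LINT x|(lborel :: 'a measure). 0)"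
  proof (rule integral_dominated_convergence)
    show "integrable lborel (\<lambda>x. 3 * \<bar>f x\<bar>)" using lim by auto
    show "AE x in lborel. (\<lambda>i. \<bar>f x - s i x\<bar>) \<longlonglongrightarrow> 0"
    proof (intro AE_I2)
      fix x :: 'a
      have "(\<lambda>i. \<bar>f x - s i x\<bar>) \<longlonglongrightarrow> \<bar>f x - f x\<bar>"
        by (intro tendsto_intros lim.hyps(2)) simp
      then show "(\<lambda>i. \<bar>f x - s i x\<bar>) \<longlonglongrightarrow> 0" by simp
    qed
    show "AE x in lborel. norm \<bar>f x - s i x\<bar> \<le> 3 * \<bar>f x\<bar>" for i
    proof (intro AE_I2)
      fix x :: 'a
      show "norm \<bar>f x - s i x\<bar> \<le> 3 * \<bar>f x\<bar>" 
      proof -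
        have "\<bar>s i x\<bar> \<le> 2 * \<bar>f x\<bar>" using lim.hyps(3) by simp
        then show ?thesis by simp
      qed
    qed
  qed auto
  then have "\<forall>\<^sub>F i in sequentially. (LINT x|lborel. \<bar>f x - s i x\<bar>) < \<epsilon> / 2"
    using order_tendstoD(2)[of _ 0 sequentially "\<epsilon> / 2"] lim.prems by auto
  then obtain i where i: "(LINT x|lborel. \<bar>f x - s i x\<bar>) < \<epsilon> / 2" by (auto simp: eventually_sequentially)
  obtain g where g: "continuous_on UNIV g" "integrable lborel g" "(LINT x|lborel. \<bar>s i x - g x\<bar>) < \<epsilon> / 2"
    using lim.IH[of "\<epsilon> / 2" i] lim.prems by auto
  have "(LINT x|lborel. \<bar>f x - g x\<bar>) \<le> (LINT x|lborel. \<bar>f x - s i x\<bar> + \<bar>s i x - g x\<bar>)"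
    using lim.hyps g by (intro integral_mono) auto
  also have "\<dots> = (LINT x|lborel. \<bar>f x - s i x\<bar>) + (LINT x|lborel. \<bar>s i x - g x\<bar>)"
    using lim.hyps g by (intro Bochner_Integration.integral_add) auto
  finally show ?case using i g by (intro exI[of _ g]) auto
qed

section \<open>Mollification in L1 and L2\<close>

lemma mollifierD:
  assumes "mollifier e \<eta>"
  shows "\<eta> x \<ge> 0" "\<eta> x \<noteq> 0 \<Longrightarrow> norm x \<le> e" "continuous_on UNIV \<eta>" "test_function \<eta>"
    "\<eta> \<in> borel_measurable borel" "integrable lborel \<eta>"
    "(\<integral>\<^sup>+ x. ennreal (\<eta> x) \<partial>lborel) = 1" "(LINT y|lborel. \<eta> (z - y)) = 1"
proof -
  have nn: "\<eta> x \<ge> 0" for x using assms by (simp add: mollifier_def)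
  then show "\<eta> x \<ge> 0" .
  show "\<eta> x \<noteq> 0 \<Longrightarrow> norm x \<le> e" and tf: "test_function \<eta>"
    using assms by (auto simp: mollifier_def)
  show c: "continuous_on UNIV \<eta>"
    using tf Ck_imp_continuous unfolding test_function_def by blast
  then show m: "\<eta> \<in> borel_measurable borel" by (rule borel_measurable_continuous_onI)
  have one: "(LINT x|lborel. \<eta> x) = 1" using assms by (simp add: mollifier_def)
  \<comment> \<open>The integral of a non-integrable function is 0 by convention, so the value 1
    forces integrability.\<close>
  then show i: "integrable lborel \<eta>" using not_integrable_integral_eq by fastforce
  show "(\<integral>\<^sup>+ x. ennreal (\<eta> x) \<partial>lborel) = 1"
    using nn_integral_eq_integral[OF i] nn one by simp
  show "(LINT y|lborel. \<eta> (z - y)) = 1" using integral_reflect[OF m] one by simp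
qed

lemma integrable_mollifier_kernel:
  assumes "mollifier e \<eta>" "loc_int f"
  shows "integrable lborel (\<lambda>y. \<eta> (x - y) * f y)"
  by (rule integrable_kernel[OF mollifierD(3)[OF assms(1)] _ assms(2)]) (rule mollifierD(2)[OF assms(1)])

lemma continuous_conv_mollifier:
  assumes "mollifier e \<eta>" "loc_int f"
  shows "continuous_on UNIV (conv \<eta> f)"
  by (rule continuous_conv[OF mollifierD(3)[OF assms(1)] _ assms(2)]) (rule mollifierD(2)[OF assms(1)])

lemma nn_integral_mollify:
  fixes \<eta> :: "'a::euclidean_space \<Rightarrow> real"
  assumes "mollifier e \<eta>" and [measurable]: "g \<in> borel_measurable borel"
  shows "(\<integral>\<^sup>+ x. \<integral>\<^sup>+ y. ennreal (\<eta> (x - y)) * g y \<partial>lborel \<partial>lborel) = (\<integral>\<^sup>+ y. g y \<partial>lborel)"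
proof -
  have [measurable]: "\<eta> \<in> borel_measurable borel" using mollifierD[OF assms(1)] by blast
  have "(\<integral>\<^sup>+ x. \<integral>\<^sup>+ y. ennreal (\<eta> (x - y)) * g y \<partial>lborel \<partial>lborel)
      = (\<integral>\<^sup>+ y. \<integral>\<^sup>+ x. ennreal (\<eta> (x - y)) * g y \<partial>lborel \<partial>lborel)"
    by (rule lborel_pair.Fubini'[symmetric]) measurable
  also have "\<dots> = (\<integral>\<^sup>+ y. (\<integral>\<^sup>+ x. ennreal (\<eta> (x - y)) \<partial>lborel) * g y \<partial>lborel)"
    by (intro nn_integral_cong nn_integral_multc) measurable
  also have "\<dots> = (\<integral>\<^sup>+ y. g y \<partial>lborel)"
    using mollifierD(7)[OF assms(1)] nn_integral_translate[of "\<lambda>x. ennreal (\<eta> x)"] by simp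
  finally show ?thesis .
qed

lemma loc_int_const: "loc_int (\<lambda>_. c)"
  unfolding loc_int_def
proof safe
  fix r
  have "integrable lborel (\<lambda>y::'a. indicator (cball 0 r) y *\<^sub>R c)"
    by (rule borel_integrable_compact) auto
  then show "integrable lborel (\<lambda>y::'a. indicator (cball 0 r) y * c)" by simp
qed simp

lemma integrable_imp_loc_int:
  assumes "integrable lborel f"
  shows "loc_int f"
  unfolding loc_int_def
  using integrable_mult_indicator[OF _ assms, of "cball 0 r" for r] borel_measurable_integrable[OF assms] by auto

lemma loc_int_diff: "loc_int f \<Longrightarrow> loc_int g \<Longrightarrow> loc_int (\<lambda>x. f x - g x)"
  unfolding loc_int_def by (auto simp: right_diff_distrib)

lemma loc_int_cmult: "loc_int f \<Longrightarrow> loc_int (\<lambda>x. c * f x)"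
  unfolding loc_int_def by (auto simp: mult.left_commute)

lemma conv_diff:
  assumes "mollifier e \<eta>" "loc_int f" "loc_int g"
  shows "conv \<eta> (\<lambda>y. f y - g y) x = conv \<eta> f x - conv \<eta> g x"
proof -
  show ?thesis unfolding conv_def right_diff_distrib
    by (intro Bochner_Integration.integral_diff integrable_mollifier_kernel[OF assms(1)] assms)
qed

lemma conv_const: "mollifier e \<eta> \<Longrightarrow> conv \<eta> (\<lambda>_. c) x = c"
  using mollifierD(8)[of e \<eta> x] by (simp add: conv_def)

lemma nn_integral_conv_le:
  fixes \<eta> :: "'a::euclidean_space \<Rightarrow> real"
  assumes \<eta>: "mollifier e \<eta>" and f: "loc_int f"
  shows "(\<integral>\<^sup>+ x. ennreal \<bar>conv \<eta> f x\<bar> \<partial>lborel) \<le> (\<integral>\<^sup>+ x. ennreal \<bar>f x\<bar> \<partial>lborel)"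
proof -
  note m = mollifierD[OF \<eta>]
  have "ennreal \<bar>conv \<eta> f x\<bar> \<le> (\<integral>\<^sup>+ y. ennreal (\<eta> (x - y)) * ennreal \<bar>f y\<bar> \<partial>lborel)" for x
    using integral_norm_bound_ennreal[OF integrable_mollifier_kernel[OF \<eta> f, of x]] m(1)
    by (simp add: conv_def abs_mult ennreal_mult)
  then have "(\<integral>\<^sup>+ x. ennreal \<bar>conv \<eta> f x\<bar> \<partial>lborel)
      \<le> (\<integral>\<^sup>+ x. \<integral>\<^sup>+ y. ennreal (\<eta> (x - y)) * ennreal \<bar>f y\<bar> \<partial>lborel \<partial>lborel)"
    by (intro nn_integral_mono)
  also have "\<dots> = (\<integral>\<^sup>+ x. ennreal \<bar>f x\<bar> \<partial>lborel)"
    by (rule nn_integral_mollify[OF \<eta>]) (use loc_int_measurable[OF f] in measurable)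
  finally show ?thesis .
qed

text \<open>Jensen's inequality is read off from the nonnegative average of (f y - c)^2 with c the
  value of the convolution at x; mollification does not increase the integral of the squared
  function. As the constant is 1, applying this to the weak derivatives does no harm to the sharp
  constant 1/16.\<close>

lemma conv_square_integral_le:
  fixes \<eta> :: "'a::euclidean_space \<Rightarrow> real"
  assumes \<eta>: "mollifier e \<eta>" and f: "loc_int f" and f2: "integrable lborel (\<lambda>x. (f x)\<^sup>2)"
  shows "integrable lborel (\<lambda>x. (conv \<eta> f x)\<^sup>2)"
    and "(LINT x|lborel. (conv \<eta> f x)\<^sup>2) \<le> (LINT x|lborel. (f x)\<^sup>2)"
proof -
  note m = mollifierD[OF \<eta>]
  note l2 = integrable_imp_loc_int[OF f2]
  have jensen: "(conv \<eta> f x)\<^sup>2 \<le> conv \<eta> (\<lambda>y. (f y)\<^sup>2) x" for x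
  proof -
    define c where "c = conv \<eta> f x"
    note i1 = integrable_mollifier_kernel[OF \<eta> l2, of x]
    note i2 = integrable_mollifier_kernel[OF \<eta> loc_int_cmult[OF f, of "2 * c"], of x]
    note i3 = integrable_mollifier_kernel[OF \<eta> loc_int_const[of "c\<^sup>2"], of x]
    have "0 \<le> (LINT y|lborel. \<eta> (x - y) * (f y - c)\<^sup>2)"
      by (rule Bochner_Integration.integral_nonneg) (simp add: m(1))
    also have "\<dots> = (LINT y|lborel. \<eta> (x - y) * (f y)\<^sup>2 - \<eta> (x - y) * (2 * c * f y) + \<eta> (x - y) * c\<^sup>2)"
      by (intro Bochner_Integration.integral_cong refl) (simp add: power2_diff algebra_simps)
    also have "\<dots> = conv \<eta> (\<lambda>y. (f y)\<^sup>2) x - (LINT y|lborel. \<eta> (x - y) * (2 * c * f y)) + (LINT y|lborel. \<eta> (x - y) * c\<^sup>2)"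
      unfolding conv_def using i1 i2 i3
      by (simp only: Bochner_Integration.integral_add Bochner_Integration.integral_diff Bochner_Integration.integrable_diff)
    also have "(LINT y|lborel. \<eta> (x - y) * (2 * c * f y)) = 2 * c * c"
    proof -
      have "(LINT y|lborel. \<eta> (x - y) * (2 * c * f y)) = (LINT y|lborel. (2 * c) * (\<eta> (x - y) * f y))"
        by (intro Bochner_Integration.integral_cong refl) simp
      also have "\<dots> = 2 * c * (LINT y|lborel. \<eta> (x - y) * f y)" by (rule integral_mult_right_zero)
      finally show ?thesis unfolding c_def conv_def .
    qed
    also have "(LINT y|lborel. \<eta> (x - y) * c\<^sup>2) = c\<^sup>2" using m(8)[of x] by simp
    finally show ?thesis unfolding c_def[symmetric] by (simp add: power2_eq_square)
  qed
  have [measurable]: "conv \<eta> f \<in> borel_measurable borel"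
    by (rule borel_measurable_continuous_onI[OF continuous_conv_mollifier[OF \<eta> f]])
  have le: "(\<integral>\<^sup>+ x. ennreal ((conv \<eta> f x)\<^sup>2) \<partial>lborel) \<le> ennreal (LINT x|lborel. (f x)\<^sup>2)"
  proof -
    have "ennreal ((conv \<eta> f x)\<^sup>2) \<le> ennreal \<bar>conv \<eta> (\<lambda>y. (f y)\<^sup>2) x\<bar>" for x
      using jensen[of x] by (intro ennreal_leI) simp
    then have "(\<integral>\<^sup>+ x. ennreal ((conv \<eta> f x)\<^sup>2) \<partial>lborel) \<le> (\<integral>\<^sup>+ x. ennreal \<bar>conv \<eta> (\<lambda>y. (f y)\<^sup>2) x\<bar> \<partial>lborel)"
      by (intro nn_integral_mono)
    also have "\<dots> \<le> (\<integral>\<^sup>+ x. ennreal \<bar>(f x)\<^sup>2\<bar> \<partial>lborel)" by (rule nn_integral_conv_le[OF \<eta> l2])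
    also have "\<dots> = ennreal (LINT x|lborel. (f x)\<^sup>2)" using nn_integral_eq_integral[OF f2] by simp
    finally show ?thesis .
  qed
  show int: "integrable lborel (\<lambda>x. (conv \<eta> f x)\<^sup>2)"
    by (rule integrableI_bounded) (use le in \<open>auto intro: order.strict_trans1 ennreal_less_top\<close>)
  show "(LINT x|lborel. (conv \<eta> f x)\<^sup>2) \<le> (LINT x|lborel. (f x)\<^sup>2)"
    using le nn_integral_eq_integral[OF int] by (simp add: ennreal_le_iff)
qed

lemma conv_cong_ball:
  assumes "mollifier e \<eta>" "\<And>y. norm y \<le> norm x + e \<Longrightarrow> f y = g y"
  shows "conv \<eta> f x = conv \<eta> g x"
  unfolding conv_def
proof (intro Bochner_Integration.integral_cong refl)
  fix y
  show "\<eta> (x - y) * f y = \<eta> (x - y) * g y"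
  proof (cases "\<eta> (x - y) = 0")
    case False
    then have "norm (x - y) \<le> e" by (rule mollifierD(2)[OF assms(1)])
    then have "norm y \<le> norm x + e" using norm_triangle_ineq4[of x "x - y"] by simp
    then show ?thesis using assms(2) by simp
  qed simp
qed

lemma conv_continuous_close:
  assumes \<eta>: "mollifier e \<eta>" and g: "loc_int g" and close: "\<And>y. norm (x - y) \<le> e \<Longrightarrow> \<bar>g y - g x\<bar> \<le> d"
  shows "\<bar>conv \<eta> g x - g x\<bar> \<le> d"
proof -
  note m = mollifierD[OF \<eta>]
  have l: "loc_int (\<lambda>y. g y - g x)" by (intro loc_int_diff g loc_int_const)
  have "\<bar>conv \<eta> g x - g x\<bar> = \<bar>conv \<eta> (\<lambda>y. g y - g x) x\<bar>"
    by (simp add: conv_diff[OF \<eta> g loc_int_const] conv_const[OF \<eta>])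
  also have "\<dots> \<le> (LINT y|lborel. \<bar>\<eta> (x - y) * (g y - g x)\<bar>)"
    unfolding conv_def by (rule integral_abs_bound)
  also have "\<dots> \<le> (LINT y|lborel. \<eta> (x - y) * d)"
  proof (rule integral_mono)
    show "integrable lborel (\<lambda>y. \<bar>\<eta> (x - y) * (g y - g x)\<bar>)"
      using integrable_mollifier_kernel[OF \<eta> l] by auto
    show "integrable lborel (\<lambda>y. \<eta> (x - y) * d)" using integrable_mollifier_kernel[OF \<eta> loc_int_const] .
    show "\<bar>\<eta> (x - y) * (g y - g x)\<bar> \<le> \<eta> (x - y) * d" for y
    proof (cases "\<eta> (x - y) = 0")
      case False
      then show ?thesis using close[OF m(2)[OF False]] m(1)[of "x - y"] by (simp add: abs_mult mult_left_mono)
    qed simp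
  qed
  also have "\<dots> = d" using m(8)[of x] by simp
  finally show ?thesis .
qed

text \<open>Truncate \<open>f\<close> to the ball of radius N + 1, which is all that convolutions of
  radius at most 1 see from the ball of radius N, and approximate by a continuous g. The error
  splits into the mollified F - g, the difference of g and its mollification, and F - g, each at
  most \<open>\<epsilon>\<close>/3; the first is no larger than the third because mollification
  contracts the L1 norm.\<close>

lemma conv_approx:
  fixes f :: "'a::euclidean_space \<Rightarrow> real"
  assumes f: "loc_int f" and \<epsilon>: "\<epsilon> > 0"
  shows "\<exists>\<delta>>0. \<forall>e \<eta>. e \<le> \<delta> \<longrightarrow> mollifier e \<eta> \<longrightarrow>
    (\<integral>\<^sup>+ x. ennreal (indicator (cball 0 N) x * \<bar>conv \<eta> f x - f x\<bar>) \<partial>lborel) \<le> ennreal \<epsilon>"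
proof -
  define F where "F = (\<lambda>y. indicator (cball 0 (N + 1)) y * f y)"
  have F: "integrable lborel F" using f by (simp add: loc_int_def F_def)
  obtain g where g: "continuous_on UNIV g" "integrable lborel g" "(LINT x|lborel. \<bar>F x - g x\<bar>) < \<epsilon> / 3"
    using continuous_approx_L1[OF F, of "\<epsilon> / 3"] \<epsilon> by auto
  have gl: "loc_int g" by (rule integrable_imp_loc_int[OF g(2)])
  have Fg: "integrable lborel (\<lambda>x. F x - g x)" using F g(2) by auto
  have [measurable]: "g \<in> borel_measurable borel" "F \<in> borel_measurable borel" "f \<in> borel_measurable borel"
    using loc_int_measurable[OF gl] loc_int_measurable[OF integrable_imp_loc_int[OF F]] loc_int_measurable[OF f] by auto
  define V where "V = measure lborel (cball (0::'a) N)"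
  \<comment> \<open>A uniform error d over a ball of volume V costs at most
    \<open>\<epsilon>\<close>/3; the added 1 covers V = 0.\<close>
  define d where "d = \<epsilon> / (3 * (V + 1))"
  have V: "V \<ge> 0" by (simp add: V_def)
  then have d: "d > 0" using \<epsilon> by (simp add: d_def add_nonneg_pos)
  have "uniformly_continuous_on (cball 0 (N + 1)) g"
    by (intro compact_uniformly_continuous continuous_on_subset[OF g(1)]) auto
  then obtain \<delta>0 where \<delta>0: "\<delta>0 > 0" "\<And>x y. x \<in> cball 0 (N + 1) \<Longrightarrow> y \<in> cball 0 (N + 1) \<Longrightarrow> dist y x < \<delta>0 \<Longrightarrow> dist (g y) (g x) < d"
    using d unfolding uniformly_continuous_on_def by blast
  \<comment> \<open>The 1 keeps convolutions within the truncation ball; halving turns distances at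
    most \<open>e\<close> into distances strictly below \<open>\<delta>0\<close>.\<close>
  define \<delta> where "\<delta> = min 1 (\<delta>0 / 2)"
  have "(\<integral>\<^sup>+ x. ennreal (indicator (cball 0 N) x * \<bar>conv \<eta> f x - f x\<bar>) \<partial>lborel) \<le> ennreal \<epsilon>"
    if e: "e \<le> \<delta>" and \<eta>: "mollifier e \<eta>" for e and \<eta> :: "'a \<Rightarrow> real"
  proof -
    note m = mollifierD[OF \<eta>]
    have Fgl: "loc_int (\<lambda>x. F x - g x)" by (rule integrable_imp_loc_int[OF Fg])
    have [measurable]: "conv \<eta> (\<lambda>x. F x - g x) \<in> borel_measurable borel"
      by (rule borel_measurable_continuous_onI[OF continuous_conv_mollifier[OF \<eta> Fgl]])
    have pw: "indicator (cball 0 N) x * \<bar>conv \<eta> f x - f x\<bar>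
        \<le> \<bar>conv \<eta> (\<lambda>y. F y - g y) x\<bar> + (d * indicator (cball 0 N) x + \<bar>F x - g x\<bar>)" for x
    proof (cases "norm x \<le> N")
      case True
      have "conv \<eta> f x = conv \<eta> F x"
        by (rule conv_cong_ball[OF \<eta>]) (use True e in \<open>auto simp: F_def \<delta>_def indicator_def\<close>)
      moreover have "F x = f x" using True by (simp add: F_def indicator_def)
      moreover have "conv \<eta> (\<lambda>y. F y - g y) x = conv \<eta> F x - conv \<eta> g x"
        by (rule conv_diff[OF \<eta> integrable_imp_loc_int[OF F] gl])
      moreover have "\<bar>conv \<eta> g x - g x\<bar> \<le> d"
      proof (rule conv_continuous_close[OF \<eta> gl])
        fix y assume y: "norm (x - y) \<le> e"
        have "norm y \<le> N + 1" using y e True norm_triangle_ineq4[of x "x - y"] by (simp add: \<delta>_def)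
        then show "\<bar>g y - g x\<bar> \<le> d"
          using \<delta>0(2)[of x y] y e True \<delta>0(1) by (auto simp: dist_norm \<delta>_def norm_minus_commute less_imp_le)
      qed
      ultimately show ?thesis using True by (simp add: indicator_def)
    qed (use d in simp)
    have "(\<integral>\<^sup>+ x. ennreal (indicator (cball 0 N) x * \<bar>conv \<eta> f x - f x\<bar>) \<partial>lborel)
      \<le> (\<integral>\<^sup>+ x. ennreal \<bar>conv \<eta> (\<lambda>y. F y - g y) x\<bar> + (ennreal d * indicator (cball 0 N) x + ennreal \<bar>F x - g x\<bar>) \<partial>lborel)"
    proof (rule nn_integral_mono)
      fix x
      show "ennreal (indicator (cball 0 N) x * \<bar>conv \<eta> f x - f x\<bar>)
         \<le> ennreal \<bar>conv \<eta> (\<lambda>y. F y - g y) x\<bar> + (ennreal d * indicator (cball 0 N) x + ennreal \<bar>F x - g x\<bar>)"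
        using ennreal_leI[OF pw[of x]] d by (simp add: ennreal_mult ennreal_indicator)
    qed
    also have "\<dots> = (\<integral>\<^sup>+ x. ennreal \<bar>conv \<eta> (\<lambda>y. F y - g y) x\<bar> \<partial>lborel) + (ennreal d * emeasure lborel (cball (0::'a) N)
        + (\<integral>\<^sup>+ x. ennreal \<bar>F x - g x\<bar> \<partial>lborel))"
    proof -
      have [measurable]: "cball (0::'a) N \<in> sets borel" by simp
      have "(\<integral>\<^sup>+ x. ennreal d * indicator (cball (0::'a) N) x + ennreal \<bar>F x - g x\<bar> \<partial>lborel)
          = (\<integral>\<^sup>+ x. ennreal d * indicator (cball (0::'a) N) x \<partial>lborel) + (\<integral>\<^sup>+ x. ennreal \<bar>F x - g x\<bar> \<partial>lborel)"
        by (rule nn_integral_add) measurable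
      moreover have "(\<integral>\<^sup>+ x. ennreal \<bar>conv \<eta> (\<lambda>y. F y - g y) x\<bar> + (ennreal d * indicator (cball 0 N) x + ennreal \<bar>F x - g x\<bar>) \<partial>lborel)
          = (\<integral>\<^sup>+ x. ennreal \<bar>conv \<eta> (\<lambda>y. F y - g y) x\<bar> \<partial>lborel)
            + (\<integral>\<^sup>+ x. ennreal d * indicator (cball 0 N) x + ennreal \<bar>F x - g x\<bar> \<partial>lborel)"
        by (rule nn_integral_add) measurable
      ultimately show ?thesis by (simp add: nn_integral_cmult_indicator)
    qed
    also have "\<dots> \<le> ennreal (\<epsilon> / 3) + (ennreal (\<epsilon> / 3) + ennreal (\<epsilon> / 3))"
    proof (intro add_mono)
      have *: "(\<integral>\<^sup>+ x. ennreal \<bar>F x - g x\<bar> \<partial>lborel) \<le> ennreal (\<epsilon> / 3)"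
        using nn_integral_eq_integral[OF integrable_abs[OF Fg]] g(3) by (simp add: ennreal_leI)
      then show "(\<integral>\<^sup>+ x. ennreal \<bar>F x - g x\<bar> \<partial>lborel) \<le> ennreal (\<epsilon> / 3)" .
      show "(\<integral>\<^sup>+ x. ennreal \<bar>conv \<eta> (\<lambda>y. F y - g y) x\<bar> \<partial>lborel) \<le> ennreal (\<epsilon> / 3)"
        using nn_integral_conv_le[OF \<eta> Fgl] * by (rule order_trans)
      have "emeasure lborel (cball (0::'a) N) = ennreal V"
        unfolding V_def by (intro emeasure_eq_ennreal_measure emeasure_lborel_cball_finite[THEN less_imp_neq, unfolded infinity_ennreal_def])
      then have "ennreal d * emeasure lborel (cball (0::'a) N) = ennreal (d * V)"
        using d V by (simp add: ennreal_mult)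
      also have "\<dots> \<le> ennreal (\<epsilon> / 3)"
        using V \<epsilon> by (intro ennreal_leI) (simp add: d_def field_simps)
      finally show "ennreal d * emeasure lborel (cball (0::'a) N) \<le> ennreal (\<epsilon> / 3)" .
    qed
    also have "\<dots> = ennreal \<epsilon>" using \<epsilon> by (simp flip: ennreal_plus)
    finally show ?thesis .
  qed
  moreover have "\<delta> > 0" using \<delta>0 by (simp add: \<delta>_def)
  ultimately show ?thesis by blast
qed

section \<open>Weak gradients\<close>

lemma locally_integrable_measurable:
  assumes "locally_integrable f"
  shows "f \<in> borel_measurable lebesgue"
proof (rule borel_measurable_LIMSEQ_metric)
  show "(\<lambda>x. indicator (cball 0 (real n)) x *\<^sub>R f x) \<in> borel_measurable lebesgue" for n
    using assms unfolding locally_integrable_def set_integrable_def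
    by (metis borel_measurable_integrable compact_cball)
  show "(\<lambda>n. indicator (cball 0 (real n)) x *\<^sub>R f x) \<longlonglongrightarrow> f x" for x
  proof (rule tendsto_eventually)
    obtain k :: nat where "norm x \<le> real k" using real_arch_simple by blast
    then show "\<forall>\<^sub>F n in sequentially. indicator (cball 0 (real n)) x *\<^sub>R f x = f x"
      unfolding eventually_sequentially by (intro exI[of _ k]) (auto simp: indicator_def)
  qed
qed

lemma ex_borel_representative:
  fixes f :: "'a::euclidean_space \<Rightarrow> real"
  assumes "locally_integrable f"
  obtains f' where "loc_int f'" "AE x in lebesgue. f x = f' x"
proof -
  have fm: "f \<in> borel_measurable lebesgue" by (rule locally_integrable_measurable[OF assms])
  obtain f' where f': "f' \<in> borel_measurable lborel" "AE x in lborel. f x = f' x"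
    using completion_ex_borel_measurable_real[OF fm] by blast
  have f'm: "f' \<in> borel_measurable borel" using f'(1) by simp
  have ae: "AE x in lebesgue. f x = f' x" by (rule AE_completion[OF f'(2)])
  have "integrable lborel (\<lambda>y. indicator (cball 0 r) y * f' y)" for r
  proof -
    have [measurable]: "f' \<in> borel_measurable borel" by (rule f'm)
    have m: "(\<lambda>y. indicator (cball 0 r) y * f' y) \<in> borel_measurable lborel"
    proof -
      have [measurable]: "cball (0::'a) r \<in> sets borel" by simp
      show ?thesis by measurable
    qed
    have i: "integrable lebesgue (\<lambda>y. indicator (cball 0 r) y * f y)"
      using assms unfolding locally_integrable_def set_integrable_def by (simp del: integrable_completion)
    have "integrable lebesgue (\<lambda>y. indicator (cball 0 r) y * f y) \<longleftrightarrow> integrable lebesgue (\<lambda>y. indicator (cball 0 r) y * f' y)"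
      by (rule integrable_cong_AE) (use i m ae in \<open>auto intro: measurable_completion\<close>)
    then show ?thesis using i integrable_completion[OF m] by simp
  qed
  then have "loc_int f'" using f'm by (simp add: loc_int_def)
  then show ?thesis using ae that by blast
qed

lemma locally_integrable_inner:
  assumes "locally_integrable g"
  shows "locally_integrable (\<lambda>x. g x \<bullet> i)"
  unfolding locally_integrable_def set_integrable_def
proof (intro allI impI)
  fix K :: "'a set" assume "compact K"
  then have "integrable lebesgue (\<lambda>x. indicator K x *\<^sub>R g x)"
    using assms by (simp add: locally_integrable_def set_integrable_def)
  then have "integrable lebesgue (\<lambda>x. (indicator K x *\<^sub>R g x) \<bullet> i)" by (rule integrable_inner_left)
  then show "integrable lebesgue (\<lambda>x. indicator K x *\<^sub>R (g x \<bullet> i))" by simp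
qed

lemma test_function_reflect:
  fixes \<eta> :: "'a::euclidean_space \<Rightarrow> real"
  assumes "test_function \<eta>"
  shows "test_function (\<lambda>y. \<eta> (x - y))"
  unfolding test_function_def
proof (intro conjI allI)
  show "Ck k (\<lambda>y. \<eta> (x - y))" for k using assms by (simp add: test_function_def Ck_reflect)
  have "bounded {z. \<eta> z \<noteq> 0}"
    using assms unfolding test_function_def by (meson bounded_subset closure_subset compact_imp_bounded)
  then obtain B where B: "\<And>z. \<eta> z \<noteq> 0 \<Longrightarrow> norm z \<le> B" by (auto simp: bounded_iff)
  have "norm y \<le> norm x + B" if "\<eta> (x - y) \<noteq> 0" for y
    using B[OF that] norm_triangle_ineq4[of x "x - y"] by simp
  then have "bounded {y. \<eta> (x - y) \<noteq> 0}" unfolding bounded_iff by blast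
  then show "compact (closure {y. \<eta> (x - y) \<noteq> 0})" by (simp add: compact_closure)
qed

lemma test_functionD:
  fixes \<phi> :: "'a::euclidean_space \<Rightarrow> real"
  assumes "test_function \<phi>"
  shows "(\<phi> has_derivative frechet_derivative \<phi> (at x)) (at x)"
    and "i \<in> Basis \<Longrightarrow> continuous_on UNIV (\<lambda>x. frechet_derivative \<phi> (at x) i)"
proof -
  have "Ck (Suc 0) \<phi>" using assms by (simp only: test_function_def)
  then have "\<phi> differentiable_on UNIV" "\<forall>i\<in>Basis. continuous_on UNIV (\<lambda>x. frechet_derivative \<phi> (at x) i)"
    by simp_all
  then show "(\<phi> has_derivative frechet_derivative \<phi> (at x)) (at x)"
    "i \<in> Basis \<Longrightarrow> continuous_on UNIV (\<lambda>x. frechet_derivative \<phi> (at x) i)"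
    by (auto simp: differentiable_on_def frechet_derivative_works)
qed

lemma mollifier_derivative_support:
  assumes "mollifier e \<eta>" "frechet_derivative \<eta> (at x) i \<noteq> 0"
  shows "norm x \<le> e"
proof (rule ccontr)
  assume "\<not> norm x \<le> e"
  then have x: "x \<in> - cball 0 e" by simp
  have "(\<eta> has_derivative (\<lambda>h. 0)) (at x)"
  proof (rule has_derivative_transform_within_open[of "\<lambda>_. 0" _ _ _ "- cball 0 e"])
    show "0 = \<eta> y" if "y \<in> - cball 0 e" for y using mollifierD(2)[OF assms(1), of y] that by force
  qed (use x in auto)
  then have "frechet_derivative \<eta> (at x) = (\<lambda>h. 0)" using frechet_derivative_at by metis
  then show False using assms(2) by simp
qed

lemma integral_lebesgue_borel_representative:
  fixes f f' k :: "'a::euclidean_space \<Rightarrow> real"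
  assumes "f \<in> borel_measurable lebesgue" "f' \<in> borel_measurable borel" "AE x in lebesgue. f x = f' x"
    "k \<in> borel_measurable borel"
  shows "(LINT x|lebesgue. k x * f x) = (LINT x|lborel. k x * f' x)"
proof -
  have m: "k \<in> borel_measurable lebesgue" "f' \<in> borel_measurable lebesgue"
    using assms(2,4) by (auto intro: measurable_completion)
  have "(LINT x|lebesgue. k x * f x) = (LINT x|lebesgue. k x * f' x)"
    by (rule integral_cong_AE) (use assms m in auto)
  also have "\<dots> = (LINT x|lborel. k x * f' x)"
    by (rule integral_completion) (use assms in auto)
  finally show ?thesis .
qed

text \<open>The reflected mollifier y -> \<open>\<eta> (x - y)\<close> is itself a test function,
  and the minus sign from its derivative cancels the one in the definition of the weak gradient.
  Hence differentiating a mollification amounts to mollifying the weak derivative.\<close>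

lemma conv_weak_gradient:
  assumes wg: "has_weak_gradient u g" and \<eta>: "mollifier e \<eta>" and i: "i \<in> Basis"
    and u': "loc_int u'" "AE x in lebesgue. u x = u' x"
    and g': "loc_int g'" "AE x in lebesgue. g x \<bullet> i = g' x"
  shows "conv (\<lambda>z. frechet_derivative \<eta> (at z) i) u' x = conv \<eta> g' x"
proof -
  note m = mollifierD[OF \<eta>]
  define D where "D = (\<lambda>z. frechet_derivative \<eta> (at z) i)"
  have Dm: "(\<lambda>y. D (x - y)) \<in> borel_measurable borel" and em: "(\<lambda>y. \<eta> (x - y)) \<in> borel_measurable borel"
    unfolding D_def
    by (intro borel_measurable_continuous_onI continuous_intros
        continuous_on_compose2[OF test_functionD(2)[OF m(4) i]] continuous_on_compose2[OF m(3)]; simp)+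
  have fr: "frechet_derivative (\<lambda>y. \<eta> (x - y)) (at y) i = - D (x - y)" for y
  proof -
    have "((\<lambda>y. \<eta> (x - y)) has_derivative (\<lambda>h. frechet_derivative \<eta> (at (x - y)) (- h))) (at y)"
      by (rule has_derivative_compose[OF _ test_functionD(1)[OF m(4)]]) (auto intro!: derivative_eq_intros)
    then have "frechet_derivative (\<lambda>y. \<eta> (x - y)) (at y) = (\<lambda>h. frechet_derivative \<eta> (at (x - y)) (- h))"
      by (rule frechet_derivative_at[symmetric])
    then show ?thesis
      using linear_neg[OF has_derivative_linear[OF test_functionD(1)[OF m(4)]]] by (simp add: D_def)
  qed
  have li: "locally_integrable u" "locally_integrable (\<lambda>x. g x \<bullet> i)"
    using wg by (auto simp: has_weak_gradient_def intro: locally_integrable_inner)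
  have "(LINT y|lebesgue. u y * frechet_derivative (\<lambda>y. \<eta> (x - y)) (at y) i)
      = - (LINT y|lebesgue. (g y \<bullet> i) * \<eta> (x - y))"
    using wg test_function_reflect[OF m(4)] i unfolding has_weak_gradient_def by blast
  then have "(LINT y|lebesgue. D (x - y) * u y) = (LINT y|lebesgue. \<eta> (x - y) * (g y \<bullet> i))"
    unfolding fr by (simp add: mult.commute)
  then show ?thesis
    unfolding integral_lebesgue_borel_representative[OF locally_integrable_measurable[OF li(1)] loc_int_measurable[OF u'(1)] u'(2) Dm]
      integral_lebesgue_borel_representative[OF locally_integrable_measurable[OF li(2)] loc_int_measurable[OF g'(1)] g'(2) em]
    by (simp add: conv_def D_def)
qed

text \<open>A form of the fundamental lemma of the calculus of variations: if all mollifications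
  vanish, \<open>conv_approx\<close> bounds the integral of |h| over each ball by every positive
  \<open>\<epsilon>\<close>.\<close>

lemma AE_zero_if_conv_zero:
  fixes h :: "'a::euclidean_space \<Rightarrow> real"
  assumes h: "loc_int h" and zero: "\<And>e \<eta> x. mollifier e \<eta> \<Longrightarrow> conv \<eta> h x = 0"
  shows "AE x in lborel. h x = 0"
proof -
  have [measurable]: "h \<in> borel_measurable borel" by (rule loc_int_measurable[OF h])
  have "AE x in lborel. indicator (cball 0 (real N)) x * \<bar>h x\<bar> = 0" for N
  proof -
    let ?I = "\<integral>\<^sup>+ x. ennreal (indicator (cball 0 (real N)) x * \<bar>h x\<bar>) \<partial>lborel"
    have le: "?I \<le> 0 + ennreal \<epsilon>" if eps: "\<epsilon> > 0" for \<epsilon>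
    proof -
      obtain \<delta> where \<delta>: "\<delta> > 0" "\<And>e \<eta>. e \<le> \<delta> \<Longrightarrow> mollifier e \<eta> \<Longrightarrow>
        (\<integral>\<^sup>+ x. ennreal (indicator (cball 0 (real N)) x * \<bar>conv \<eta> h x - h x\<bar>) \<partial>lborel) \<le> ennreal \<epsilon>"
        using conv_approx[OF h eps, of "real N"] by blast
      obtain \<eta> :: "'a \<Rightarrow> real" where \<eta>: "mollifier \<delta> \<eta>" using ex_mollifier[OF \<delta>(1)] by blast
      show ?thesis using \<delta>(2)[OF order_refl \<eta>] zero[OF \<eta>] by simp
    qed
    have "?I \<le> 0" by (rule ennreal_le_epsilon) (rule le)
    then have I0: "?I = 0" by simp
    have [measurable]: "cball (0::'a) (real N) \<in> sets borel" by simp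
    have "(\<lambda>x. ennreal (indicator (cball 0 (real N)) x * \<bar>h x\<bar>)) \<in> borel_measurable lborel" by measurable
    from nn_integral_0_iff_AE[OF this] I0
    have "AE x in lborel. ennreal (indicator (cball 0 (real N)) x * \<bar>h x\<bar>) = 0" by blast
    then show ?thesis
    proof eventually_elim
      case (elim x)
      then show ?case by (cases "x \<in> cball 0 (real N)") (simp_all add: ennreal_eq_0_iff)
    qed
  qed
  then have "AE x in lborel. \<forall>N. indicator (cball 0 (real N)) x * \<bar>h x\<bar> = 0" by (subst AE_all_countable) simp
  then show ?thesis
  proof eventually_elim
    case (elim x)
    obtain N :: nat where "norm x \<le> real N" using real_arch_simple by blast
    with elim[rule_format, of N] show ?case by simp
  qed
qed

text \<open>Both candidates have the same mollifications, namely those obtained by differentiating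
  the kernel against u. This makes the integral of the squared gradient independent of the
  representative that the choice operator in \<open>weak_gradient\<close> picks.\<close>

lemma weak_gradient_unique:
  fixes u :: "'a::euclidean_space \<Rightarrow> real"
  assumes "has_weak_gradient u g1" "has_weak_gradient u g2"
  shows "AE x in lebesgue. g1 x = g2 x"
proof -
  have lu: "locally_integrable u" and lg: "locally_integrable g1" "locally_integrable g2"
    using assms by (auto simp: has_weak_gradient_def)
  obtain u' where u': "loc_int u'" "AE x in lebesgue. u x = u' x" using ex_borel_representative[OF lu] .
  have "AE x in lebesgue. g1 x \<bullet> i = g2 x \<bullet> i" if i: "i \<in> Basis" for i
  proof -
    obtain h1 where h1: "loc_int h1" "AE x in lebesgue. g1 x \<bullet> i = h1 x"
      using ex_borel_representative[OF locally_integrable_inner[OF lg(1)]] .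
    obtain h2 where h2: "loc_int h2" "AE x in lebesgue. g2 x \<bullet> i = h2 x"
      using ex_borel_representative[OF locally_integrable_inner[OF lg(2)]] .
    have "AE x in lborel. h1 x - h2 x = 0"
    proof (rule AE_zero_if_conv_zero[OF loc_int_diff[OF h1(1) h2(1)]])
      fix e and \<eta> :: "'a \<Rightarrow> real" and x assume \<eta>: "mollifier e \<eta>"
      show "conv \<eta> (\<lambda>x. h1 x - h2 x) x = 0"
        using conv_weak_gradient[OF assms(1) \<eta> i u' h1, of x] conv_weak_gradient[OF assms(2) \<eta> i u' h2, of x]
        by (simp add: conv_diff[OF \<eta> h1(1) h2(1)])
    qed
    then have "AE x in lebesgue. h1 x - h2 x = 0" by (rule AE_completion)
    with h1(2) h2(2) show ?thesis by eventually_elim simp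
  qed
  then have "AE x in lebesgue. \<forall>i\<in>Basis. g1 x \<bullet> i = g2 x \<bullet> i"
    by (rule AE_finite_allI[OF finite_Basis])
  then show ?thesis by eventually_elim (rule euclidean_eqI, blast)
qed

section \<open>The Onofri inequality in the plane\<close>

text \<open>Both measures agree on open boxes, whose preimages under the identification of pairs
  with vectors are boxes with the same side lengths.\<close>

lemma distr_vec2:
  "distr (lborel :: (real \<times> real) measure) borel (\<lambda>z. vector [fst z, snd z] :: real ^ 2) = lborel"
proof -
  have cont: "continuous_on UNIV (\<lambda>z::real \<times> real. vector [fst z, snd z] :: real ^ 2)"
  proof -
    have "(vector [a, b] :: real ^ 2) = a *\<^sub>R axis 1 1 + b *\<^sub>R axis 2 1" for a b
      by (simp add: vec_eq_iff forall_2 axis_def)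
    then show ?thesis by (simp, intro continuous_intros)
  qed
  have [measurable]: "(\<lambda>z::real \<times> real. vector [fst z, snd z] :: real ^ 2) \<in> borel_measurable borel"
    by (rule borel_measurable_continuous_onI[OF cont])
  have "lborel = distr (lborel :: (real \<times> real) measure) borel (\<lambda>z. vector [fst z, snd z] :: real ^ 2)"
  proof (rule lborel_eqI)
    fix l u :: "real ^ 2" assume lu: "\<And>b. b \<in> Basis \<Longrightarrow> l \<bullet> b \<le> u \<bullet> b"
    have le: "l $ i \<le> u $ i" for i using lu[of "axis i 1"] by (simp add: inner_axis axis_in_Basis_iff)
    have pre: "(\<lambda>z::real \<times> real. vector [fst z, snd z] :: real ^ 2) -` box l u = box (l $ 1, l $ 2) (u $ 1, u $ 2)"
      by (auto simp: mem_box_cart forall_2 mem_box Basis_prod_def)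
    have "emeasure (distr (lborel :: (real \<times> real) measure) borel (\<lambda>z. vector [fst z, snd z] :: real ^ 2)) (box l u)
        = emeasure lborel (box (l $ 1, l $ 2) (u $ 1, u $ 2))"
      by (subst emeasure_distr) (auto simp: pre)
    also have "\<dots> = ennreal ((u $ 1 - l $ 1) * (u $ 2 - l $ 2))"
    proof -
      have "box (l $ 1, l $ 2) (u $ 1, u $ 2) = box (l $ 1) (u $ 1) \<times> box (l $ 2) (u $ 2)"
        by (auto simp: mem_box Basis_prod_def)
      then show ?thesis using le[of 1] le[of 2]
        by (simp add: lborel_prod[symmetric] lborel.emeasure_pair_measure_Times ennreal_mult)
    qed
    also have "(u $ 1 - l $ 1) * (u $ 2 - l $ 2) = (\<Prod>b\<in>Basis. (u - l) \<bullet> b)"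
      by (simp add: Basis_vec_def prod.UNION_disjoint inner_axis UNIV_2 axis_eq_axis UN_Un algebra_simps)
    finally show "emeasure (distr (lborel :: (real \<times> real) measure) borel (\<lambda>z. vector [fst z, snd z] :: real ^ 2)) (box l u)
        = ennreal (\<Prod>b\<in>Basis. (u - l) \<bullet> b)" .
  qed simp
  then show ?thesis by simp
qed

lemma norm_square_vec2: "(norm x)\<^sup>2 = (x $ 1)\<^sup>2 + (x $ 2)\<^sup>2" for x :: "real ^ 2"
  by (simp add: norm_vec_def L2_set_def UNIV_2)

text \<open>The density of \<open>\<pi> \<mu>\<^sub>2\<close>.\<close>

definition \<nu> :: "real ^ 2 \<Rightarrow> real" where
  "\<nu> x = 1 / (1 + (norm x)\<^sup>2)\<^sup>2"

theorem onofri_C1_vec: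
  fixes w w1 w2 :: "real ^ 2 \<Rightarrow> real"
  assumes c0: "continuous_on UNIV w" and c1: "continuous_on UNIV w1" and c2: "continuous_on UNIV w2"
    and d1: "\<And>x t. ((\<lambda>t. w (x + t *\<^sub>R axis 1 1)) has_real_derivative w1 (x + t *\<^sub>R axis 1 1)) (at t)"
    and d2: "\<And>x t. ((\<lambda>t. w (x + t *\<^sub>R axis 2 1)) has_real_derivative w2 (x + t *\<^sub>R axis 2 1)) (at t)"
    and zero: "\<And>x. \<bar>x $ 1\<bar> > r \<or> \<bar>x $ 2\<bar> > r \<Longrightarrow> w x = 0 \<and> w1 x = 0 \<and> w2 x = 0"
  shows "integrable lborel (\<lambda>x. exp (w x) * \<nu> x)"
    and "pi * ln ((LINT x|lborel. exp (w x) * \<nu> x) / pi)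
      \<le> 1 / 16 * (LINT x|lborel. (w1 x)\<^sup>2 + (w2 x)\<^sup>2) + (LINT x|lborel. w x * \<nu> x)"
proof -
  define V :: "real \<times> real \<Rightarrow> real ^ 2" where "V = (\<lambda>z. vector [fst z, snd z])"
  have V: "V z = fst z *\<^sub>R axis 1 1 + snd z *\<^sub>R axis 2 1" for z
    by (simp add: V_def vec_eq_iff forall_2 axis_def)
  have Vc: "V z $ 1 = fst z" "V z $ 2 = snd z" for z by (simp_all add: V_def)
  have cV: "continuous_on UNIV V" unfolding V by (intro continuous_intros)
  have mV: "V \<in> lborel \<rightarrow>\<^sub>M borel" using borel_measurable_continuous_onI[OF cV] by simp
  have [measurable]: "w \<in> borel_measurable borel" "w1 \<in> borel_measurable borel" "w2 \<in> borel_measurable borel"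
    using c0 c1 c2 by (auto intro: borel_measurable_continuous_onI)
  have [measurable]: "\<nu> \<in> borel_measurable borel" unfolding \<nu>_def by measurable
  have dist: "distr lborel borel V = lborel" using distr_vec2 by (simp add: V_def)
  have nuV: "\<nu> (V z) = 1 / (japanese z)\<^sup>2" for z
    by (simp add: \<nu>_def norm_square_vec2 Vc add.assoc)
  have tr: "(LINT x|lborel. f x) = (LINT z|lborel. f (V z))" if "f \<in> borel_measurable borel" for f :: "real ^ 2 \<Rightarrow> real"
    using integral_distr[OF mV that] by (simp add: dist)
  have tri: "integrable lborel f \<longleftrightarrow> integrable lborel (\<lambda>z. f (V z))" if "f \<in> borel_measurable borel" for f :: "real ^ 2 \<Rightarrow> real"
    using integrable_distr_eq[OF mV that] by (simp add: dist)
  have C: "continuous_on UNIV (\<lambda>z. w (V z))" "continuous_on UNIV (\<lambda>z. w1 (V z))" "continuous_on UNIV (\<lambda>z. w2 (V z))"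
    by (auto intro: continuous_on_compose2[OF c0 cV] continuous_on_compose2[OF c1 cV] continuous_on_compose2[OF c2 cV])
  have D1: "((\<lambda>x. w (V (x, y))) has_real_derivative w1 (V (x, y))) (at x)" for x y
    using d1[of "y *\<^sub>R axis 2 1" x] by (simp add: V add.commute)
  have D2: "((\<lambda>y. w (V (x, y))) has_real_derivative w2 (V (x, y))) (at y)" for x y
    using d2[of "x *\<^sub>R axis 1 1" y] by (simp add: V)
  have Z: "w (V z) = 0 \<and> w1 (V z) = 0 \<and> w2 (V z) = 0" if "z \<notin> square r" for z
    by (rule zero) (use that in \<open>cases z; auto simp: Vc\<close>)
  note main = onofri_C1[of "\<lambda>z. w (V z)" "\<lambda>z. w1 (V z)" "\<lambda>z. w2 (V z)", OF C D1 D2 Z]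
  show "integrable lborel (\<lambda>x. exp (w x) * \<nu> x)"
    using main(1) by (subst tri) (simp_all add: nuV)
  have "(LINT x|lborel. exp (w x) * \<nu> x) = (LINT z|lborel. exp (w (V z)) / (japanese z)\<^sup>2)"
    by (subst tr) (simp_all add: nuV)
  moreover have "(LINT x|lborel. w x * \<nu> x) = (LINT z|lborel. w (V z) / (japanese z)\<^sup>2)"
    by (subst tr) (simp_all add: nuV)
  moreover have "(LINT x|lborel. (w1 x)\<^sup>2 + (w2 x)\<^sup>2) = (LINT z|lborel. (w1 (V z))\<^sup>2 + (w2 (V z))\<^sup>2)"
    by (subst tr) simp_all
  ultimately show "pi * ln ((LINT x|lborel. exp (w x) * \<nu> x) / pi)
      \<le> 1 / 16 * (LINT x|lborel. (w1 x)\<^sup>2 + (w2 x)\<^sup>2) + (LINT x|lborel. w x * \<nu> x)"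
    using main(2) by simp
qed

section \<open>Cutoff functions\<close>

text \<open>Squaring the positive part makes the function continuously differentiable, and the
  inequality for compactly supported functions asks for no more; a smooth cutoff would make the
  derivative bound less explicit.\<close>

definition cutoff :: "real \<Rightarrow> real" where
  "cutoff t = (max 0 (1 - t\<^sup>2))\<^sup>2"

definition cutoff' :: "real \<Rightarrow> real" where
  "cutoff' t = - 4 * t * max 0 (1 - t\<^sup>2)"

lemma DERIV_max_square: "((\<lambda>s::real. (max 0 s)\<^sup>2) has_real_derivative 2 * max 0 s) (at s)"
proof -
  consider "s > 0" | "s < 0" | "s = 0" by linarith
  then show ?thesis
  proof cases
    case 1
    have "((\<lambda>s::real. s\<^sup>2) has_real_derivative 2 * max 0 s) (at s)"
      using 1 by (auto intro!: derivative_eq_intros)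
    then show ?thesis
      by (rule has_field_derivative_transform_within_open[of _ _ _ "{0<..}"]) (use 1 in auto)
  next
    case 2
    have "((\<lambda>s::real. 0) has_real_derivative 2 * max 0 s) (at s)" using 2 by simp
    then show ?thesis
      by (rule has_field_derivative_transform_within_open[of _ _ _ "{..<0}"]) (use 2 in auto)
  next
    case 3
    have "(\<lambda>h::real. ((max 0 (0 + h))\<^sup>2 - (max 0 0)\<^sup>2) / h) \<midarrow>0\<rightarrow> 0"
    proof (rule Lim_null_comparison)
      show "(\<lambda>h::real. \<bar>h\<bar>) \<midarrow>0\<rightarrow> 0" by (rule tendsto_rabs_zero) (rule tendsto_ident_at)
      show "\<forall>\<^sub>F h::real in at 0. norm (((max 0 (0 + h))\<^sup>2 - (max 0 0)\<^sup>2) / h) \<le> \<bar>h\<bar>"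
        by (intro always_eventually allI) (auto simp: max_def power2_eq_square)
    qed
    then show ?thesis unfolding 3 DERIV_def by simp
  qed
qed

lemma DERIV_cutoff: "(cutoff has_real_derivative cutoff' t) (at t)"
proof -
  have "((\<lambda>t. (max 0 (1 - t\<^sup>2))\<^sup>2) has_real_derivative 2 * max 0 (1 - t\<^sup>2) * (- 2 * t)) (at t)"
    by (rule DERIV_chain2[OF DERIV_max_square]) (auto intro!: derivative_eq_intros)
  then show ?thesis by (simp add: cutoff_def[abs_def] cutoff'_def mult_ac)
qed

lemma continuous_cutoff: "continuous_on S cutoff" "continuous_on S cutoff'"
  unfolding cutoff_def[abs_def] cutoff'_def[abs_def] by (intro continuous_intros)+

lemma cutoff_support: "\<bar>t\<bar> \<ge> 1 \<Longrightarrow> cutoff t = 0" "\<bar>t\<bar> \<ge> 1 \<Longrightarrow> cutoff' t = 0"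
proof -
  assume "\<bar>t\<bar> \<ge> 1"
  then have "t\<^sup>2 \<ge> 1" using abs_le_square_iff[of 1 t] by simp
  then show "cutoff t = 0" "cutoff' t = 0" by (auto simp: cutoff_def cutoff'_def)
qed

lemma cutoff_bounds: "0 \<le> cutoff t" "cutoff t \<le> 1" "\<bar>cutoff' t\<bar> \<le> 4"
proof -
  have m: "0 \<le> max 0 (1 - t\<^sup>2)" "max 0 (1 - t\<^sup>2) \<le> 1" by auto
  show "0 \<le> cutoff t" by (simp add: cutoff_def)
  show "cutoff t \<le> 1" unfolding cutoff_def using m by (intro power_le_one)
  show "\<bar>cutoff' t\<bar> \<le> 4"
  proof (cases "\<bar>t\<bar> \<ge> 1")
    case False
    have "\<bar>cutoff' t\<bar> = 4 * (\<bar>t\<bar> * max 0 (1 - t\<^sup>2))" by (simp add: cutoff'_def abs_mult)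
    also have "\<dots> \<le> 4 * (1 * 1)" using m False by (intro mult_left_mono mult_mono) auto
    finally show ?thesis by simp
  qed (simp add: cutoff_support)
qed

lemma nu_facts: "\<nu> x > 0" "\<nu> x \<le> 1" "continuous_on UNIV \<nu>" "integrable lborel \<nu>" "(LINT x|lborel. \<nu> x) = pi"
proof -
  have p: "1 + (norm x)\<^sup>2 > 0" for x :: "real ^ 2" by (simp add: add_pos_nonneg)
  have nz: "1 + (norm x)\<^sup>2 \<noteq> 0" for x :: "real ^ 2" using p[of x] by (metis less_irrefl)
  show "\<nu> x > 0" by (simp add: \<nu>_def nz)
  show "\<nu> x \<le> 1" 
  proof -
    have "1 \<le> (1 + (norm x)\<^sup>2)\<^sup>2" by (rule one_le_power) simp
    then show ?thesis by (simp add: \<nu>_def divide_le_eq_1)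
  qed
  show "continuous_on UNIV \<nu>" unfolding \<nu>_def[abs_def]
    by (intro continuous_intros) (simp add: nz)
  show "integrable lborel \<nu>" "(LINT x|lborel. \<nu> x) = pi"
    using has_bochner_integral_mu[where 'a="real ^ 2"] unfolding \<nu>_def[abs_def] has_bochner_integral_iff by auto
qed

definition cutoff2 :: "real \<Rightarrow> real ^ 2 \<Rightarrow> real" where
  "cutoff2 N x = cutoff (x $ 1 / N) * cutoff (x $ 2 / N)"

lemma cutoff2_bounds: "0 \<le> cutoff2 N x" "cutoff2 N x \<le> 1"
  unfolding cutoff2_def by (auto intro: mult_nonneg_nonneg mult_le_one cutoff_bounds)

lemma cutoff2_tendsto: "(\<lambda>n. cutoff2 (real (Suc n)) x) \<longlonglongrightarrow> 1"
proof -
  have "(\<lambda>n. cutoff2 (real (Suc n)) x) \<longlonglongrightarrow> cutoff 0 * cutoff 0"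
    unfolding cutoff2_def
  proof (intro tendsto_mult isCont_tendsto_compose[of _ cutoff])
    show "isCont cutoff 0" using continuous_cutoff(1)[of UNIV] by (simp add: continuous_on_eq_continuous_at)
    show "(\<lambda>n. c / real (Suc n)) \<longlonglongrightarrow> 0" for c
      by (rule LIMSEQ_Suc[OF lim_const_over_n])
    then show "(\<lambda>n. x $ 2 / real (Suc n)) \<longlonglongrightarrow> 0" .
    show "isCont cutoff 0" using continuous_cutoff(1)[of UNIV] by (simp add: continuous_on_eq_continuous_at)
  qed
  then show ?thesis by (simp add: cutoff_def)
qed

lemma cutoff2_support:
  assumes "N > 0" "cutoff2 N x \<noteq> 0"
  shows "norm x \<le> 2 * N"
proof -
  have "\<bar>x $ i / N\<bar> < 1" if "i = 1 \<or> i = 2" for i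
    using assms(2) cutoff_support(1)[of "x $ i / N"] that unfolding cutoff2_def by (auto simp: not_le[symmetric])
  then have "\<bar>x $ 1\<bar> < N" "\<bar>x $ 2\<bar> < N" using assms(1) by (auto simp: abs_divide)
  then show ?thesis using norm_le_l1_cart[of x] by (simp add: UNIV_2)
qed

text \<open>Young's inequality with a weight: for small \<open>\<theta>\<close> the coefficient of
  a^2 stays close to 1, so the sharp constant survives the cutoff, while the large coefficient falls
  on the error term.\<close>

lemma square_add_le:
  fixes a b :: real
  assumes "\<theta> > 0"
  shows "(a + b)\<^sup>2 \<le> (1 + \<theta>) * a\<^sup>2 + (1 + 1 / \<theta>) * b\<^sup>2"
proof -
  have "0 \<le> (\<theta> * a - b)\<^sup>2 / \<theta>" using assms by simp
  also have "\<dots> = \<theta> * a\<^sup>2 - 2 * a * b + b\<^sup>2 / \<theta>"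
    using assms by (simp add: power2_diff power2_eq_square field_simps)
  finally show ?thesis by (simp add: power2_sum algebra_simps)
qed

text \<open>By the product rule the gradient of the truncated function is the truncated gradient
  plus v times the gradient of the cutoff. Each component of the latter is at most 4 / N, which
  accounts for 32 = 2 * 4^2. The error is a multiple of (1 + 1 / \<open>\<theta>\<close>) / N^2, so
  \<open>\<theta>\<close> = 1 / N makes it vanish while 1 + \<open>\<theta>\<close> tends to
  1.\<close>

lemma onofri_cutoff:
  fixes v D1 D2 :: "real ^ 2 \<Rightarrow> real"
  assumes c: "continuous_on UNIV v" "continuous_on UNIV D1" "continuous_on UNIV D2"
    and d1: "\<And>x t. ((\<lambda>t. v (x + t *\<^sub>R axis 1 1)) has_real_derivative D1 (x + t *\<^sub>R axis 1 1)) (at t)"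
    and d2: "\<And>x t. ((\<lambda>t. v (x + t *\<^sub>R axis 2 1)) has_real_derivative D2 (x + t *\<^sub>R axis 2 1)) (at t)"
    and i: "integrable lborel (\<lambda>x. (v x)\<^sup>2)" "integrable lborel (\<lambda>x. (D1 x)\<^sup>2)" "integrable lborel (\<lambda>x. (D2 x)\<^sup>2)"
    and N: "N > 0" and \<theta>: "\<theta> > 0"
  shows "integrable lborel (\<lambda>x. exp (cutoff2 N x * v x) * \<nu> x)"
    and "pi * ln ((LINT x|lborel. exp (cutoff2 N x * v x) * \<nu> x) / pi)
      \<le> 1 / 16 * ((1 + \<theta>) * ((LINT x|lborel. (D1 x)\<^sup>2) + (LINT x|lborel. (D2 x)\<^sup>2))
          + (1 + 1 / \<theta>) * (32 / N\<^sup>2) * (LINT x|lborel. (v x)\<^sup>2))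
        + (LINT x|lborel. cutoff2 N x * v x * \<nu> x)"
proof -
  define s1 where "s1 = (\<lambda>x::real ^ 2. cutoff' (x $ 1 / N) / N * cutoff (x $ 2 / N))"
  define s2 where "s2 = (\<lambda>x::real ^ 2. cutoff (x $ 1 / N) * (cutoff' (x $ 2 / N) / N))"
  define w where "w = (\<lambda>x. cutoff2 N x * v x)"
  define w1 where "w1 = (\<lambda>x. cutoff2 N x * D1 x + s1 x * v x)"
  define w2 where "w2 = (\<lambda>x. cutoff2 N x * D2 x + s2 x * v x)"
  note cc = continuous_on_compose2[OF continuous_cutoff(1)[of UNIV]] continuous_on_compose2[OF continuous_cutoff(2)[of UNIV]]
  have cs: "continuous_on UNIV (cutoff2 N)" "continuous_on UNIV s1" "continuous_on UNIV s2"
    unfolding cutoff2_def[abs_def] s1_def s2_def using N by (intro continuous_intros cc; simp)+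
  have cw: "continuous_on UNIV w" "continuous_on UNIV w1" "continuous_on UNIV w2"
    unfolding w_def w1_def w2_def by (intro continuous_intros cs c)+
  have e1: "((\<lambda>t. w (x + t *\<^sub>R axis 1 1)) has_real_derivative w1 (x + t *\<^sub>R axis 1 1)) (at t)" for x t
  proof -
    have "((\<lambda>t. cutoff ((x $ 1 + t) / N)) has_real_derivative cutoff' ((x $ 1 + t) / N) * (1 / N)) (at t)"
      by (rule DERIV_chain2[OF DERIV_cutoff]) (use N in \<open>auto intro!: derivative_eq_intros\<close>)
    then have "((\<lambda>t. cutoff ((x $ 1 + t) / N) * cutoff (x $ 2 / N) * v (x + t *\<^sub>R axis 1 1)) has_real_derivative
        (cutoff' ((x $ 1 + t) / N) * (1 / N) * cutoff (x $ 2 / N)) * v (x + t *\<^sub>R axis 1 1)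
        + D1 (x + t *\<^sub>R axis 1 1) * (cutoff ((x $ 1 + t) / N) * cutoff (x $ 2 / N))) (at t)"
      by (intro DERIV_mult DERIV_cmult_right d1)
    then show ?thesis
      by (simp add: w_def w1_def cutoff2_def s1_def axis_def algebra_simps)
  qed
  have e2: "((\<lambda>t. w (x + t *\<^sub>R axis 2 1)) has_real_derivative w2 (x + t *\<^sub>R axis 2 1)) (at t)" for x t
  proof -
    have "((\<lambda>t. cutoff ((x $ 2 + t) / N)) has_real_derivative cutoff' ((x $ 2 + t) / N) * (1 / N)) (at t)"
      by (rule DERIV_chain2[OF DERIV_cutoff]) (use N in \<open>auto intro!: derivative_eq_intros\<close>)
    then have "((\<lambda>t. cutoff (x $ 1 / N) * cutoff ((x $ 2 + t) / N) * v (x + t *\<^sub>R axis 2 1)) has_real_derivative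
        (cutoff (x $ 1 / N) * (cutoff' ((x $ 2 + t) / N) * (1 / N))) * v (x + t *\<^sub>R axis 2 1)
        + D2 (x + t *\<^sub>R axis 2 1) * (cutoff (x $ 1 / N) * cutoff ((x $ 2 + t) / N))) (at t)"
      by (intro DERIV_mult DERIV_cmult d2)
    then show ?thesis
      by (simp add: w_def w2_def cutoff2_def s2_def axis_def algebra_simps)
  qed
  have zero: "w x = 0 \<and> w1 x = 0 \<and> w2 x = 0" if "\<bar>x $ 1\<bar> > N \<or> \<bar>x $ 2\<bar> > N" for x
  proof -
    have "\<bar>x $ 1 / N\<bar> \<ge> 1 \<or> \<bar>x $ 2 / N\<bar> \<ge> 1" using that N by auto
    then show ?thesis
      by (auto simp: w_def w1_def w2_def cutoff2_def s1_def s2_def cutoff_support)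
  qed
  have m1: "integrable lborel (\<lambda>x. exp (w x) * \<nu> x)"
    by (rule onofri_C1_vec(1)[OF cw e1 e2 zero])
  have m2: "pi * ln ((LINT x|lborel. exp (w x) * \<nu> x) / pi)
      \<le> 1 / 16 * (LINT x|lborel. (w1 x)\<^sup>2 + (w2 x)\<^sup>2) + (LINT x|lborel. w x * \<nu> x)"
    by (rule onofri_C1_vec(2)[OF cw e1 e2 zero])
  show "integrable lborel (\<lambda>x. exp (cutoff2 N x * v x) * \<nu> x)" using m1 by (simp add: w_def)
  have sb: "(s1 x)\<^sup>2 \<le> 16 / N\<^sup>2" "(s2 x)\<^sup>2 \<le> 16 / N\<^sup>2" for x
  proof -
    have "\<bar>cutoff' a / N * cutoff b\<bar> \<le> 4 / N * 1" for a b
      unfolding abs_mult using cutoff_bounds N by (intro mult_mono) (auto simp: divide_right_mono)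
    then have "(cutoff' a / N * cutoff b)\<^sup>2 \<le> (4 / N)\<^sup>2" for a b
      using N by (simp add: abs_le_square_iff[symmetric])
    then have sq: "(cutoff' a / N * cutoff b)\<^sup>2 \<le> 16 / N\<^sup>2" for a b by (simp only: power_divide) simp
    show "(s1 x)\<^sup>2 \<le> 16 / N\<^sup>2" unfolding s1_def by (rule sq)
    show "(s2 x)\<^sup>2 \<le> 16 / N\<^sup>2" unfolding s2_def by (subst mult.commute) (rule sq)
  qed
  have summand: "(cutoff2 N x * d + s * v x)\<^sup>2 \<le> (1 + \<theta>) * d\<^sup>2 + (1 + 1 / \<theta>) * (16 / N\<^sup>2) * (v x)\<^sup>2"
    if "s\<^sup>2 \<le> 16 / N\<^sup>2" for x d s
  proof -
    have "(cutoff2 N x * d + s * v x)\<^sup>2 \<le> (1 + \<theta>) * (cutoff2 N x * d)\<^sup>2 + (1 + 1 / \<theta>) * (s * v x)\<^sup>2"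
      by (rule square_add_le[OF \<theta>])
    also have "\<dots> \<le> (1 + \<theta>) * d\<^sup>2 + (1 + 1 / \<theta>) * (16 / N\<^sup>2 * (v x)\<^sup>2)"
    proof (intro add_mono mult_left_mono)
      have "(cutoff2 N x)\<^sup>2 \<le> 1" using cutoff2_bounds[of N x] by (intro power_le_one)
      from mult_right_mono[OF this, of "d\<^sup>2"] show "(cutoff2 N x * d)\<^sup>2 \<le> d\<^sup>2" by (simp add: power_mult_distrib)
      show "(s * v x)\<^sup>2 \<le> 16 / N\<^sup>2 * (v x)\<^sup>2"
        unfolding power_mult_distrib by (rule mult_right_mono[OF that]) simp
    qed (use \<theta> in auto)
    finally show ?thesis by (simp only: mult.assoc)
  qed
  let ?B = "\<lambda>x. (1 + \<theta>) * ((D1 x)\<^sup>2 + (D2 x)\<^sup>2) + (1 + 1 / \<theta>) * (32 / N\<^sup>2) * (v x)\<^sup>2"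
  have pw: "(w1 x)\<^sup>2 + (w2 x)\<^sup>2 \<le> ?B x" for x
  proof -
    have "(w1 x)\<^sup>2 + (w2 x)\<^sup>2 \<le> ((1 + \<theta>) * (D1 x)\<^sup>2 + (1 + 1 / \<theta>) * (16 / N\<^sup>2) * (v x)\<^sup>2)
        + ((1 + \<theta>) * (D2 x)\<^sup>2 + (1 + 1 / \<theta>) * (16 / N\<^sup>2) * (v x)\<^sup>2)"
      unfolding w1_def w2_def by (intro add_mono summand sb)
    also have "\<dots> = ?B x" by (simp add: algebra_simps)
    finally show ?thesis .
  qed
  have iB: "integrable lborel ?B" using i by auto
  have "(LINT x|lborel. (w1 x)\<^sup>2 + (w2 x)\<^sup>2) \<le> (LINT x|lborel. ?B x)"
  proof (rule integral_mono[OF _ iB pw])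
    show "integrable lborel (\<lambda>x. (w1 x)\<^sup>2 + (w2 x)\<^sup>2)"
    proof (rule Bochner_Integration.integrable_bound[OF iB])
      show "(\<lambda>x. (w1 x)\<^sup>2 + (w2 x)\<^sup>2) \<in> borel_measurable lborel"
        using borel_measurable_continuous_onI[OF cw(2)] borel_measurable_continuous_onI[OF cw(3)] by simp
      show "AE x in lborel. norm ((w1 x)\<^sup>2 + (w2 x)\<^sup>2) \<le> norm (?B x)"
      proof (rule AE_I2)
        fix x
        show "norm ((w1 x)\<^sup>2 + (w2 x)\<^sup>2) \<le> norm (?B x)" using pw[of x] by (simp add: abs_of_nonneg)
      qed
    qed
  qed
  also have "(LINT x|lborel. ?B x) = (1 + \<theta>) * ((LINT x|lborel. (D1 x)\<^sup>2) + (LINT x|lborel. (D2 x)\<^sup>2))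
          + (1 + 1 / \<theta>) * (32 / N\<^sup>2) * (LINT x|lborel. (v x)\<^sup>2)"
    using i by simp
  finally have fin: "(LINT x|lborel. (w1 x)\<^sup>2 + (w2 x)\<^sup>2)
      \<le> (1 + \<theta>) * ((LINT x|lborel. (D1 x)\<^sup>2) + (LINT x|lborel. (D2 x)\<^sup>2))
          + (1 + 1 / \<theta>) * (32 / N\<^sup>2) * (LINT x|lborel. (v x)\<^sup>2)" .
  show "pi * ln ((LINT x|lborel. exp (cutoff2 N x * v x) * \<nu> x) / pi)
      \<le> 1 / 16 * ((1 + \<theta>) * ((LINT x|lborel. (D1 x)\<^sup>2) + (LINT x|lborel. (D2 x)\<^sup>2))
          + (1 + 1 / \<theta>) * (32 / N\<^sup>2) * (LINT x|lborel. (v x)\<^sup>2))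
        + (LINT x|lborel. cutoff2 N x * v x * \<nu> x)"
    by (rule order_trans[OF m2[unfolded w_def] add_right_mono[OF mult_left_mono[OF fin]]]) simp
qed

section \<open>Passage to the limit for square-integrable weak derivatives\<close>

text \<open>The right side converges, or is bounded by quantities that converge, along mollified and
  truncated functions. Only the exponential integral lacks a dominating function: Fatou's lemma
  bounds it from above, which proves its finiteness along with the inequality.\<close>

theorem onofri_borel:
  fixes u g1 g2 :: "real ^ 2 \<Rightarrow> real"
  assumes loc: "loc_int u" "loc_int g1" "loc_int g2"
    and i: "integrable lborel (\<lambda>x. (u x)\<^sup>2)" "integrable lborel (\<lambda>x. (g1 x)\<^sup>2)" "integrable lborel (\<lambda>x. (g2 x)\<^sup>2)"
    and wd1: "\<And>e \<eta> x. mollifier e \<eta> \<Longrightarrow> conv (\<lambda>z. frechet_derivative \<eta> (at z) (axis 1 1)) u x = conv \<eta> g1 x"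
    and wd2: "\<And>e \<eta> x. mollifier e \<eta> \<Longrightarrow> conv (\<lambda>z. frechet_derivative \<eta> (at z) (axis 2 1)) u x = conv \<eta> g2 x"
  shows "integrable lborel (\<lambda>x. exp (u x) * \<nu> x)" and "integrable lborel (\<lambda>x. u x * \<nu> x)"
    and "pi * ln ((LINT x|lborel. exp (u x) * \<nu> x) / pi)
      \<le> 1 / 16 * ((LINT x|lborel. (g1 x)\<^sup>2) + (LINT x|lborel. (g2 x)\<^sup>2)) + (LINT x|lborel. u x * \<nu> x)"
proof -
  note nu = nu_facts
  have expnu: "0 \<le> exp a * \<nu> x" for a x using nu(1)[of x] by simp
  have [measurable]: "u \<in> borel_measurable borel" by (rule loc_int_measurable[OF loc(1)])
  have [measurable]: "\<nu> \<in> borel_measurable borel" by (rule borel_measurable_continuous_onI[OF nu(3)])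
  \<comment> \<open>The ball contains the support of the cutoff with N = n + 1, by
    \<open>cutoff2_support\<close>. The bounds are summable in n, so almost everywhere convergence
    will hold for the whole sequence, without extracting a subsequence.\<close>
  have ex: "\<exists>\<eta>. (\<exists>e. mollifier e \<eta>) \<and> (\<integral>\<^sup>+ x. ennreal (indicator (cball 0 (2 * real (Suc n))) x * \<bar>conv \<eta> u x - u x\<bar>) \<partial>lborel) \<le> ennreal ((1 / 2) ^ n)" for n
  proof -
    have pos: "(1 / 2 :: real) ^ n > 0" by simp
    obtain \<delta> where \<delta>: "\<delta> > 0" "\<And>e \<eta>. e \<le> \<delta> \<Longrightarrow> mollifier e \<eta> \<Longrightarrow>
      (\<integral>\<^sup>+ x. ennreal (indicator (cball 0 (2 * real (Suc n))) x * \<bar>conv \<eta> u x - u x\<bar>) \<partial>lborel) \<le> ennreal ((1 / 2) ^ n)"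
      using conv_approx[OF loc(1) pos, of "2 * real (Suc n)"] by blast
    obtain \<eta> :: "real ^ 2 \<Rightarrow> real" where "mollifier \<delta> \<eta>" using ex_mollifier[OF \<delta>(1)] by blast
    then show ?thesis using \<delta>(2)[OF order_refl] by blast
  qed
  have "\<exists>\<eta>. \<forall>n. (\<exists>e. mollifier e (\<eta> n)) \<and> (\<integral>\<^sup>+ x. ennreal (indicator (cball 0 (2 * real (Suc n))) x * \<bar>conv (\<eta> n) u x - u x\<bar>) \<partial>lborel) \<le> ennreal ((1 / 2) ^ n)"
    by (intro choice allI ex)
  then obtain \<eta> where ex': "\<And>n. \<exists>e. mollifier e (\<eta> n)"
    and approx: "\<And>n. (\<integral>\<^sup>+ x. ennreal (indicator (cball 0 (2 * real (Suc n))) x * \<bar>conv (\<eta> n) u x - u x\<bar>) \<partial>lborel) \<le> ennreal ((1 / 2) ^ n)"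
    by blast
  have "\<exists>e. \<forall>n. mollifier (e n) (\<eta> n)" by (intro choice allI ex')
  then obtain e where \<eta>: "\<And>n. mollifier (e n) (\<eta> n)" by blast
  define v where "v = (\<lambda>n. conv (\<eta> n) u)"
  define \<xi> where "\<xi> = (\<lambda>n. cutoff2 (real (Suc n)))"
  define F where "F = (\<lambda>n x. indicator (cball 0 (2 * real (Suc n))) x * \<bar>v n x - u x\<bar>)"
  have cv: "continuous_on UNIV (v n)" for n unfolding v_def by (rule continuous_conv_mollifier[OF \<eta> loc(1)])
  have c\<xi>: "continuous_on UNIV (\<xi> n)" for n
    unfolding \<xi>_def cutoff2_def[abs_def]
    by (intro continuous_intros continuous_on_compose2[OF continuous_cutoff(1)[of UNIV]]) auto
  have [measurable]: "v n \<in> borel_measurable borel" "\<xi> n \<in> borel_measurable borel" for n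
    using cv c\<xi> by (auto intro: borel_measurable_continuous_onI)
  have Fm[measurable]: "F n \<in> borel_measurable borel" for n
  proof -
    have [measurable]: "cball (0 :: real ^ 2) (2 * real (Suc n)) \<in> sets borel" by simp
    show ?thesis unfolding F_def by measurable
  qed
  have F0: "F n x \<ge> 0" for n x by (simp add: F_def)
  have \<xi>01: "0 \<le> \<xi> n x" "\<xi> n x \<le> 1" for n x unfolding \<xi>_def by (rule cutoff2_bounds)+
  have \<xi>F: "\<bar>\<xi> n x * (v n x - u x) * \<nu> x\<bar> \<le> F n x" for n x
  proof (cases "\<xi> n x = 0")
    case False
    then have "norm x \<le> 2 * real (Suc n)" unfolding \<xi>_def by (intro cutoff2_support) auto
    then have "F n x = \<bar>v n x - u x\<bar>" by (simp add: F_def)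
    moreover have "\<xi> n x * \<nu> x * \<bar>v n x - u x\<bar> \<le> 1 * \<bar>v n x - u x\<bar>"
      using \<xi>01[of n x] nu(1,2)[of x] by (intro mult_right_mono mult_le_one) auto
    ultimately show ?thesis using \<xi>01(1)[of n x] nu(1)[of x] by (simp add: abs_mult mult_ac)
  qed (use F0 in simp)
  have sumF: "(\<integral>\<^sup>+ x. (\<Sum>n. ennreal (F n x)) \<partial>lborel) \<noteq> \<infinity>"
  proof -
    have "(\<integral>\<^sup>+ x. (\<Sum>n. ennreal (F n x)) \<partial>lborel) = (\<Sum>n. \<integral>\<^sup>+ x. ennreal (F n x) \<partial>lborel)"
      by (rule nn_integral_suminf) measurable
    also have "\<dots> \<le> (\<Sum>n. ennreal ((1 / 2) ^ n))"
      using approx by (intro suminf_le) (auto simp: F_def v_def)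
    also have "\<dots> = ennreal (\<Sum>n. (1 / 2) ^ n)"
      by (rule suminf_ennreal2) (auto intro: summable_geometric)
    finally show ?thesis using ennreal_less_top by (auto simp: top_unique)
  qed
  have "AE x in lborel. (\<Sum>n. ennreal (F n x)) \<noteq> \<infinity>"
    by (rule nn_integral_noteq_infinite[OF _ sumF]) measurable
  then have vlim: "AE x in lborel. (\<lambda>n. v n x) \<longlonglongrightarrow> u x"
  proof eventually_elim
    case (elim x)
    have "summable (\<lambda>n. F n x)" using F0 elim by (intro summable_suminf_not_top) auto
    then have lim: "(\<lambda>n. F n x) \<longlonglongrightarrow> 0" by (rule summable_LIMSEQ_zero)
    obtain k :: nat where k: "norm x \<le> real k" using real_arch_simple by blast
    have "\<forall>\<^sub>F n in sequentially. F n x = \<bar>v n x - u x\<bar>"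
      unfolding eventually_sequentially
    proof (intro exI[of _ k] allI impI)
      fix n assume "k \<le> n"
      then have "real k \<le> real n" by simp
      then have "norm x \<le> 2 * real (Suc n)" using k by simp
      then show "F n x = \<bar>v n x - u x\<bar>" by (simp add: F_def)
    qed
    with lim have "(\<lambda>n. \<bar>v n x - u x\<bar>) \<longlonglongrightarrow> 0" by (rule Lim_transform_eventually)
    then have "(\<lambda>n. v n x - u x) \<longlonglongrightarrow> 0" by (rule tendsto_rabs_zero_cancel)
    then show ?case by (rule LIM_zero_cancel)
  qed
  \<comment> \<open>From |u| <= u^2 + 1 and \<open>\<nu> x \<le> 1\<close>: square integrability
    over the plane and the finite mass of \<open>\<nu>\<close> make the linear term
    integrable.\<close>
  have unb: "\<bar>u x * \<nu> x\<bar> \<le> (u x)\<^sup>2 + \<nu> x" for x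
  proof -
    have "\<bar>u x\<bar> \<le> (u x)\<^sup>2 + 1" using sum_squares_bound[of "\<bar>u x\<bar>" 1] by (simp; smt (verit) zero_le_power2)
    then have "\<bar>u x\<bar> * \<nu> x \<le> ((u x)\<^sup>2 + 1) * \<nu> x" using nu(1)[of x] by (intro mult_right_mono) auto
    also have "\<dots> \<le> (u x)\<^sup>2 + \<nu> x" using mult_left_mono[OF nu(2)[of x], of "(u x)\<^sup>2"] by (simp add: distrib_right)
    finally show ?thesis using nu(1)[of x] by (simp add: abs_mult)
  qed
  have iun: "integrable lborel (\<lambda>x. (u x)\<^sup>2 + \<nu> x)" using i(1) nu(4) by auto
  show iu: "integrable lborel (\<lambda>x. u x * \<nu> x)"
  proof (rule Bochner_Integration.integrable_bound[OF iun])
    show "AE x in lborel. norm (u x * \<nu> x) \<le> norm ((u x)\<^sup>2 + \<nu> x)"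
    proof (rule AE_I2)
      show "norm (u x * \<nu> x) \<le> norm ((u x)\<^sup>2 + \<nu> x)" for x using unb[of x] by simp
    qed
  qed measurable
  \<comment> \<open>The linear term splits as \<open>a n + b n\<close>: the mollification error,
    which the approximation bound sends to 0, and the truncated integral of u, which converges by
    domination.\<close>
  define a where "a = (\<lambda>n. LINT x|lborel. \<xi> n x * (v n x - u x) * \<nu> x)"
  define b where "b = (\<lambda>n. LINT x|lborel. \<xi> n x * u x * \<nu> x)"
  have FI: "(\<integral>\<^sup>+ x. ennreal (F n x) \<partial>lborel) \<le> ennreal ((1 / 2) ^ n)" for n
    using approx by (simp add: F_def v_def)
  have iF: "integrable lborel (F n)" for n
    by (rule integrableI_nonneg) (use F0 FI[of n] in \<open>auto intro: order.strict_trans1 ennreal_less_top\<close>)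
  have ia: "integrable lborel (\<lambda>x. \<xi> n x * (v n x - u x) * \<nu> x)" for n
  proof (rule Bochner_Integration.integrable_bound[OF iF[of n]])
    show "AE x in lborel. norm (\<xi> n x * (v n x - u x) * \<nu> x) \<le> norm (F n x)"
    proof (rule AE_I2)
      show "norm (\<xi> n x * (v n x - u x) * \<nu> x) \<le> norm (F n x)" for x using \<xi>F[of n x] F0[of n x] by simp
    qed
  qed measurable
  have "\<bar>a n\<bar> \<le> (1 / 2) ^ n" for n
  proof -
    have "ennreal \<bar>a n\<bar> \<le> (\<integral>\<^sup>+ x. ennreal \<bar>\<xi> n x * (v n x - u x) * \<nu> x\<bar> \<partial>lborel)"
      using integral_norm_bound_ennreal[OF ia[of n]] by (simp add: a_def)
    also have "\<dots> \<le> (\<integral>\<^sup>+ x. ennreal (F n x) \<partial>lborel)" by (intro nn_integral_mono ennreal_leI \<xi>F)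
    also note FI
    finally show ?thesis by (simp add: ennreal_le_iff)
  qed
  moreover have "(\<lambda>n. (1 / 2 :: real) ^ n) \<longlonglongrightarrow> 0" by (rule LIMSEQ_realpow_zero) auto
  ultimately have lima: "a \<longlonglongrightarrow> 0"
    by (intro Lim_null_comparison[of a "\<lambda>n. (1 / 2) ^ n"]) auto
  have bb: "\<bar>\<xi> n x * u x * \<nu> x\<bar> \<le> \<bar>u x * \<nu> x\<bar>" for n x
    using mult_right_mono[OF \<xi>01(2)[of n x], of "\<bar>u x * \<nu> x\<bar>"] \<xi>01(1)[of n x] by (simp add: abs_mult mult.assoc)
  have limb: "b \<longlonglongrightarrow> (LINT x|lborel. u x * \<nu> x)" unfolding b_def
  proof (rule integral_dominated_convergence)
    show "integrable lborel (\<lambda>x. \<bar>u x * \<nu> x\<bar>)" using iu by (rule integrable_abs)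
    show "AE x in lborel. (\<lambda>n. \<xi> n x * u x * \<nu> x) \<longlonglongrightarrow> u x * \<nu> x"
    proof (rule AE_I2)
      fix x
      have "(\<lambda>n. \<xi> n x * u x * \<nu> x) \<longlonglongrightarrow> 1 * u x * \<nu> x"
        unfolding \<xi>_def by (intro tendsto_intros cutoff2_tendsto)
      then show "(\<lambda>n. \<xi> n x * u x * \<nu> x) \<longlonglongrightarrow> u x * \<nu> x" by simp
    qed
    show "AE x in lborel. norm (\<xi> n x * u x * \<nu> x) \<le> \<bar>u x * \<nu> x\<bar>" for n
      using bb by (intro AE_I2) (simp only: real_norm_def)
  qed measurable
  have ib: "integrable lborel (\<lambda>x. \<xi> n x * u x * \<nu> x)" for n
  proof (rule Bochner_Integration.integrable_bound[OF iu])
    show "AE x in lborel. norm (\<xi> n x * u x * \<nu> x) \<le> norm (u x * \<nu> x)"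
      using bb by (intro AE_I2) (simp only: real_norm_def)
  qed measurable
  have ab: "(LINT x|lborel. \<xi> n x * v n x * \<nu> x) = a n + b n" for n
    unfolding a_def b_def
    by (subst Bochner_Integration.integral_add[OF ia ib, symmetric]) (simp add: algebra_simps)
  define \<Gamma> where "\<Gamma> = (LINT x|lborel. (g1 x)\<^sup>2) + (LINT x|lborel. (g2 x)\<^sup>2)"
  define U where "U = (LINT x|lborel. (u x)\<^sup>2)"
  define Z where "Z = (\<lambda>n. LINT x|lborel. exp (\<xi> n x * v n x) * \<nu> x)"
  \<comment> \<open>Right side of \<open>onofri_cutoff\<close> for N = n + 1 and
    \<open>\<theta>\<close> = 1 / N, with the mollified norms replaced by those of u and its weak
    derivatives.\<close>
  define B where "B = (\<lambda>n. 1 / 16 * ((1 + 1 / real (Suc n)) * \<Gamma> + (1 + real (Suc n)) * (32 / (real (Suc n))\<^sup>2) * U) + (a n + b n))"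
  have ZB: "integrable lborel (\<lambda>x. exp (\<xi> n x * v n x) * \<nu> x)" "pi * ln (Z n / pi) \<le> B n" for n
  proof -
    note m = mollifierD[OF \<eta>[of n]]
    have ax: "axis k (1::real) \<in> (Basis :: (real ^ 2) set)" for k by (simp add: axis_in_Basis_iff)
    have D: "((\<lambda>t. v n (x + t *\<^sub>R axis k 1)) has_real_derivative conv (\<lambda>z. frechet_derivative (\<eta> n) (at z) (axis k 1)) u (x + t *\<^sub>R axis k 1)) (at t)"
      for x t k unfolding v_def
      by (rule DERIV_conv[OF test_functionD(1)[OF m(4)] test_functionD(2)[OF m(4) ax] _ _ loc(1)])
         (erule m(2) mollifier_derivative_support[OF \<eta>[of n]])+
    have D1: "((\<lambda>t. v n (x + t *\<^sub>R axis 1 1)) has_real_derivative conv (\<eta> n) g1 (x + t *\<^sub>R axis 1 1)) (at t)" for x t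
      using D[of x 1 t] unfolding wd1[OF \<eta>] .
    have D2: "((\<lambda>t. v n (x + t *\<^sub>R axis 2 1)) has_real_derivative conv (\<eta> n) g2 (x + t *\<^sub>R axis 2 1)) (at t)" for x t
      using D[of x 2 t] unfolding wd2[OF \<eta>] .
    note yu = conv_square_integral_le[OF \<eta> loc(1) i(1), of n]
    note y1 = conv_square_integral_le[OF \<eta> loc(2) i(2), of n]
    note y2 = conv_square_integral_le[OF \<eta> loc(3) i(3), of n]
    have vi: "integrable lborel (\<lambda>x. (v n x)\<^sup>2)" using yu(1) by (simp add: v_def)
    note main = onofri_cutoff[OF cv[of n] continuous_conv_mollifier[OF \<eta>[of n] loc(2)] continuous_conv_mollifier[OF \<eta>[of n] loc(3)]
      D1 D2 vi y1(1) y2(1), of "real (Suc n)" "1 / real (Suc n)"]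
    show "integrable lborel (\<lambda>x. exp (\<xi> n x * v n x) * \<nu> x)" unfolding \<xi>_def by (rule main(1)) auto
    have "pi * ln (Z n / pi) \<le> 1 / 16 * ((1 + 1 / real (Suc n)) * ((LINT x|lborel. (conv (\<eta> n) g1 x)\<^sup>2) + (LINT x|lborel. (conv (\<eta> n) g2 x)\<^sup>2))
        + (1 + 1 / (1 / real (Suc n))) * (32 / (real (Suc n))\<^sup>2) * (LINT x|lborel. (v n x)\<^sup>2)) + (LINT x|lborel. \<xi> n x * v n x * \<nu> x)"
      unfolding Z_def \<xi>_def by (rule main(2)) auto
    also have "\<dots> \<le> 1 / 16 * ((1 + 1 / real (Suc n)) * \<Gamma> + (1 + 1 / (1 / real (Suc n))) * (32 / (real (Suc n))\<^sup>2) * U) + (LINT x|lborel. \<xi> n x * v n x * \<nu> x)"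
      unfolding \<Gamma>_def U_def v_def
      by (intro add_mono mult_left_mono yu(2) y1(2) y2(2) order_refl) auto
    finally show "pi * ln (Z n / pi) \<le> B n" by (simp add: ab B_def)
  qed
  define Binf where "Binf = 1 / 16 * \<Gamma> + (LINT x|lborel. u x * \<nu> x)"
  have Blim: "B \<longlonglongrightarrow> Binf"
  proof -
    have l1: "(\<lambda>n. 1 / real (Suc n)) \<longlonglongrightarrow> 0" by (rule LIMSEQ_Suc[OF lim_const_over_n])
    have q: "(1 + r) * (32 / r\<^sup>2) = 32 * (1 / r * (1 / r) + 1 / r)" if "r \<noteq> 0" for r :: real
      using that by (simp add: field_simps power2_eq_square)
    have Beq: "B n = 1 / 16 * ((1 + 1 / real (Suc n)) * \<Gamma> + 32 * (1 / real (Suc n) * (1 / real (Suc n)) + 1 / real (Suc n)) * U) + (a n + b n)" for n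
      unfolding B_def by (subst q) simp_all
    have "(\<lambda>n. 1 / 16 * ((1 + 1 / real (Suc n)) * \<Gamma> + 32 * (1 / real (Suc n) * (1 / real (Suc n)) + 1 / real (Suc n)) * U) + (a n + b n))
        \<longlonglongrightarrow> 1 / 16 * ((1 + 0) * \<Gamma> + 32 * (0 * 0 + 0) * U) + (0 + (LINT x|lborel. u x * \<nu> x))"
      by (intro tendsto_add tendsto_mult tendsto_const l1 lima limb)
    then show ?thesis unfolding Beq[abs_def] Binf_def by simp
  qed
  have Zpos: "Z n \<ge> 0" for n unfolding Z_def
    by (rule Bochner_Integration.integral_nonneg) (rule expnu)
  \<comment> \<open>Fatou's lemma concerns the integrals and not their logarithms, hence the
    exponentiated form. For Z n = 0 the bound is trivial.\<close>
  have Zle: "Z n \<le> pi * exp (B n / pi)" for n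
  proof (cases "Z n = 0")
    case False
    then have "Z n > 0" using Zpos[of n] by simp
    then have "Z n / pi = exp (ln (Z n / pi))" by simp
    also have "\<dots> \<le> exp (B n / pi)" using ZB(2)[of n] by (simp add: field_simps)
    finally show ?thesis by (simp add: field_simps)
  qed simp
  have Nle: "(\<integral>\<^sup>+ x. ennreal (exp (u x) * \<nu> x) \<partial>lborel) \<le> ennreal (pi * exp (Binf / pi))"
  proof -
    have "(\<integral>\<^sup>+ x. ennreal (exp (u x) * \<nu> x) \<partial>lborel) = (\<integral>\<^sup>+ x. liminf (\<lambda>n. ennreal (exp (\<xi> n x * v n x) * \<nu> x)) \<partial>lborel)"
    proof (rule nn_integral_cong_AE)
      show "AE x in lborel. ennreal (exp (u x) * \<nu> x) = liminf (\<lambda>n. ennreal (exp (\<xi> n x * v n x) * \<nu> x))"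
        using vlim
      proof eventually_elim
        case (elim x)
        have "(\<lambda>n. exp (\<xi> n x * v n x) * \<nu> x) \<longlonglongrightarrow> exp (1 * u x) * \<nu> x"
          unfolding \<xi>_def by (intro tendsto_intros cutoff2_tendsto elim)
        then have "(\<lambda>n. ennreal (exp (\<xi> n x * v n x) * \<nu> x)) \<longlonglongrightarrow> ennreal (exp (u x) * \<nu> x)"
          by (intro tendsto_ennrealI) simp
        then show ?case by (intro lim_imp_Liminf[symmetric]) auto
      qed
    qed
    also have "\<dots> \<le> liminf (\<lambda>n. \<integral>\<^sup>+ x. ennreal (exp (\<xi> n x * v n x) * \<nu> x) \<partial>lborel)"
      by (rule nn_integral_liminf) measurable
    also have "\<dots> \<le> liminf (\<lambda>n. ennreal (pi * exp (B n / pi)))"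
    proof (intro Liminf_mono always_eventually allI)
      fix n
      have "(\<integral>\<^sup>+ x. ennreal (exp (\<xi> n x * v n x) * \<nu> x) \<partial>lborel) = ennreal (Z n)"
        unfolding Z_def by (rule nn_integral_eq_integral[OF ZB(1) AE_I2]) (rule expnu)
      then show "(\<integral>\<^sup>+ x. ennreal (exp (\<xi> n x * v n x) * \<nu> x) \<partial>lborel) \<le> ennreal (pi * exp (B n / pi))"
        using Zle[of n] by (simp add: ennreal_leI)
    qed
    also have "liminf (\<lambda>n. ennreal (pi * exp (B n / pi))) = ennreal (pi * exp (Binf / pi))"
      by (intro lim_imp_Liminf tendsto_ennrealI tendsto_intros Blim) auto
    finally show ?thesis .
  qed
  show ie: "integrable lborel (\<lambda>x. exp (u x) * \<nu> x)"
  proof (rule integrableI_nonneg)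
    show "(\<integral>\<^sup>+ x. ennreal (exp (u x) * \<nu> x) \<partial>lborel) < \<infinity>"
      using Nle by (rule order.strict_trans1) simp
    show "AE x in lborel. 0 \<le> exp (u x) * \<nu> x" by (rule AE_I2) (rule expnu)
  qed measurable
  define E where "E = (LINT x|lborel. exp (u x) * \<nu> x)"
  have "ennreal E \<le> ennreal (pi * exp (Binf / pi))"
    using Nle nn_integral_eq_integral[OF ie AE_I2[OF expnu]] by (simp add: E_def)
  then have El: "E \<le> pi * exp (Binf / pi)" by (simp add: ennreal_le_iff)
  \<comment> \<open>Positivity is required to take logarithms back; it holds since the integrand is
    positive everywhere.\<close>
  have "E > 0"
  proof -
    have "E \<ge> 0" unfolding E_def
      by (rule Bochner_Integration.integral_nonneg) (rule expnu)
    moreover have "E \<noteq> 0"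
    proof
      assume "E = 0"
      then have "AE x in lborel. exp (u x) * \<nu> x = 0"
        unfolding E_def using integral_nonneg_eq_0_iff_AE[OF ie AE_I2[OF expnu]] by simp
      then have "AE x in (lborel :: (real ^ 2) measure). False"
        by eventually_elim (use nu(1) in \<open>auto simp: less_imp_neq[symmetric]\<close>)
      then show False by (simp add: ae_filter_eq_bot_iff trivial_limit_def[symmetric])
    qed
    ultimately show ?thesis by simp
  qed
  then have "ln (E / pi) \<le> ln (exp (Binf / pi))" using El by (subst ln_le_cancel_iff) (auto simp: field_simps)
  then have "pi * ln (E / pi) \<le> Binf" by (simp add: field_simps)
  then show "pi * ln ((LINT x|lborel. exp (u x) * \<nu> x) / pi)
      \<le> 1 / 16 * ((LINT x|lborel. (g1 x)\<^sup>2) + (LINT x|lborel. (g2 x)\<^sup>2)) + (LINT x|lborel. u x * \<nu> x)"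
    unfolding E_def Binf_def \<Gamma>_def .
qed

section \<open>Return to Lebesgue measurable functions and to \<open>dmu2\<close>\<close>

lemma borel_representative_integral:
  fixes f f' :: "'a::euclidean_space \<Rightarrow> real"
  assumes "f \<in> borel_measurable lebesgue" and f': "f' \<in> borel_measurable borel" and "AE x in lebesgue. f x = f' x"
  shows "integrable lebesgue f \<longleftrightarrow> integrable lborel f'" "(LINT x|lebesgue. f x) = (LINT x|lborel. f' x)"
proof -
  have l: "f' \<in> borel_measurable lborel" using f' by simp
  have m: "f' \<in> borel_measurable lebesgue" by (rule measurable_completion[OF l])
  show "integrable lebesgue f \<longleftrightarrow> integrable lborel f'"
    using integrable_cong_AE[OF assms(1) m assms(3)] integrable_completion[OF l] by simp
  show "(LINT x|lebesgue. f x) = (LINT x|lborel. f' x)"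
    using integral_cong_AE[OF assms(1) m assms(3)] integral_completion[OF l] by simp
qed

lemma mu2_eq: "mu2 x = \<nu> x / pi"
  by (simp add: mu2_def \<nu>_def)

text \<open>The analysis above is written with \<open>\<nu>\<close>, of total mass pi; the division
  by pi that makes the measure a probability is introduced here.\<close>

lemma dmu2_integral:
  assumes f: "f \<in> borel_measurable lebesgue" and f': "f' \<in> borel_measurable borel" and ae: "AE x in lebesgue. f x = f' x"
  shows "integrable dmu2 f \<longleftrightarrow> integrable lborel (\<lambda>x. f' x * \<nu> x)"
    and "(LINT x|dmu2. f x) = (LINT x|lborel. f' x * \<nu> x) / pi"
proof -
  have nub: "\<nu> \<in> borel_measurable borel" by (rule borel_measurable_continuous_onI[OF nu_facts(3)])
  have mb: "mu2 \<in> borel_measurable borel"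
    using nub unfolding mu2_eq[abs_def] by measurable
  have ml: "mu2 \<in> borel_measurable lebesgue" using mb by (auto intro: measurable_completion)
  have nn: "AE x in lebesgue. 0 \<le> mu2 x" using nu_facts(1) by (simp add: mu2_eq less_imp_le)
  have fm: "(\<lambda>x. mu2 x * f x) \<in> borel_measurable lebesgue" using f ml by measurable
  have fm': "(\<lambda>x. f' x * \<nu> x / pi) \<in> borel_measurable borel" using f' nub by measurable
  have ae': "AE x in lebesgue. mu2 x * f x = f' x * \<nu> x / pi"
    using ae by eventually_elim (simp add: mu2_eq)
  note rep = borel_representative_integral[OF fm fm' ae']
  have "integrable lborel (\<lambda>x. f' x * \<nu> x / pi) \<longleftrightarrow> integrable lborel (\<lambda>x. f' x * \<nu> x)"
    using integrable_mult_left_iff[of lborel "1 / pi" "\<lambda>x. f' x * \<nu> x"] by simp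
  then show "integrable dmu2 f \<longleftrightarrow> integrable lborel (\<lambda>x. f' x * \<nu> x)"
    unfolding dmu2_def using integrable_density[OF f ml nn] rep(1) by simp
  show "(LINT x|dmu2. f x) = (LINT x|lborel. f' x * \<nu> x) / pi"
    unfolding dmu2_def using integral_density[OF f ml nn] rep(2) by simp
qed

lemma has_weak_gradient_weak_gradient:
  "has_weak_gradient u g \<Longrightarrow> has_weak_gradient u (weak_gradient u)"
  unfolding weak_gradient_def by (rule someI[of "has_weak_gradient u"])

text \<open>The estimate is run with the weak gradient \<open>g\<close> that membership in
  \<open>sobolev_H1\<close> provides, since that one is known to be square integrable. The gradient
  picked by \<open>weak_gradient\<close> agrees with it almost everywhere, so the two energies
  coincide.\<close>

lemma onofri_H1:
  fixes u :: "real ^ 2 \<Rightarrow> real"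
  assumes "u \<in> sobolev_H1"
  shows "integrable dmu2 (\<lambda>x. exp (u x))" and "integrable dmu2 u"
    and "ln (LINT x|dmu2. exp (u x)) - (LINT x|dmu2. u x)
      \<le> 1 / (16 * pi) * (LINT x|lebesgue. (norm (weak_gradient u x))\<^sup>2)"
proof -
  obtain g where u: "L2 u" and wg: "has_weak_gradient u g" and g: "L2 g"
    using assms by (auto simp: sobolev_H1_def)
  have wG: "has_weak_gradient u (weak_gradient u)" by (rule has_weak_gradient_weak_gradient[OF wg])
  have li: "locally_integrable u" "locally_integrable g" "locally_integrable (weak_gradient u)"
    using wg wG by (auto simp: has_weak_gradient_def)
  note lii = locally_integrable_inner[OF li(2)]
  have um: "u \<in> borel_measurable lebesgue" and gm: "g \<in> borel_measurable lebesgue"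
    and Gm: "weak_gradient u \<in> borel_measurable lebesgue"
    using li by (auto intro: locally_integrable_measurable)
  obtain u' where u': "loc_int u'" "AE x in lebesgue. u x = u' x" using ex_borel_representative[OF li(1)] .
  obtain g1 where g1: "loc_int g1" "AE x in lebesgue. g x \<bullet> axis 1 1 = g1 x" using ex_borel_representative[OF lii] .
  obtain g2 where g2: "loc_int g2" "AE x in lebesgue. g x \<bullet> axis 2 1 = g2 x" using ex_borel_representative[OF lii] .
  have [measurable]: "u' \<in> borel_measurable borel" "g1 \<in> borel_measurable borel" "g2 \<in> borel_measurable borel"
    using u' g1 g2 by (auto intro: loc_int_measurable)
  have iu: "integrable lborel (\<lambda>x. (u' x)\<^sup>2)"
  proof -
    have "AE x in lebesgue. (u x)\<^sup>2 = (u' x)\<^sup>2" using u'(2) by eventually_elim simp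
    then show ?thesis
      using borel_representative_integral(1)[of "\<lambda>x. (u x)\<^sup>2" "\<lambda>x. (u' x)\<^sup>2"] u um by (simp add: L2_def)
  qed
  have ig: "integrable lborel (\<lambda>x. (h x)\<^sup>2)"
    if h: "h \<in> borel_measurable borel" "AE x in lebesgue. g x \<bullet> axis k 1 = h x" for h k
  proof -
    have m: "(\<lambda>x. (g x \<bullet> axis k 1)\<^sup>2) \<in> borel_measurable lebesgue" using gm by measurable
    have "integrable lebesgue (\<lambda>x. (g x \<bullet> axis k 1)\<^sup>2)"
    proof (rule Bochner_Integration.integrable_bound)
      show "integrable lebesgue (\<lambda>x. (norm (g x))\<^sup>2)" using g by (simp add: L2_def)
      show "AE x in lebesgue. norm ((g x \<bullet> axis k 1)\<^sup>2) \<le> norm ((norm (g x))\<^sup>2)"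
      proof (rule AE_I2)
        fix x
        have "\<bar>g x \<bullet> axis k 1\<bar> \<le> norm (g x)" by (simp add: inner_axis component_le_norm_cart)
        then show "norm ((g x \<bullet> axis k 1)\<^sup>2) \<le> norm ((norm (g x))\<^sup>2)" by (simp add: abs_le_square_iff[symmetric])
      qed
    qed (rule m)
    moreover have "AE x in lebesgue. (g x \<bullet> axis k 1)\<^sup>2 = (h x)\<^sup>2" using h(2) by eventually_elim simp
    ultimately show ?thesis
      using borel_representative_integral(1)[OF m, of "\<lambda>x. (h x)\<^sup>2"] h(1) by simp
  qed
  have ig1: "integrable lborel (\<lambda>x. (g1 x)\<^sup>2)" by (rule ig[OF _ g1(2)]) measurable
  have ig2: "integrable lborel (\<lambda>x. (g2 x)\<^sup>2)" by (rule ig[OF _ g2(2)]) measurable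
  have ax: "axis k (1::real) \<in> (Basis :: (real ^ 2) set)" for k by (simp add: axis_in_Basis_iff)
  note main = onofri_borel[OF u'(1) g1(1) g2(1) iu ig1 ig2
      conv_weak_gradient[OF wg _ ax u' g1] conv_weak_gradient[OF wg _ ax u' g2]]
  have eae: "AE x in lebesgue. exp (u x) = exp (u' x)" using u'(2) by eventually_elim simp
  have em: "(\<lambda>x. exp (u x)) \<in> borel_measurable lebesgue" using um by measurable
  have em': "(\<lambda>x. exp (u' x)) \<in> borel_measurable borel" by measurable
  note te = dmu2_integral[OF em em' eae]
  note tu = dmu2_integral[OF um loc_int_measurable[OF u'(1)] u'(2)]
  have m1: "integrable lborel (\<lambda>x. exp (u' x) * \<nu> x)" by (rule main(1))
  have m2: "integrable lborel (\<lambda>x. u' x * \<nu> x)" by (rule main(2))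
  have m3: "pi * ln ((LINT x|lborel. exp (u' x) * \<nu> x) / pi)
      \<le> 1 / 16 * ((LINT x|lborel. (g1 x)\<^sup>2) + (LINT x|lborel. (g2 x)\<^sup>2)) + (LINT x|lborel. u' x * \<nu> x)" by (rule main(3))
  show "integrable dmu2 (\<lambda>x. exp (u x))" using te(1) m1 by simp
  show "integrable dmu2 u" using tu(1) m2 by simp
  have "(LINT x|lebesgue. (norm (weak_gradient u x))\<^sup>2) = (LINT x|lborel. (g1 x)\<^sup>2 + (g2 x)\<^sup>2)"
  proof (rule borel_representative_integral(2))
    show "(\<lambda>x. (norm (weak_gradient u x))\<^sup>2) \<in> borel_measurable lebesgue" using Gm by measurable
    show "(\<lambda>x. (g1 x)\<^sup>2 + (g2 x)\<^sup>2) \<in> borel_measurable borel" by measurable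
    show "AE x in lebesgue. (norm (weak_gradient u x))\<^sup>2 = (g1 x)\<^sup>2 + (g2 x)\<^sup>2"
      using weak_gradient_unique[OF wG wg] g1(2) g2(2)
      by eventually_elim (simp add: norm_square_vec2 inner_axis)
  qed
  also have "\<dots> = (LINT x|lborel. (g1 x)\<^sup>2) + (LINT x|lborel. (g2 x)\<^sup>2)"
    by (rule Bochner_Integration.integral_add[OF ig1 ig2])
  finally have G: "(LINT x|lebesgue. (norm (weak_gradient u x))\<^sup>2) = \<dots>" .
  show "ln (LINT x|dmu2. exp (u x)) - (LINT x|dmu2. u x)
      \<le> 1 / (16 * pi) * (LINT x|lebesgue. (norm (weak_gradient u x))\<^sup>2)"
  proof -
    have "L - I / pi \<le> 1 / (16 * pi) * D" if "pi * L \<le> 1 / 16 * D + I" for L I D :: real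
    proof -
      have "L \<le> (1 / 16 * D + I) / pi" using that by (simp add: pos_le_divide_eq mult.commute)
      then show ?thesis by (simp add: add_divide_distrib)
    qed
    from this[OF m3] show ?thesis unfolding G te(2) tu(2) .
  qed
qed

lemma zero_has_weak_gradient: "has_weak_gradient (\<lambda>x::'a::euclidean_space. 0) (\<lambda>x. 0)"
  by (simp add: has_weak_gradient_def locally_integrable_def set_integrable_def)

lemma zero_in_sobolev_H1: "(\<lambda>x. 0) \<in> sobolev_H1"
  unfolding sobolev_H1_def using zero_has_weak_gradient by (auto simp: L2_def)

lemma weak_gradient_zero: "AE x in lebesgue. weak_gradient (\<lambda>x::'a::euclidean_space. 0 :: real) x = 0"
proof -
  have "has_weak_gradient (\<lambda>x::'a. 0) (weak_gradient (\<lambda>x. 0))"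
    by (rule has_weak_gradient_weak_gradient[OF zero_has_weak_gradient])
  from weak_gradient_unique[OF this zero_has_weak_gradient] show ?thesis .
qed

text \<open>Since a non-integrable function has integral 0 by convention, integrability of u and of
  e^u is asserted together with the inequality. Membership of the zero function in the space is what
  makes the equality a statement about an optimal function.\<close>

theorem theorem3p3:
  shows "(\<forall>u \<in> sobolev_H1 :: (real ^ 2 \<Rightarrow> real) set.
            integrable dmu2 (\<lambda>x. exp (u x)) \<and> integrable dmu2 u \<and>
            ln (LINT x|dmu2. exp (u x)) - (LINT x|dmu2. u x)
              \<le> 1 / (16 * pi) * (LINT x|lebesgue. (norm (weak_gradient u x))\<^sup>2))
       \<and> (\<lambda>x. 0) \<in> (sobolev_H1 :: (real ^ 2 \<Rightarrow> real) set)
       \<and> ln (LINT x|dmu2. exp ((\<lambda>x. 0 :: real) x)) - (LINT x|dmu2. (\<lambda>x. 0 :: real) x)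
           = 1 / (16 * pi) *
               (LINT x|lebesgue. (norm (weak_gradient (\<lambda>x :: real ^ 2. 0) x))\<^sup>2)"
proof (intro conjI ballI)
  have "(LINT x|dmu2. 1) = (1::real)"
    using dmu2_integral(2)[of "\<lambda>_. 1" "\<lambda>_. 1"] nu_facts(5) by simp
  \<comment> \<open>The gradient of the zero function chosen by \<open>weak_gradient\<close> is
    known to vanish only almost everywhere, which suffices under the integral.\<close>
  moreover have "(LINT x|lebesgue. (norm (weak_gradient (\<lambda>x :: real ^ 2. 0) x))\<^sup>2) = 0"
  proof (rule integral_eq_zero_AE)
    show "AE x in lebesgue. (norm (weak_gradient (\<lambda>x :: real ^ 2. 0) x))\<^sup>2 = 0"
      using weak_gradient_zero by eventually_elim simp
  qed
  ultimately show "ln (LINT x|dmu2. exp ((\<lambda>x. 0 :: real) x)) - (LINT x|dmu2. (\<lambda>x. 0 :: real) x)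
           = 1 / (16 * pi) *
               (LINT x|lebesgue. (norm (weak_gradient (\<lambda>x :: real ^ 2. 0) x))\<^sup>2)"
    by simp
qed (rule onofri_H1 zero_in_sobolev_H1; assumption?)+

end
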